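(* Let $\mathfrak{c}$ denote the cardinality of the continuum. (1) The mapping class group of the Prüfer surface $\mathsf{P}$ (which is contractible) has cardinality $\ge\mathfrak{c}$. (2) There is a contractible Type I surface whose mapping class group has cardinality $\ge\mathfrak{c}$.
   Context: A surface is a connected Hausdorff space each of whose points has a neighborhood homeomorphic to $\mathbb{R}^2$ (no metrizability assumed). A space $X$ is of Type I if it is non-Lindelöf and $X=\bigcup_{\alpha\in\omega_1}X_\alpha$, where each $X_\alpha$ is open, each $\overline{X_\alpha}$ is Lindelöf, and $\overline{X_\alpha}\subset X_\beta$ whenever $\alpha<\beta<\omega_1$. Two homeomorphisms of a space $X$ are isotopic if there is a homotopy $h_t$ ($t\in[0,1]$) between them such that $h_t$ is a homeomorphism of $X$ for each $t\in[0,1]$. The mapping class group of $X$ is the group of homeomorphisms of $X$ quotiented by isotopy classes. The Prüfer surface $\mathsf{P}$ is a surface with boundary defined as follows. Let $H_0=\{\langle x,y\rangle\in\mathbb{R}^2: x>0\}$, and for each $c\in\mathbb{R}$ let $\mathbb{R}_c$ be a copy of $\mathbb{R}$; for $E\subset\mathbb{R}$ write $E_c$ for the copy of $E$ in $\mathbb{R}_c$. As a set, $\mathsf{P}$ is the disjoint union $H_0\cup\bigcup_{c\in\mathbb{R}}\mathbb{R}_c$. Points of $H_0$ have their usual Euclidean neighborhoods (with $H_0$ open in $\mathsf{P}$), and a neighborhood basis of $u\in\mathbb{R}_c$ is given by the sets $$T^c_{a,b,\epsilon}=(a,b)_c\cup\{\langle x,y\rangle\in H_0: ax+c<y<bx+c,\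 x<\epsilon\}$$ for $a<u<b$ and $\epsilon>0$. *)

theory Defs
  imports "HOL-Analysis.Analysis" "HOL-Algebra.Bij" "HOL-Algebra.Coset"
begin

section \<open>Surfaces and spaces of Type I\<close>

text \<open>Neighborhoods are not required to be open, and no metrizability or countability is assumed.\<close>

definition surface :: "'a topology \<Rightarrow> bool" where
  "surface X \<longleftrightarrow> connected_space X \<and> Hausdorff_space X \<and>
     (\<forall>x\<in>topspace X. \<exists>U N. openin X U \<and> x \<in> U \<and> U \<subseteq> N \<and> N \<subseteq> topspace X \<and>
        subtopology X N homeomorphic_space (euclidean :: (real \<times> real) topology))"

text \<open>
  The cardinal successor of the standard order on the natural numbers is a well-order of order
  type \<open>\<omega>\<^sub>1\<close>; its field serves as the index set, and \<open>\<alpha> < \<beta>\<close> reads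
  \<open>(\<alpha>, \<beta>) \<in> omega1 \<and> \<alpha> \<noteq> \<beta>\<close> because the relation is reflexive on its field.
\<close>

definition omega1 :: "nat set rel" where
  "omega1 = cardSuc natLeq"

definition type_I :: "'a topology \<Rightarrow> bool" where
  "type_I X \<longleftrightarrow> \<not> Lindelof_space X \<and>
     (\<exists>W :: nat set \<Rightarrow> 'a set.
        topspace X = (\<Union>\<alpha>\<in>Field omega1. W \<alpha>) \<and>
        (\<forall>\<alpha>\<in>Field omega1. openin X (W \<alpha>) \<and> Lindelof_space (subtopology X (X closure_of W \<alpha>))) \<and>
        (\<forall>\<alpha> \<beta>. (\<alpha>, \<beta>) \<in> omega1 \<and> \<alpha> \<noteq> \<beta> \<longrightarrow> X closure_of W \<alpha> \<subseteq> W \<beta>))"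


section \<open>The mapping class group\<close>

text \<open>
  As in \<^const>\<open>BijGroup\<close>, self-homeomorphisms are represented by extensional functions, so
  that each one is counted once, whatever the values outside the carrier of the space.
\<close>

definition homeo_group :: "'a topology \<Rightarrow> ('a \<Rightarrow> 'a) monoid" where
  "homeo_group X = BijGroup (topspace X)
     \<lparr>carrier := {f \<in> extensional (topspace X). homeomorphic_map X X f}\<rparr>"

definition isotopic :: "'a topology \<Rightarrow> ('a \<Rightarrow> 'a) \<Rightarrow> ('a \<Rightarrow> 'a) \<Rightarrow> bool" where
  "isotopic X = homotopic_with (homeomorphic_map X X) X X"

definition isotopy_rel :: "'a topology \<Rightarrow> ('a \<Rightarrow> 'a) rel" where
  "isotopy_rel X = {(f, g). f \<in> carrier (homeo_group X) \<and> g \<in> carrier (homeo_group X) \<and> isotopic X f g}"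

text \<open>
  The elements are the isotopy classes of self-homeomorphisms. Classes are multiplied as subsets
  of the group of homeomorphisms, as for quotient groups in \<^const>\<open>FactGroup\<close>; by the lemma
  \<open>isotopy_class_mult\<close> below this is the product induced by composition of representatives.
\<close>

definition mapping_class_group :: "'a topology \<Rightarrow> ('a \<Rightarrow> 'a) set monoid" where
  "mapping_class_group X =
     \<lparr>carrier = carrier (homeo_group X) // isotopy_rel X,
      mult = set_mult (homeo_group X),
      one = isotopy_rel X `` {\<one>\<^bsub>homeo_group X\<^esub>}\<rparr>"

lemma homeo_group_carrier:
  "carrier (homeo_group X) = {f \<in> extensional (topspace X). homeomorphic_map X X f}"
  by (simp add: homeo_group_def)

lemma homeo_in_Bij: "f \<in> carrier (homeo_group X) \<Longrightarrow> f \<in> Bij (topspace X)"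
  by (auto simp: homeo_group_carrier Bij_def bij_betw_def homeomorphic_eq_everything_map)

lemma homeo_group_mult:
  assumes "f \<in> carrier (homeo_group X)" "g \<in> carrier (homeo_group X)"
  shows "f \<otimes>\<^bsub>homeo_group X\<^esub> g = compose (topspace X) f g"
  using assms[THEN homeo_in_Bij] by (simp add: homeo_group_def BijGroup_def)

lemma homeo_group_one: "\<one>\<^bsub>homeo_group X\<^esub> = (\<lambda>x\<in>topspace X. x)"
  by (simp add: homeo_group_def BijGroup_def)

lemma group_homeo_group: "group (homeo_group X)"
proof (rule groupI)
  let ?G = "homeo_group X" and ?S = "topspace X"
  show one: "\<one>\<^bsub>?G\<^esub> \<in> carrier ?G"
    using homeomorphic_map_eq[of X X id "\<lambda>x\<in>topspace X. x"]
    by (simp add: homeo_group_one homeo_group_carrier)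
  show closed: "f \<otimes>\<^bsub>?G\<^esub> g \<in> carrier ?G" if "f \<in> carrier ?G" "g \<in> carrier ?G" for f g
    using that homeomorphic_map_eq[OF homeomorphic_map_compose, of X X g X f "compose ?S f g"]
    by (simp add: homeo_group_mult) (auto simp: homeo_group_carrier compose_def)
  show "f \<otimes>\<^bsub>?G\<^esub> g \<otimes>\<^bsub>?G\<^esub> h = f \<otimes>\<^bsub>?G\<^esub> (g \<otimes>\<^bsub>?G\<^esub> h)"
    if "f \<in> carrier ?G" "g \<in> carrier ?G" "h \<in> carrier ?G" for f g h
    using that closed[of f g] closed[of g h] Bij_imp_funcset[OF homeo_in_Bij, of h X]
    by (simp add: homeo_group_mult compose_assoc)
  show "\<one>\<^bsub>?G\<^esub> \<otimes>\<^bsub>?G\<^esub> f = f" if "f \<in> carrier ?G" for f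
    using that one Bij_imp_funcset[OF homeo_in_Bij, of f X]
    by (simp add: homeo_group_mult) (simp add: homeo_group_one homeo_group_carrier)
  show "\<exists>g\<in>carrier ?G. g \<otimes>\<^bsub>?G\<^esub> f = \<one>\<^bsub>?G\<^esub>" if f: "f \<in> carrier ?G" for f
  proof -
    obtain g where g: "homeomorphic_maps X X f g"
      using f by (auto simp: homeo_group_carrier homeomorphic_map_maps)
    have "homeomorphic_map X X g"
      using g homeomorphic_maps_map by blast
    then have "restrict g ?S \<in> carrier ?G"
      using homeomorphic_map_eq[of X X g "restrict g ?S"] by (simp add: homeo_group_carrier)
    moreover have "compose ?S (restrict g ?S) f = (\<lambda>x\<in>?S. x)"
      using g f Bij_imp_funcset[OF homeo_in_Bij[OF f]]
      by (fastforce simp: compose_def homeomorphic_maps_def)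
    ultimately show ?thesis
      using f by (metis homeo_group_mult homeo_group_one)
  qed
qed

lemma isotopic_cong:
  assumes "isotopic X f g" "\<And>x. x \<in> topspace X \<Longrightarrow> f x = f' x" "\<And>x. x \<in> topspace X \<Longrightarrow> g x = g' x"
  shows "isotopic X f' g'"
  unfolding isotopic_def
proof (rule homotopic_with_eq)
  show "homotopic_with (homeomorphic_map X X) X X f g" using assms(1) by (simp add: isotopic_def)
  show "homeomorphic_map X X h \<longleftrightarrow> homeomorphic_map X X k" if "\<And>x. x \<in> topspace X \<Longrightarrow> h x = k x" for h k
    using that homeomorphic_map_eq[of X X h k] homeomorphic_map_eq[of X X k h] by metis
qed (use assms in auto)

lemma equiv_isotopy_rel: "equiv (carrier (homeo_group X)) (isotopy_rel X)"
proof (rule equivI)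
  show "refl_on (carrier (homeo_group X)) (isotopy_rel X)"
    by (auto simp: refl_on_def isotopy_rel_def isotopic_def homeo_group_carrier
        homeomorphic_imp_continuous_map)
  show "sym (isotopy_rel X)"
    by (auto simp: sym_def isotopy_rel_def isotopic_def intro: homotopic_with_symD)
  show "trans (isotopy_rel X)"
    by (auto simp: trans_def isotopy_rel_def isotopic_def intro: homotopic_with_trans)
qed (auto simp: isotopy_rel_def)

lemma isotopy_rel_mult:
  assumes "(f, f') \<in> isotopy_rel X" "(g, g') \<in> isotopy_rel X"
  shows "(f \<otimes>\<^bsub>homeo_group X\<^esub> g, f' \<otimes>\<^bsub>homeo_group X\<^esub> g') \<in> isotopy_rel X"
proof -
  let ?G = "homeo_group X"
  interpret group ?G by (rule group_homeo_group)
  have mem: "f \<in> carrier ?G" "f' \<in> carrier ?G" "g \<in> carrier ?G" "g' \<in> carrier ?G"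
    and iso: "isotopic X f f'" "isotopic X g g'"
    using assms by (auto simp: isotopy_rel_def)
  have 1: "homotopic_with (homeomorphic_map X X) X X (f \<circ> g) (f' \<circ> g)"
    using iso(1) mem
    by (intro homotopic_with_compose_continuous_map_right[of "homeomorphic_map X X" X])
      (auto simp: isotopic_def homeo_group_carrier homeomorphic_imp_continuous_map
        intro: homeomorphic_map_compose)
  have 2: "homotopic_with (homeomorphic_map X X) X X (f' \<circ> g) (f' \<circ> g')"
    using iso(2) mem
    by (intro homotopic_with_compose_continuous_map_left[of "homeomorphic_map X X" X X])
      (auto simp: isotopic_def homeo_group_carrier homeomorphic_imp_continuous_map
        intro: homeomorphic_map_compose)
  have "isotopic X (f \<circ> g) (f' \<circ> g')"
    unfolding isotopic_def using 1 2 by (rule homotopic_with_trans)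
  then have "isotopic X (f \<otimes>\<^bsub>?G\<^esub> g) (f' \<otimes>\<^bsub>?G\<^esub> g')"
    by (rule isotopic_cong) (auto simp: homeo_group_mult mem compose_def)
  then show ?thesis
    using mem by (simp add: isotopy_rel_def)
qed

lemma isotopy_class_mult:
  assumes f: "f \<in> carrier (homeo_group X)" and g: "g \<in> carrier (homeo_group X)"
  shows "isotopy_rel X `` {f} \<otimes>\<^bsub>mapping_class_group X\<^esub> isotopy_rel X `` {g} =
         isotopy_rel X `` {f \<otimes>\<^bsub>homeo_group X\<^esub> g}"
proof -
  let ?G = "homeo_group X"
  interpret group ?G by (rule group_homeo_group)
  have "k \<in> isotopy_rel X `` {f} <#>\<^bsub>?G\<^esub> isotopy_rel X `` {g}"
    if "(f \<otimes>\<^bsub>?G\<^esub> g, k) \<in> isotopy_rel X" for k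
  proof -
    have k: "k \<in> carrier ?G" using that by (simp add: isotopy_rel_def)
    have refl: "(h, h) \<in> isotopy_rel X" if "h \<in> carrier ?G" for h
      using that equiv_isotopy_rel[of X] by (simp add: equiv_def refl_on_def)
    have "(inv\<^bsub>?G\<^esub> f \<otimes>\<^bsub>?G\<^esub> (f \<otimes>\<^bsub>?G\<^esub> g), inv\<^bsub>?G\<^esub> f \<otimes>\<^bsub>?G\<^esub> k) \<in> isotopy_rel X"
      using isotopy_rel_mult[OF refl that, of "inv\<^bsub>?G\<^esub> f"] f by simp
    then have "(g, inv\<^bsub>?G\<^esub> f \<otimes>\<^bsub>?G\<^esub> k) \<in> isotopy_rel X"
      using f g by (simp flip: m_assoc)
    moreover have "k = f \<otimes>\<^bsub>?G\<^esub> (inv\<^bsub>?G\<^esub> f \<otimes>\<^bsub>?G\<^esub> k)"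
      using f k by (simp flip: m_assoc)
    ultimately show ?thesis
      using refl[OF f] unfolding set_mult_def by blast
  qed
  then show ?thesis
    by (auto simp: mapping_class_group_def set_mult_def intro: isotopy_rel_mult)
qed

lemma group_mapping_class_group: "group (mapping_class_group X)"
proof -
  let ?G = "homeo_group X" and ?M = "mapping_class_group X" and ?c = "\<lambda>f. isotopy_rel X `` {f}"
  interpret group ?G by (rule group_homeo_group)
  have carr: "carrier ?M = ?c ` carrier ?G"
    by (auto simp: mapping_class_group_def quotient_def)
  have one: "\<one>\<^bsub>?M\<^esub> = ?c \<one>\<^bsub>?G\<^esub>" by (simp add: mapping_class_group_def)
  have inv: "\<exists>y\<in>carrier ?M. y \<otimes>\<^bsub>?M\<^esub> ?c f = \<one>\<^bsub>?M\<^esub>" if "f \<in> carrier ?G" for f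
    using that by (intro bexI[of _ "?c (inv\<^bsub>?G\<^esub> f)"]) (auto simp: carr one isotopy_class_mult)
  show ?thesis
    by (rule groupI) (use inv in \<open>auto simp: carr one isotopy_class_mult m_assoc\<close>)
qed


section \<open>The Pruefer surface\<close>

text \<open>
  \<open>Half x y\<close> is the point \<open>(x, y)\<close> of the half-plane, which belongs to the surface only
  for \<open>x > 0\<close>; \<open>Edge c u\<close> is the copy of \<open>u\<close> in the boundary line with index \<open>c\<close>.
\<close>

datatype pruefer_point = Half real real | Edge real real

definition pruefer_carrier :: "pruefer_point set" where
  "pruefer_carrier = {Half x y | x y. 0 < x} \<union> range (\<lambda>(c, u). Edge c u)"

definition pruefer_T :: "real \<Rightarrow> real \<Rightarrow> real \<Rightarrow> real \<Rightarrow> pruefer_point set" where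
  "pruefer_T c a b \<epsilon> = {Edge c u | u. a < u \<and> u < b} \<union>
     {Half x y | x y. 0 < x \<and> a * x + c < y \<and> y < b * x + c \<and> x < \<epsilon>}"

text \<open>A set is open iff it contains a basic neighborhood of each of its points.\<close>

definition pruefer_open :: "pruefer_point set \<Rightarrow> bool" where
  "pruefer_open U \<longleftrightarrow> U \<subseteq> pruefer_carrier \<and>
     open {(x, y). Half x y \<in> U} \<and>
     (\<forall>c u. Edge c u \<in> U \<longrightarrow>
        (\<exists>a b \<epsilon>. a < u \<and> u < b \<and> 0 < \<epsilon> \<and> pruefer_T c a b \<epsilon> \<subseteq> U))"

definition pruefer :: "pruefer_point topology" where
  "pruefer = topology pruefer_open"

lemma pruefer_T_mono:
  assumes "a' \<le> a" "b \<le> b'" "\<epsilon> \<le> \<epsilon>'"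
  shows "pruefer_T c a b \<epsilon> \<subseteq> pruefer_T c a' b' \<epsilon>'"
proof -
  have "a' * x \<le> a * x" "b * x \<le> b' * x" if "0 < x" for x
    using that assms by (auto intro: mult_right_mono)
  then show ?thesis
    using assms unfolding pruefer_T_def by fastforce
qed

lemma istopology_pruefer_open: "istopology pruefer_open"
  unfolding istopology_def
proof (intro conjI allI impI)
  fix S T assume S: "pruefer_open S" and T: "pruefer_open T"
  have "{(x, y). Half x y \<in> S \<inter> T} = {(x, y). Half x y \<in> S} \<inter> {(x, y). Half x y \<in> T}" by auto
  moreover have "\<exists>a b \<epsilon>. a < u \<and> u < b \<and> 0 < \<epsilon> \<and> pruefer_T c a b \<epsilon> \<subseteq> S \<inter> T"
    if cu: "Edge c u \<in> S \<inter> T" for c u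
  proof -
    obtain a b e where 1: "a < u" "u < b" "0 < e" "pruefer_T c a b e \<subseteq> S"
      using S cu unfolding pruefer_open_def by (meson IntD1)
    obtain a' b' e' where 2: "a' < u" "u < b'" "0 < e'" "pruefer_T c a' b' e' \<subseteq> T"
      using T cu unfolding pruefer_open_def by (meson IntD2)
    have "pruefer_T c (max a a') (min b b') (min e e') \<subseteq> S \<inter> T"
      using 1(4) 2(4) pruefer_T_mono[of a "max a a'" "min b b'" b "min e e'" e c]
        pruefer_T_mono[of a' "max a a'" "min b b'" b' "min e e'" e' c] by auto
    moreover have "max a a' < u" "u < min b b'" "0 < min e e'" using 1 2 by auto
    ultimately show ?thesis by blast
  qed
  ultimately show "pruefer_open (S \<inter> T)"
    using S T unfolding pruefer_open_def by (auto simp: open_Int)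
next
  fix K assume K: "\<forall>S\<in>K. pruefer_open S"
  have "{(x, y). Half x y \<in> \<Union>K} = (\<Union>S\<in>K. {(x, y). Half x y \<in> S})" by auto
  then have "open {(x, y). Half x y \<in> \<Union>K}"
    using K by (simp add: pruefer_open_def open_UN)
  moreover have "\<exists>a b \<epsilon>. a < u \<and> u < b \<and> 0 < \<epsilon> \<and> pruefer_T c a b \<epsilon> \<subseteq> \<Union>K"
    if "Edge c u \<in> \<Union>K" for c u
    using K that unfolding pruefer_open_def by (meson Union_iff Union_upper subset_trans)
  moreover have "\<Union>K \<subseteq> pruefer_carrier"
    using K unfolding pruefer_open_def by blast
  ultimately show "pruefer_open (\<Union>K)"
    unfolding pruefer_open_def by blast
qed

lemma openin_pruefer: "openin pruefer = pruefer_open"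
  by (simp add: pruefer_def istopology_pruefer_open topology_inverse')

lemma topspace_pruefer: "topspace pruefer = pruefer_carrier"
proof -
  have "{(x, y). Half x y \<in> pruefer_carrier} = {0<..} \<times> UNIV"
    by (auto simp: pruefer_carrier_def)
  moreover have "\<exists>a b \<epsilon>. a < u \<and> u < b \<and> 0 < \<epsilon> \<and> pruefer_T c a b \<epsilon> \<subseteq> pruefer_carrier" for c u
    by (intro exI[of _ "u - 1"] exI[of _ "u + 1"] exI[of _ 1])
      (auto simp: pruefer_T_def pruefer_carrier_def)
  ultimately have "pruefer_open pruefer_carrier"
    unfolding pruefer_open_def
    by (simp add: open_Times)
  then show ?thesis
    unfolding topspace_def openin_pruefer by (auto simp: pruefer_open_def)
qed

end

theory Submission
  imports Defs
begin

text \<open>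
  The Pruefer surface. Near the boundary line with index \<open>c\<close> the coordinates are \<open>x\<close> and the slope
  \<open>u = (y - c) / x\<close>. The half-plane contracts, so it suffices to push the boundary inside. A
  homotopy that leaves a boundary line at once cannot be continuous at the start, because the points
  of the line are told apart only by their slopes. Hence the slopes are first scaled down to \<open>0\<close>:
  a map \<open>(x, y) \<mapsto> (x', y)\<close> multiplies the slopes with respect to all lines simultaneously by
  \<open>x / x'\<close>. Once every line is collapsed to its point of slope \<open>0\<close>, everything can be translated to
  the right (\<open>contractible_pruefer\<close>). The translations \<open>(x, y) \<mapsto> (x, y + s)\<close> are pairwise not
  isotopic: by invariance of domain each stage of an isotopy preserves the boundary, whose
  components are the lines, so a boundary point cannot change its line
  (\<open>lepoll_mapping_class_group_pruefer\<close>).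

  The surface of Type I. It is a thickened Aronszajn tree, called \<open>bush\<close> below. A branch is a function
  \<open>u\<close> that assigns an integer to each ordinal below some countable ordinal \<open>\<alpha>\<close>. Only those \<open>u\<close> are
  used that differ at finitely many places from a member \<open>e\<^sub>\<alpha>\<close> of a coherent family, so that there
  are countably many branches of each length; and the weights \<open>2\<^bsup>-|e\<^sub>\<alpha> \<xi>|\<^esup>\<close> are summable over
  \<open>\<xi> < \<alpha>\<close> (\<open>coherent_labellings_exist\<close>). A branch carries an open strip
  \<open>{..<h} \<times> {-1<..<1}\<close>, where \<open>h\<close> is the sum of the weights along the branch, the two lowest levels
  having weight \<open>1\<close>. Two strips are identified as long as the branches agree. Where the labels start
  to differ, say \<open>k\<close> and \<open>l\<close>, the two strips run with the slopes \<open>4 k\<close> and \<open>4 l\<close> through a common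
  block: they overlap on the first half of the block at most and are disjoint from there on. All
  transition maps extend to continuous maps of the plane, so the result is a Hausdorff surface
  (\<open>surface_bush\<close>). The points on levels below \<open>\<alpha>\<close> form an open Lindelof set, and these sets exhaust the surface (\<open>type_I_bush\<close>).

  For contractibility it is decisive that the heights are real numbers. First every strip is
  narrowed to its centre line. In a block with two strips this is only possible if the points of
  the overlap also move down towards the bottom of the block, by the same factor; the function
  \<open>squeeze\<close> describes this movement, and as it is a Lipschitz function of the height the movement is
  continuous also at limit levels. What remains is the tree of centre lines, where every point moves
  down by multiplying its height with \<open>1 - t\<close> (\<open>contractible_bush\<close>).

  For each \<open>f :: int \<Rightarrow> int\<close> there is a shear of the surface: on the second level of the tree, in the
  block below which the label is \<open>k\<close>, it moves each strip sideways by \<open>f k\<close> places, together with all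
  that is above. Given an isotopy between two shears, the Lindelof property yields a level \<open>\<alpha>\<close> such
  that all stages preserve the part below \<open>\<alpha>\<close>, hence also its frontier
  (\<open>isotopy_invariant_frontier\<close>). The frontier is a disjoint union of relatively open intervals, one
  for each branch of length \<open>\<alpha>\<close>; so both shears permute the branches in the same way and are equal
  (\<open>lepoll_mapping_class_group_bush\<close>).
\<close>

section \<open>Spaces covered by open charts\<close>

definition chart_cover :: "'i set \<Rightarrow> ('i \<Rightarrow> 'b topology) \<Rightarrow> ('i \<Rightarrow> 'b \<Rightarrow> 'a) \<Rightarrow> 'a topology \<Rightarrow> bool" where
  "chart_cover I S \<Psi> X \<longleftrightarrow>
     (\<forall>v\<in>I. continuous_map (S v) X (\<Psi> v) \<and> open_map (S v) X (\<Psi> v)) \<and>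
     topspace X = (\<Union>v\<in>I. \<Psi> v ` topspace (S v))"

text \<open>
  Open charts make \<open>X\<close> a quotient of the disjoint union of their domains: the preimage of an open
  set under \<open>g\<close> is the union of the images of open sets of coordinates.
\<close>

lemma continuous_map_from_charts:
  assumes cover: "chart_cover I S \<Psi> X"
    and cont: "\<And>v. v \<in> I \<Longrightarrow> continuous_map (S v) Y (\<lambda>a. g (\<Psi> v a))"
  shows "continuous_map X Y g"
  unfolding continuous_map
proof (intro conjI allI impI)
  show "g ` topspace X \<subseteq> topspace Y"
  proof (rule image_subsetI)
    fix x assume "x \<in> topspace X"
    then obtain v a where va: "v \<in> I" "a \<in> topspace (S v)" "x = \<Psi> v a"
      using cover by (auto simp: chart_cover_def)
    then show "g x \<in> topspace Y"
      using continuous_map_image_subset_topspace[OF cont[OF va(1)]] by auto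
  qed
  fix V assume V: "openin Y V"
  have "openin X (\<Psi> v ` {a \<in> topspace (S v). g (\<Psi> v a) \<in> V})" if "v \<in> I" for v
  proof -
    have "openin (S v) {a \<in> topspace (S v). g (\<Psi> v a) \<in> V}"
      using openin_continuous_map_preimage[OF cont[OF that] V] .
    then show ?thesis
      using that cover by (simp add: chart_cover_def open_map_def)
  qed
  moreover have "{x \<in> topspace X. g x \<in> V} = (\<Union>v\<in>I. \<Psi> v ` {a \<in> topspace (S v). g (\<Psi> v a) \<in> V})"
    using cover unfolding chart_cover_def by auto
  ultimately show "openin X {x \<in> topspace X. g x \<in> V}"
    by (auto intro: openin_Union)
qed

lemma open_map_times_id:
  assumes "open_map S X f"
  shows "open_map (prod_topology T S) (prod_topology T X) (\<lambda>(t, a). (t, f a))"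
  unfolding open_map_def
proof (intro allI impI)
  fix U assume U: "openin (prod_topology T S) U"
  show "openin (prod_topology T X) ((\<lambda>(t, a). (t, f a)) ` U)"
    unfolding openin_prod_topology_alt
  proof (intro allI impI)
    fix t x assume "(t, x) \<in> (\<lambda>(t, a). (t, f a)) ` U"
    then obtain a where a: "(t, a) \<in> U" "x = f a" by auto
    then obtain P Q where "openin T P" "openin S Q" "t \<in> P" "a \<in> Q" "P \<times> Q \<subseteq> U"
      using U unfolding openin_prod_topology_alt by meson
    moreover have "P \<times> f ` Q \<subseteq> (\<lambda>(t, a). (t, f a)) ` U"
      using \<open>P \<times> Q \<subseteq> U\<close> by force
    ultimately show "\<exists>P Q. openin T P \<and> openin X Q \<and> t \<in> P \<and> x \<in> Q \<and> P \<times> Q \<subseteq> (\<lambda>(t, a). (t, f a)) ` U"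
      using assms a unfolding open_map_def by blast
  qed
qed

text \<open>
  Homotopies out of \<open>X\<close> are maps out of a product; so they can be defined in charts of \<open>X\<close> as well.
\<close>

lemma chart_cover_times:
  assumes "chart_cover I S \<Psi> X"
  shows "chart_cover I (\<lambda>v. prod_topology T (S v)) (\<lambda>v (t, a). (t, \<Psi> v a)) (prod_topology T X)"
proof -
  have "continuous_map (prod_topology T (S v)) (prod_topology T X) (\<lambda>(t, a). (t, \<Psi> v a))"
    if "v \<in> I" for v
  proof -
    have "continuous_map (S v) X (\<Psi> v)" using assms that by (simp add: chart_cover_def)
    then show ?thesis
      using continuous_map_prod_top[of T "S v" T X id "\<Psi> v"] by (auto simp: id_def)
  qed
  moreover have "open_map (prod_topology T (S v)) (prod_topology T X) (\<lambda>(t, a). (t, \<Psi> v a))"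
    if "v \<in> I" for v
    using assms that by (intro open_map_times_id) (simp add: chart_cover_def)
  moreover have "topspace (prod_topology T X) =
      (\<Union>v\<in>I. (\<lambda>(t, a). (t, \<Psi> v a)) ` topspace (prod_topology T (S v)))"
    using assms by (force simp: chart_cover_def)
  ultimately show ?thesis
    unfolding chart_cover_def by blast
qed

lemma homotopy_from_charts:
  assumes "chart_cover I S \<Psi> X"
    and "\<And>v. v \<in> I \<Longrightarrow> continuous_map (prod_topology T (S v)) Y (\<lambda>(t, a). h (t, \<Psi> v a))"
  shows "continuous_map (prod_topology T X) Y h"
proof (rule continuous_map_from_charts[OF chart_cover_times[OF assms(1)]])
  fix v assume "v \<in> I"
  then show "continuous_map (prod_topology T (S v)) Y (\<lambda>a. h (case a of (t, a) \<Rightarrow> (t, \<Psi> v a)))"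
    using assms(2) by (simp add: case_prod_unfold)
qed

lemma homotopicI:
  assumes "continuous_map (prod_topology (top_of_set {0..1::real}) X) Y h"
    and "\<And>x. x \<in> topspace X \<Longrightarrow> h (0, x) = f x" "\<And>x. x \<in> topspace X \<Longrightarrow> h (1, x) = g x"
  shows "homotopic_with (\<lambda>_. True) X Y f g"
  using assms by (subst homotopic_with) auto

section \<open>Counting isotopy classes\<close>

lemma lepoll_mapping_class_group:
  assumes homeo: "\<And>i. i \<in> J \<Longrightarrow> homeomorphic_map X X (\<phi> i)"
    and sep: "\<And>i j. \<lbrakk>i \<in> J; j \<in> J; isotopic X (\<phi> i) (\<phi> j)\<rbrakk> \<Longrightarrow> i = j"
  shows "J \<lesssim> carrier (mapping_class_group X)"
proof -
  let ?r = "\<lambda>i. restrict (\<phi> i) (topspace X)"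
  have carr: "?r i \<in> carrier (homeo_group X)" if "i \<in> J" for i
    using homeo[OF that] homeomorphic_map_eq[of X X "\<phi> i" "?r i"] by (simp add: homeo_group_carrier)
  have "inj_on (\<lambda>i. isotopy_rel X `` {?r i}) J"
  proof (rule inj_onI)
    fix i j assume ij: "i \<in> J" "j \<in> J" and eq: "isotopy_rel X `` {?r i} = isotopy_rel X `` {?r j}"
    then have "isotopic X (?r i) (?r j)"
      using eq_equiv_class[OF eq equiv_isotopy_rel carr] by (simp add: isotopy_rel_def)
    then show "i = j"
      using isotopic_cong[of X "?r i" "?r j" "\<phi> i" "\<phi> j"] sep ij by simp
  qed
  moreover have "(\<lambda>i. isotopy_rel X `` {?r i}) ` J \<subseteq> carrier (mapping_class_group X)"
    using carr by (auto simp: mapping_class_group_def intro: quotientI)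
  ultimately show ?thesis
    unfolding lepoll_def by blast
qed

lemma isotopicE:
  assumes "isotopic X f g"
  obtains h where "continuous_map (prod_topology (top_of_set {0..1::real}) X) X h"
    "\<And>x. h (0, x) = f x" "\<And>x. h (1, x) = g x"
    "\<And>t. t \<in> {0..1} \<Longrightarrow> homeomorphic_map X X (\<lambda>x. h (t, x))"
  using assms unfolding isotopic_def homotopic_with_def by blast

text \<open>
  The way to tell isotopy classes apart: if a set \<open>B\<close> splits into relatively open pieces, labelled by
  \<open>\<iota>\<close>, then a point whose track stays in \<open>B\<close> stays in one piece, as the unit interval is connected.
\<close>

lemma isotopy_track_index:
  assumes h: "continuous_map (prod_topology (top_of_set {0..1::real}) X) X h"
    and p: "p \<in> topspace X"
    and B: "\<And>t. t \<in> {0..1} \<Longrightarrow> h (t, p) \<in> B"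
    and pieces: "\<And>b. b \<in> B \<Longrightarrow> \<exists>U. openin X U \<and> b \<in> U \<and> (\<forall>b'\<in>U \<inter> B. \<iota> b' = \<iota> b)"
  shows "\<iota> (h (0, p)) = \<iota> (h (1, p))"
proof -
  have path: "continuous_map (top_of_set {0..1::real}) X (\<lambda>t. h (t, p))"
    using p by (intro continuous_map_compose[OF _ h, unfolded o_def] continuous_map_pairedI) auto
  have "\<exists>b. \<forall>t\<in>{0..1::real}. \<iota> (h (t, p)) = b"
  proof -
    have "(\<lambda>t. \<iota> (h (t, p))) constant_on {0..1::real}"
    proof (rule locally_constant_imp_constant)
      fix t :: real assume t: "t \<in> {0..1}"
      obtain U where U: "openin X U" "h (t, p) \<in> U" "\<forall>b'\<in>U \<inter> B. \<iota> b' = \<iota> (h (t, p))"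
        using pieces[OF B[OF t]] by blast
      have "openin (top_of_set {0..1}) {r \<in> {0..1}. h (r, p) \<in> U}"
        using openin_continuous_map_preimage[OF path U(1)] by simp
      then show "\<exists>V. openin (top_of_set {0..1}) V \<and> t \<in> V \<and> (\<forall>r\<in>V. \<iota> (h (r, p)) = \<iota> (h (t, p)))"
        using U t B by (intro exI[of _ "{r \<in> {0..1}. h (r, p) \<in> U}"]) blast
    qed simp
    then show ?thesis by (auto simp: constant_on_def)
  qed
  then obtain b where b: "\<forall>t\<in>{0..1::real}. \<iota> (h (t, p)) = b" ..
  have "\<iota> (h (0, p)) = b" "\<iota> (h (1, p)) = b" using b by simp_all
  then show ?thesis by simp
qed

section \<open>The Pruefer surface\<close>

text \<open>
  The coordinate \<open>u\<close> is the slope, seen from \<open>(0, c)\<close>. In these coordinates the basic neighbourhoods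
  of the boundary line with index \<open>c\<close> are rectangles, see \<open>pruefer_chart_box\<close>.
\<close>

definition pruefer_chart :: "real \<Rightarrow> real \<times> real \<Rightarrow> pruefer_point" where
  "pruefer_chart c = (\<lambda>(x, u). if x = 0 then Edge c u else Half x (c + u * x))"

abbreviation half_plane :: "(real \<times> real) set" where
  "half_plane \<equiv> {0..} \<times> UNIV"

lemma pruefer_chart_simps [simp]:
  "pruefer_chart c (0, u) = Edge c u"
  "x \<noteq> 0 \<Longrightarrow> pruefer_chart c (x, u) = Half x (c + u * x)"
  by (simp_all add: pruefer_chart_def)

lemma pruefer_carrier_iff [simp]:
  "Half x y \<in> pruefer_carrier \<longleftrightarrow> 0 < x" "Edge c u \<in> pruefer_carrier"
  by (auto simp: pruefer_carrier_def)

lemma inj_pruefer_chart: "inj (pruefer_chart c)"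
  by (rule injI) (auto simp: pruefer_chart_def split: if_splits)

lemma pruefer_chart_box:
  "pruefer_chart c ` ({0..<\<epsilon>} \<times> {a<..<b}) = (if 0 < \<epsilon> then pruefer_T c a b \<epsilon> else {})"
proof (cases "0 < \<epsilon>")
  case True
  have "p \<in> pruefer_T c a b \<epsilon>" if "p \<in> pruefer_chart c ` ({0..<\<epsilon>} \<times> {a<..<b})" for p
    using that
    by (clarsimp simp: pruefer_chart_def pruefer_T_def split: if_splits)
      (metis add.commute add_strict_left_mono mult_strict_right_mono order_le_imp_less_or_eq)
  moreover have "p \<in> pruefer_chart c ` ({0..<\<epsilon>} \<times> {a<..<b})" if p: "p \<in> pruefer_T c a b \<epsilon>" for p
  proof (cases p)
    case (Half x y)
    then have x: "0 < x" "x < \<epsilon>" "a * x + c < y" "y < b * x + c"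
      using p by (auto simp: pruefer_T_def)
    then have "a < (y - c) / x" "(y - c) / x < b"
      by (auto simp: field_simps)
    moreover have "p = pruefer_chart c (x, (y - c) / x)"
      using x Half by simp
    ultimately show ?thesis using x by (intro image_eqI[of _ _ "(x, (y - c) / x)"]) auto
  next
    case (Edge d u)
    then have "d = c" "a < u" "u < b" using p by (auto simp: pruefer_T_def)
    then show ?thesis using True Edge by (intro image_eqI[of _ _ "(0, u)"]) auto
  qed
  ultimately show ?thesis using True by auto
qed auto

lemma continuous_map_pruefer_chart:
  "continuous_map (top_of_set half_plane) pruefer (pruefer_chart c)"
  unfolding continuous_map
proof (intro conjI allI impI)
  show "pruefer_chart c ` topspace (top_of_set half_plane) \<subseteq> topspace pruefer"
    by (auto simp: topspace_pruefer pruefer_chart_def)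
  fix U assume "openin pruefer U"
  then have U: "pruefer_open U" by (simp add: openin_pruefer)
  let ?A = "{a \<in> topspace (top_of_set half_plane). pruefer_chart c a \<in> U}"
  show "openin (top_of_set half_plane) ?A"
  proof (subst openin_subopen, intro ballI)
    fix p assume p: "p \<in> ?A"
    obtain x u where xu: "p = (x, u)" by force
    show "\<exists>V. openin (top_of_set half_plane) V \<and> p \<in> V \<and> V \<subseteq> ?A"
    proof (cases "x = 0")
      case True
      then obtain a b \<epsilon> where ab: "a < u" "u < b" "0 < \<epsilon>" "pruefer_T c a b \<epsilon> \<subseteq> U"
        using p U xu unfolding pruefer_open_def by force
      have "half_plane \<inter> ({..<\<epsilon>} \<times> {a<..<b}) \<subseteq> ?A"
        using pruefer_chart_box[of c \<epsilon> a b] ab by auto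
      moreover have "openin (top_of_set half_plane) (half_plane \<inter> ({..<\<epsilon>} \<times> {a<..<b}))"
        by (intro openin_open_Int open_Times) auto
      ultimately show ?thesis
        using ab True xu by (intro exI[of _ "half_plane \<inter> ({..<\<epsilon>} \<times> {a<..<b})"]) auto
    next
      case False
      let ?V = "(\<lambda>q. (fst q, c + snd q * fst q)) -` {(x, y). Half x y \<in> U} \<inter> {0<..} \<times> UNIV"
      have "open ((\<lambda>q::real \<times> real. (fst q, c + snd q * fst q)) -` {(x, y). Half x y \<in> U})"
        using U by (intro open_vimage) (auto simp: pruefer_open_def intro!: continuous_intros)
      then have "openin (top_of_set half_plane) (half_plane \<inter> ?V)"
        by (intro openin_open_Int open_Int open_Times) auto
      moreover have "p \<in> half_plane \<inter> ?V" "half_plane \<inter> ?V \<subseteq> ?A"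
        using p False xu by (auto simp: pruefer_chart_def)
      ultimately show ?thesis by blast
    qed
  qed
qed

lemma open_map_pruefer_chart:
  "open_map (top_of_set half_plane) pruefer (pruefer_chart c)"
  unfolding open_map_def
proof (intro allI impI)
  fix O' assume O: "openin (top_of_set half_plane) O'"
  then obtain W where W: "open W" "O' = half_plane \<inter> W" by (auto simp: openin_open)
  show "openin pruefer (pruefer_chart c ` O')"
    unfolding openin_pruefer pruefer_open_def
  proof (intro conjI allI impI)
    show "pruefer_chart c ` O' \<subseteq> pruefer_carrier"
      using W by (auto simp: pruefer_chart_def)
    have Half_iff: "Half x y \<in> pruefer_chart c ` O' \<longleftrightarrow> 0 < x \<and> (x, (y - c) / x) \<in> W" for x y
    proof
      assume "Half x y \<in> pruefer_chart c ` O'"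
      then show "0 < x \<and> (x, (y - c) / x) \<in> W"
        using W by (auto simp: pruefer_chart_def split: if_splits)
    next
      assume x: "0 < x \<and> (x, (y - c) / x) \<in> W"
      then have "Half x y = pruefer_chart c (x, (y - c) / x)" by simp
      moreover have "(x, (y - c) / x) \<in> O'" using x W by auto
      ultimately show "Half x y \<in> pruefer_chart c ` O'" by blast
    qed
    have "open (({0<..} \<times> UNIV) \<inter> (\<lambda>q. (fst q, (snd q - c) / fst q)) -` W)"
      using W(1) by (intro continuous_open_preimage) (auto intro!: continuous_intros open_Times)
    moreover have "({0<..} \<times> UNIV) \<inter> (\<lambda>q. (fst q, (snd q - c) / fst q)) -` W
        = {(x, y). Half x y \<in> pruefer_chart c ` O'}"
      by (auto simp: Half_iff)
    ultimately show "open {(x, y). Half x y \<in> pruefer_chart c ` O'}" by simp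
    fix d u assume "Edge d u \<in> pruefer_chart c ` O'"
    then have du: "d = c" "(0, u) \<in> W"
      using W by (auto simp: pruefer_chart_def split: if_splits)
    obtain A B where AB: "open A" "open B" "0 \<in> A" "u \<in> B" "A \<times> B \<subseteq> W"
      using open_prod_elim[OF W(1) du(2)] by (metis mem_Sigma_iff)
    obtain \<epsilon> where e: "0 < \<epsilon>" "ball 0 \<epsilon> \<subseteq> A" using AB openE by blast
    obtain \<delta> where d: "0 < \<delta>" "ball u \<delta> \<subseteq> B" using AB openE by blast
    have "{0..<\<epsilon>} \<times> {u - \<delta><..<u + \<delta>} \<subseteq> O'"
      using W(2) AB(5) e d by (auto simp: subset_iff dist_real_def abs_less_iff)
    then have "pruefer_T d (u - \<delta>) (u + \<delta>) \<epsilon> \<subseteq> pruefer_chart c ` O'"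
      using pruefer_chart_box[of c \<epsilon> "u - \<delta>" "u + \<delta>"] e du by (metis image_mono)
    then show "\<exists>a b \<epsilon>. a < u \<and> u < b \<and> 0 < \<epsilon> \<and> pruefer_T d a b \<epsilon> \<subseteq> pruefer_chart c ` O'"
      using e d by (intro exI[of _ "u - \<delta>"] exI[of _ "u + \<delta>"] exI[of _ \<epsilon>]) auto
  qed
qed

lemma chart_cover_pruefer: "chart_cover UNIV (\<lambda>c. top_of_set half_plane) pruefer_chart pruefer"
proof -
  have "p \<in> (\<Union>c. pruefer_chart c ` half_plane)" if "p \<in> pruefer_carrier" for p
  proof (cases p)
    case (Half x y)
    then have "p = pruefer_chart y (x, 0)" "(x, 0) \<in> half_plane" using that by auto
    then show ?thesis by blast
  next
    case (Edge c u)
    then have "p = pruefer_chart c (0, u)" "(0, u) \<in> half_plane" by auto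
    then show ?thesis by blast
  qed
  moreover have "pruefer_chart c ` half_plane \<subseteq> pruefer_carrier" for c
    by (auto simp: pruefer_chart_def)
  ultimately have "pruefer_carrier = (\<Union>c. pruefer_chart c ` half_plane)" by blast
  then have "topspace pruefer = (\<Union>c. pruefer_chart c ` topspace (top_of_set half_plane))"
    by (simp only: topspace_pruefer topspace_euclidean_subtopology)
  then show ?thesis
    unfolding chart_cover_def
    by (intro conjI ballI continuous_map_pruefer_chart open_map_pruefer_chart)
qed

subsection \<open>Contractibility\<close>

lemma continuous_map_Half:
  assumes f: "continuous_on D f" and g: "continuous_on D g" and pos: "\<And>z. z \<in> D \<Longrightarrow> 0 < f z"
  shows "continuous_map (top_of_set D) pruefer (\<lambda>z. Half (f z) (g z))"
proof -
  let ?k = "\<lambda>z. (f z, g z / f z)"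
  have nz: "f z \<noteq> 0" if "z \<in> D" for z using pos[OF that] by simp
  have "continuous_on D ?k"
    using nz by (intro continuous_intros f g) auto
  then have "continuous_map (top_of_set D) (top_of_set half_plane) ?k"
    using pos by (auto simp: continuous_map_in_subtopology less_imp_le)
  then have "continuous_map (top_of_set D) pruefer (pruefer_chart 0 \<circ> ?k)"
    by (rule continuous_map_compose) (rule continuous_map_pruefer_chart)
  then show ?thesis
    by (rule continuous_map_eq) (use nz in auto)
qed

text \<open>
  The point \<open>(x, y)\<close> moves horizontally to \<open>(f (t, x), y)\<close>. When \<open>f * g\<close> is the coordinate \<open>x\<close>, its slope
  with respect to every boundary line is multiplied by \<open>g\<close>; this dictates the values on the lines.
\<close>

definition pruefer_push :: "(real \<times> real \<Rightarrow> real) \<Rightarrow> (real \<times> real \<Rightarrow> real) \<Rightarrow> real \<times> pruefer_point \<Rightarrow> pruefer_point" where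
  "pruefer_push f g = (\<lambda>(t, p). case p of Half x y \<Rightarrow> Half (f (t, x)) y
     | Edge c u \<Rightarrow> pruefer_chart c (f (t, 0), u * g (t, 0)))"

text \<open>
  In the chart of any boundary line the map is \<open>(x, u) \<mapsto> (f (t, x), u * g (t, x))\<close>.
\<close>

lemma continuous_map_pruefer_push:
  assumes f: "continuous_on ({0..1} \<times> {0..}) f" and g: "continuous_on ({0..1} \<times> {0..}) g"
    and f0: "\<And>t x. \<lbrakk>t \<in> {0..1}; 0 \<le> x\<rbrakk> \<Longrightarrow> 0 \<le> f (t, x)"
    and fg: "\<And>t x. \<lbrakk>t \<in> {0..1}; 0 \<le> x\<rbrakk> \<Longrightarrow> f (t, x) * g (t, x) = x"
  shows "continuous_map (prod_topology (top_of_set {0..1}) pruefer) pruefer (pruefer_push f g)"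
proof (rule homotopy_from_charts[OF chart_cover_pruefer])
  fix c :: real
  let ?D = "{0..1} \<times> half_plane :: (real \<times> real \<times> real) set"
  let ?k = "\<lambda>(t, x, u). (f (t, x), u * g (t, x))"
  have "continuous_on ?D ?k"
    unfolding case_prod_unfold
    by (intro continuous_intros continuous_on_compose2[OF f] continuous_on_compose2[OF g]) auto
  then have "continuous_map (top_of_set ?D) (top_of_set half_plane) ?k"
    using f0 by (auto simp: continuous_map_in_subtopology)
  then have "continuous_map (top_of_set ?D) pruefer (pruefer_chart c \<circ> ?k)"
    by (rule continuous_map_compose) (rule continuous_map_pruefer_chart)
  moreover have "pruefer_push f g (t, pruefer_chart c (x, u)) = pruefer_chart c (f (t, x), u * g (t, x))"
    if "t \<in> {0..1}" "0 \<le> x" for t x u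
  proof (cases "x = 0")
    case False
    then have "f (t, x) \<noteq> 0" using fg[OF that] by auto
    moreover have "u * x = u * g (t, x) * f (t, x)" using fg[OF that] by (simp add: algebra_simps)
    ultimately show ?thesis using False by (simp add: pruefer_push_def)
  qed (simp add: pruefer_push_def)
  ultimately show "continuous_map (prod_topology (top_of_set {0..1}) (top_of_set half_plane)) pruefer
      (\<lambda>(t, a). pruefer_push f g (t, pruefer_chart c a))"
    unfolding prod_topology_subtopology_eu by (elim continuous_map_eq) auto
qed

text \<open>
  Both homotopies below divide by a function that vanishes at a single point with \<open>x = 0\<close>; there the
  quotient tends to \<open>0\<close> since it is dominated by the square root.
\<close>

lemma tendsto_null_at_axis:
  fixes f :: "real \<times> real \<Rightarrow> real"
  assumes "\<And>t x. \<lbrakk>0 \<le> t; t \<le> 1; 0 \<le> x; x \<le> 1\<rbrakk> \<Longrightarrow> \<bar>f (t, x)\<bar> \<le> sqrt x"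
  shows "(f \<longlongrightarrow> 0) (at (t0, 0) within {0..1} \<times> {0..})"
proof (rule Lim_null_comparison)
  let ?F = "at (t0, 0 :: real) within {0..1} \<times> {0..}"
  have "open (UNIV \<times> {..<1} :: (real \<times> real) set)" by (intro open_Times) auto
  then have "\<forall>\<^sub>F p in ?F. p \<in> UNIV \<times> {..<1}"
    unfolding eventually_at_topological by (intro exI[of _ "UNIV \<times> {..<1}"]) simp
  moreover have "\<forall>\<^sub>F p in ?F. p \<in> {0..1} \<times> {0..}"
    by (simp add: eventually_at_filter)
  ultimately show "\<forall>\<^sub>F p in ?F. norm (f p) \<le> sqrt (snd p)"
    by eventually_elim (use assms in auto)
  have "continuous_on UNIV (\<lambda>p::real \<times> real. sqrt (snd p))" by (intro continuous_intros)
  then have "((\<lambda>p::real \<times> real. sqrt (snd p)) \<longlongrightarrow> sqrt (snd (t0, 0::real))) (at (t0, 0) within {0..1} \<times> {0..})"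
    by (meson continuous_on continuous_on_subset subset_UNIV UNIV_I tendsto_within_subset)
  then show "((\<lambda>p::real \<times> real. sqrt (snd p)) \<longlongrightarrow> 0) (at (t0, 0) within {0..1} \<times> {0..})" by simp
qed

lemma continuous_on_div_null:
  fixes g :: "real \<times> real \<Rightarrow> real"
  assumes g: "continuous_on ({0..1} \<times> {0..}) g"
    and pos: "\<And>t x. \<lbrakk>0 \<le> t; t \<le> 1; 0 < x\<rbrakk> \<Longrightarrow> g (t, x) \<noteq> 0"
    and bound: "\<And>t x. \<lbrakk>0 \<le> t; t \<le> 1; 0 \<le> x; x \<le> 1\<rbrakk> \<Longrightarrow> \<bar>x / g (t, x)\<bar> \<le> sqrt x"
  shows "continuous_on ({0..1} \<times> {0..}) (\<lambda>p. snd p / g p)"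
  unfolding continuous_on_def
proof (intro ballI)
  fix p :: "real \<times> real" assume p: "p \<in> {0..1} \<times> {0..}"
  obtain t x where tx: "p = (t, x)" by force
  show "((\<lambda>p. snd p / g p) \<longlongrightarrow> snd p / g p) (at p within {0..1} \<times> {0..})"
  proof (cases "x = 0")
    case True
    then show ?thesis using tendsto_null_at_axis[of "\<lambda>p. snd p / g p" t] bound tx by simp
  next
    case False
    then have "g p \<noteq> 0" using p tx pos by auto
    moreover have "(g \<longlongrightarrow> g p) (at p within {0..1} \<times> {0..})"
      using g p unfolding continuous_on_def by blast
    ultimately show ?thesis by (intro tendsto_intros)
  qed
qed

text \<open>
  First \<open>x\<close> becomes \<open>x / ((1 - t) + t * sqrt x)\<close>, which multiplies the slopes on the boundary by
  \<open>1 - t\<close>; then the surface is pushed to the right by \<open>t\<close>; then it shrinks along straight segments.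
  The square root makes the slopes \<open>(y - c) / sqrt x\<close> at the end of the first stage tend to \<open>0\<close>
  along with \<open>x\<close>.
\<close>

theorem contractible_pruefer: "contractible_space pruefer"
proof -
  let ?I = "prod_topology (top_of_set {0..1::real}) pruefer"
  let ?retract = "\<lambda>p. case p of Half x y \<Rightarrow> Half (sqrt x) y | Edge c u \<Rightarrow> Edge c 0"
  let ?inside = "\<lambda>p. case p of Half x y \<Rightarrow> Half (sqrt x + 1) y | Edge c u \<Rightarrow> Half 1 c"
  have 1: "homotopic_with (\<lambda>_. True) pruefer pruefer id ?retract"
  proof -
    let ?g = "\<lambda>p::real \<times> real. (1 - fst p) + fst p * sqrt (snd p)"
    have g: "continuous_on ({0..1} \<times> {0..}) ?g" by (intro continuous_intros)
    have pos: "0 < ?g (t, x)" if "0 \<le> t" "t \<le> 1" "0 < x" for t x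
      using that by (cases "t = 1") (auto intro: add_pos_nonneg)
    have nonneg: "0 \<le> ?g (t, x)" if "0 \<le> t" "t \<le> 1" "0 \<le> x" for t x
      using that by auto
    have bound: "\<bar>x / ?g (t, x)\<bar> \<le> sqrt x" if "0 \<le> t" "t \<le> 1" "0 \<le> x" "x \<le> 1" for t x
    proof (cases "x = 0")
      case False
      have "(1 - t) * sqrt x \<le> (1 - t) * 1"
        using that by (intro mult_left_mono) auto
      then have "sqrt x \<le> ?g (t, x)" by (simp add: algebra_simps)
      then have "sqrt x * sqrt x \<le> sqrt x * ?g (t, x)"
        using that by (intro mult_left_mono) auto
      then show ?thesis
        using that False pos[of t x] by (simp add: divide_le_eq abs_of_pos)
    qed simp
    have "continuous_map ?I pruefer (pruefer_push (\<lambda>p. snd p / ?g p) ?g)"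
    proof (rule continuous_map_pruefer_push)
      show "continuous_on ({0..1} \<times> {0..}) (\<lambda>p. snd p / ?g p)"
        using g bound pos by (intro continuous_on_div_null) force+
      show "snd (t, x) / ?g (t, x) * ?g (t, x) = x" if "t \<in> {0..1}" "0 \<le> x" for t x
        using that pos[of t x] by (cases "x = 0") auto
      show "0 \<le> snd (t, x) / ?g (t, x)" if "t \<in> {0..1}" "0 \<le> x" for t x
        using that nonneg[of t x] by auto
    qed (rule g)
    moreover have "pruefer_push (\<lambda>p. snd p / ?g p) ?g (0, p) = p" if "p \<in> pruefer_carrier" for p
      using that by (cases p) (auto simp: pruefer_push_def)
    moreover have "pruefer_push (\<lambda>p. snd p / ?g p) ?g (1, p) = ?retract p" if "p \<in> pruefer_carrier" for p
      using that by (cases p) (auto simp: pruefer_push_def real_div_sqrt)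
    ultimately show ?thesis
      by (intro homotopicI) (simp_all add: topspace_pruefer)
  qed
  have 2: "homotopic_with (\<lambda>_. True) pruefer pruefer ?retract ?inside"
  proof -
    let ?f = "\<lambda>p::real \<times> real. sqrt (snd p) + fst p"
    have f: "continuous_on ({0..1} \<times> {0..}) ?f" by (intro continuous_intros)
    have pos: "0 < ?f (t, x)" if "0 \<le> t" "t \<le> 1" "0 < x" for t x
      using that by (auto intro: add_pos_nonneg)
    have bound: "\<bar>x / ?f (t, x)\<bar> \<le> sqrt x" if "0 \<le> t" "t \<le> 1" "0 \<le> x" for t x
    proof (cases "x = 0")
      case False
      have "sqrt x * sqrt x \<le> sqrt x * ?f (t, x)"
        using that by (intro mult_left_mono) auto
      then show ?thesis
        using that False pos[of t x] by (simp add: divide_le_eq abs_of_pos)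
    qed simp
    have "continuous_map ?I pruefer (pruefer_push ?f (\<lambda>p. snd p / ?f p))"
    proof (rule continuous_map_pruefer_push)
      show "continuous_on ({0..1} \<times> {0..}) (\<lambda>p. snd p / ?f p)"
        using f bound pos by (intro continuous_on_div_null) force+
      show "?f (t, x) * (snd (t, x) / ?f (t, x)) = x" if "t \<in> {0..1}" "0 \<le> x" for t x
        using that pos[of t x] by (cases "x = 0") auto
      show "0 \<le> ?f (t, x)" if "t \<in> {0..1}" "0 \<le> x" for t x
        using that by auto
    qed (rule f)
    moreover have "pruefer_push ?f (\<lambda>p. snd p / ?f p) (0, p) = ?retract p" for p
      by (auto simp: pruefer_push_def split: pruefer_point.split)
    moreover have "pruefer_push ?f (\<lambda>p. snd p / ?f p) (1, p) = ?inside p" for p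
      by (auto simp: pruefer_push_def split: pruefer_point.split)
    ultimately show ?thesis
      by (rule homotopicI)
  qed
  have 3: "homotopic_with (\<lambda>_. True) pruefer pruefer ?inside (\<lambda>_. Half 1 0)"
  proof -
    let ?h = "\<lambda>(t, p). case p of Half x y \<Rightarrow> Half (1 + (1 - t) * sqrt x) ((1 - t) * y)
      | Edge c u \<Rightarrow> Half 1 ((1 - t) * c)"
    have "continuous_map ?I pruefer ?h"
    proof (rule homotopy_from_charts[OF chart_cover_pruefer])
      fix c :: real
      let ?D = "{0..1} \<times> half_plane :: (real \<times> real \<times> real) set"
      have "continuous_map (top_of_set ?D) pruefer
          (\<lambda>(t, x, u). Half (1 + (1 - t) * sqrt x) ((1 - t) * (c + u * x)))"
        unfolding case_prod_unfold
        by (intro continuous_map_Half) (auto intro!: continuous_intros add_pos_nonneg)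
      then show "continuous_map (prod_topology (top_of_set {0..1}) (top_of_set half_plane)) pruefer
          (\<lambda>(t, a). ?h (t, pruefer_chart c a))"
        unfolding prod_topology_subtopology_eu
        by (rule continuous_map_eq) (auto simp: pruefer_chart_def)
    qed
    moreover have "?h (0, p) = ?inside p" "?h (1, p) = Half 1 0" for p
      by (auto split: pruefer_point.split)
    ultimately show ?thesis
      by (rule homotopicI)
  qed
  have "homotopic_with (\<lambda>_. True) pruefer pruefer id (\<lambda>_. Half 1 0)"
    using homotopic_with_trans[OF homotopic_with_trans[OF 1 2] 3] .
  then show ?thesis unfolding contractible_space_def by blast
qed

subsection \<open>Translations\<close>

definition pruefer_translate :: "real \<Rightarrow> pruefer_point \<Rightarrow> pruefer_point" where
  "pruefer_translate s p = (case p of Half x y \<Rightarrow> Half x (y + s) | Edge c u \<Rightarrow> Edge (c + s) u)"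

lemma homeomorphic_map_pruefer_translate:
  "homeomorphic_map pruefer pruefer (pruefer_translate s)"
proof -
  have cont: "continuous_map pruefer pruefer (pruefer_translate r)" for r
  proof (rule continuous_map_from_charts[OF chart_cover_pruefer])
    fix c
    have "(\<lambda>a. pruefer_translate r (pruefer_chart c a)) = pruefer_chart (c + r)"
      by (auto simp: pruefer_translate_def pruefer_chart_def fun_eq_iff)
    then show "continuous_map (top_of_set half_plane) pruefer (\<lambda>a. pruefer_translate r (pruefer_chart c a))"
      using continuous_map_pruefer_chart by simp
  qed
  have "homeomorphic_maps pruefer pruefer (pruefer_translate s) (pruefer_translate (- s))"
    unfolding homeomorphic_maps_def
    using cont by (auto simp: pruefer_translate_def split: pruefer_point.split)
  then show ?thesis by (rule homeomorphic_maps_map[THEN iffD1, THEN conjunct1])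
qed

text \<open>
  If a boundary point had its image inside the half-plane, a plane neighbourhood of this image would
  be mapped by the inverse and the chart injectively and continuously into the closed half-plane,
  hitting its border. By invariance of domain the image is open in the plane, a contradiction.
\<close>

lemma homeomorphic_map_pruefer_Edge:
  assumes f: "homeomorphic_map pruefer pruefer f"
  shows "f (Edge c u) \<in> range (case_prod Edge)"
proof (rule ccontr)
  assume contr: "f (Edge c u) \<notin> range (case_prod Edge)"
  obtain g where fg: "homeomorphic_maps pruefer pruefer f g"
    using f by (auto simp: homeomorphic_map_maps)
  have edge: "Edge c u \<in> topspace pruefer"
    by (auto simp: topspace_pruefer)
  then have "f (Edge c u) \<in> pruefer_carrier"
    using f by (metis homeomorphic_imp_surjective_map imageI topspace_pruefer)
  then obtain x y where xy: "f (Edge c u) = Half x y" "0 < x"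
    using contr by (auto simp: pruefer_carrier_def)
  let ?D = "pruefer_chart c ` half_plane"
  have D: "openin pruefer ?D"
    using open_map_pruefer_chart[of c] unfolding open_map_def by auto
  have fD: "openin pruefer (f ` ?D)"
    using homeomorphic_imp_open_map[OF f] D unfolding open_map_def by blast
  define W where "W = {(x, y). Half x y \<in> f ` ?D}"
  define \<kappa> where "\<kappa> = (\<lambda>q. inv_into UNIV (pruefer_chart c) (g (Half (fst q) (snd q))))"
  have W: "open W" using fD by (simp add: W_def openin_pruefer pruefer_open_def)
  have W0: "0 < fst q" if "q \<in> W" for q
  proof -
    have "Half (fst q) (snd q) \<in> f ` ?D" using that by (auto simp: W_def)
    then have "Half (fst q) (snd q) \<in> pruefer_carrier"
      using openin_subset[OF fD] topspace_pruefer by blast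
    then show ?thesis by simp
  qed
  have gf: "g (f p) = p" if "p \<in> topspace pruefer" for p
    using fg that by (simp add: homeomorphic_maps_def)
  have fg': "f (g p) = p" if "p \<in> topspace pruefer" for p
    using fg that by (simp add: homeomorphic_maps_def)
  have gW: "g (Half (fst q) (snd q)) \<in> ?D" if "q \<in> W" for q
  proof -
    have "Half (fst q) (snd q) \<in> f ` ?D" using that by (auto simp: W_def)
    then obtain p where "p \<in> ?D" "Half (fst q) (snd q) = f p" by blast
    then show ?thesis using gf openin_subset[OF D] by auto
  qed
  have \<kappa>: "pruefer_chart c (\<kappa> q) = g (Half (fst q) (snd q))" "\<kappa> q \<in> half_plane" if q: "q \<in> W" for q
  proof -
    obtain a where "a \<in> half_plane" "g (Half (fst q) (snd q)) = pruefer_chart c a" using gW[OF q] by (elim imageE)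
    then show "pruefer_chart c (\<kappa> q) = g (Half (fst q) (snd q))" "\<kappa> q \<in> half_plane"
      by (simp_all add: \<kappa>_def inv_f_f[OF inj_pruefer_chart])
  qed
  have cont: "continuous_on W \<kappa>"
    unfolding continuous_on_open_invariant
  proof (intro allI impI)
    fix B :: "(real \<times> real) set" assume "open B"
    then have "openin pruefer (pruefer_chart c ` (half_plane \<inter> B))"
      using open_map_pruefer_chart[of c] unfolding open_map_def by (simp add: openin_open_Int)
    then have "openin pruefer {p \<in> topspace pruefer. g p \<in> pruefer_chart c ` (half_plane \<inter> B)}"
      using fg by (intro openin_continuous_map_preimage) (auto simp: homeomorphic_maps_def)
    then have "open {(x, y). Half x y \<in> {p \<in> topspace pruefer. g p \<in> pruefer_chart c ` (half_plane \<inter> B)}}"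
      by (simp add: openin_pruefer pruefer_open_def)
    moreover have "{(x, y). Half x y \<in> {p \<in> topspace pruefer. g p \<in> pruefer_chart c ` (half_plane \<inter> B)}} \<inter> W
        = \<kappa> -` B \<inter> W"
    proof -
      have "Half (fst q) (snd q) \<in> topspace pruefer" if "q \<in> W" for q
        using W0[OF that] by (auto simp: topspace_pruefer)
      moreover have "g (Half (fst q) (snd q)) \<in> pruefer_chart c ` (half_plane \<inter> B) \<longleftrightarrow> \<kappa> q \<in> B"
        if "q \<in> W" for q
        using \<kappa>[OF that] inj_image_mem_iff[OF inj_pruefer_chart, of c "\<kappa> q" "half_plane \<inter> B"] by simp
      ultimately show ?thesis by force
    qed
    ultimately show "\<exists>A. open A \<and> A \<inter> W = \<kappa> -` B \<inter> W" by blast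
  qed
  have inj: "inj_on \<kappa> W"
  proof (rule inj_onI)
    fix q r assume qr: "q \<in> W" "r \<in> W" "\<kappa> q = \<kappa> r"
    then have "g (Half (fst q) (snd q)) = g (Half (fst r) (snd r))" using \<kappa>(1) by metis
    moreover have "Half (fst q) (snd q) \<in> topspace pruefer" "Half (fst r) (snd r) \<in> topspace pruefer"
      using W0 qr by (auto simp: topspace_pruefer)
    ultimately have "Half (fst q) (snd q) = Half (fst r) (snd r)" using fg' by metis
    then show "q = r" by (simp add: prod_eq_iff)
  qed
  have "open (\<kappa> ` W)"
    using invariance_of_domain[OF cont W inj] .
  have "(x, y) \<in> W" using xy(1) by (auto simp: W_def intro!: image_eqI[of _ _ "(0, u)"] image_eqI[of _ f "Edge c u"])
  have "\<kappa> (x, y) = (0, u)"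
    using gf[OF edge] xy(1) inv_f_f[OF inj_pruefer_chart, of c "(0, u)"] by (simp add: \<kappa>_def)
  then have "(0, u) \<in> \<kappa> ` W" using \<open>(x, y) \<in> W\<close> by force
  then obtain \<epsilon> where e: "0 < \<epsilon>" "ball (0, u) \<epsilon> \<subseteq> \<kappa> ` W"
    using \<open>open (\<kappa> ` W)\<close> openE by blast
  \<comment> \<open>A point to the left of the half-plane in the open image gives the contradiction.\<close>
  have "(- \<epsilon> / 2, u) \<in> ball (0, u) \<epsilon>"
    using e(1) by (simp add: dist_Pair_Pair dist_real_def)
  then have "(- \<epsilon> / 2, u) \<in> \<kappa> ` W" using e(2) by (rule subsetD[rotated])
  then obtain q where "q \<in> W" "(- \<epsilon> / 2, u) = \<kappa> q" by (elim imageE)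
  then have "(- \<epsilon> / 2, u) \<in> half_plane" using \<kappa>(2) by metis
  then show False using e(1) by simp
qed

theorem lepoll_mapping_class_group_pruefer:
  "(UNIV :: real set) \<lesssim> carrier (mapping_class_group pruefer)"
proof (rule lepoll_mapping_class_group)
  show "homeomorphic_map pruefer pruefer (pruefer_translate s)" for s
    by (rule homeomorphic_map_pruefer_translate)
  fix r s :: real assume "isotopic pruefer (pruefer_translate r) (pruefer_translate s)"
  then obtain h where h: "continuous_map (prod_topology (top_of_set {0..1::real}) pruefer) pruefer h"
    "\<And>x. h (0, x) = pruefer_translate r x" "\<And>x. h (1, x) = pruefer_translate s x"
    "\<And>t. t \<in> {0..1} \<Longrightarrow> homeomorphic_map pruefer pruefer (\<lambda>x. h (t, x))"
    by (rule isotopicE) blast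
  let ?index = "\<lambda>p. case p of Edge c u \<Rightarrow> c | Half x y \<Rightarrow> 0"
  have "?index (h (0, Edge 0 0)) = ?index (h (1, Edge 0 0))"
  proof (rule isotopy_track_index[OF h(1), where B = "range (case_prod Edge)"])
    show "Edge 0 0 \<in> topspace pruefer"
      by (auto simp: topspace_pruefer)
    show "h (t, Edge 0 0) \<in> range (case_prod Edge)" if "t \<in> {0..1}" for t
      using homeomorphic_map_pruefer_Edge[OF h(4)[OF that]] .
    fix b assume "b \<in> range (case_prod Edge)"
    then obtain c u where b: "b = Edge c u" by auto
    let ?U = "pruefer_chart c ` half_plane"
    have "openin pruefer ?U"
      using open_map_pruefer_chart[of c] unfolding open_map_def by auto
    moreover have "b \<in> ?U" using b by (auto intro: image_eqI[of _ _ "(0, u)"])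
    moreover have "\<forall>b'\<in>?U \<inter> range (case_prod Edge). ?index b' = ?index b"
      using b by (auto simp: pruefer_chart_def split: if_splits)
    ultimately show "\<exists>U. openin pruefer U \<and> b \<in> U \<and> (\<forall>b'\<in>U \<inter> range (case_prod Edge). ?index b' = ?index b)"
      by blast
  qed
  then show "r = s" by (simp add: h pruefer_translate_def)
qed

section \<open>The first uncountable ordinal\<close>

lemma Card_order_omega1: "Card_order omega1"
  unfolding omega1_def by (simp add: cardSuc_Card_order natLeq_Card_order)

lemma Well_order_omega1: "Well_order omega1"
  using Card_order_omega1 card_order_on_well_order_on by blast

lemma uncountable_Field_omega1:
  includes cardinal_syntax
  shows "uncountable (Field omega1)"
proof
  assume "countable (Field omega1)"
  then have "|Field omega1| \<le>o natLeq"
    by (metis UNIV_I card_of_nat countable_def card_of_ordLeq ordLeq_ordIso_trans subset_UNIV)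
  then have "omega1 \<le>o natLeq"
    using card_of_Field_ordIso[OF Card_order_omega1] ordIso_ordLeq_trans ordIso_symmetric by blast
  moreover have "natLeq <o omega1"
    unfolding omega1_def by (simp add: cardSuc_greater natLeq_Card_order)
  ultimately show False
    using not_ordLess_ordLeq by blast
qed

lemma countable_underS_omega1:
  includes cardinal_syntax
  assumes "x \<in> Field omega1"
  shows "countable (underS omega1 x)"
proof -
  have "|underS omega1 x| <o cardSuc natLeq"
    using card_of_underS[OF Card_order_omega1 assms] by (simp add: omega1_def)
  then have "|underS omega1 x| \<le>o natLeq"
    using cardSuc_ordLeq_ordLess[OF natLeq_Card_order card_of_Card_order] by blast
  then have "|underS omega1 x| \<le>o |UNIV :: nat set|"
    using card_of_nat ordIso_symmetric ordLeq_ordIso_trans by blast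
  then show ?thesis
    by (meson card_of_ordLeq countableI)
qed

text \<open>
  As a type of class \<open>wellorder\<close>, the index set gives access to the usual notation for orders, to least
  elements and to induction.
\<close>

typedef w1 = "Field omega1"
  using uncountable_Field_omega1 by (metis countable_empty ex_in_conv)

instantiation w1 :: wellorder
begin

definition less_eq_w1 :: "w1 \<Rightarrow> w1 \<Rightarrow> bool" where
  "x \<le> y \<longleftrightarrow> (Rep_w1 x, Rep_w1 y) \<in> omega1"

definition less_w1 :: "w1 \<Rightarrow> w1 \<Rightarrow> bool" where
  "x < y \<longleftrightarrow> (Rep_w1 x, Rep_w1 y) \<in> omega1 \<and> x \<noteq> y"

instance
proof
  have wo: "refl_on (Field omega1) omega1" "trans omega1" "antisym omega1" "total_on (Field omega1) omega1"
    "wf (omega1 - Id)"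
    using Well_order_omega1
    by (auto simp: well_order_on_def linear_order_on_def partial_order_on_def preorder_on_def)
  fix x y z :: w1
  show le_refl: "x \<le> x"
    using wo(1) Rep_w1 by (auto simp: less_eq_w1_def refl_on_def)
  show "x < y \<longleftrightarrow> x \<le> y \<and> \<not> y \<le> x"
    using wo(3) le_refl unfolding less_eq_w1_def less_w1_def antisym_def by (metis Rep_w1_inject)
  show "x \<le> y \<Longrightarrow> y \<le> z \<Longrightarrow> x \<le> z"
    using wo(2) by (auto simp: less_eq_w1_def elim: transE)
  show "x \<le> y \<Longrightarrow> y \<le> x \<Longrightarrow> x = y"
    using wo(3) unfolding less_eq_w1_def antisym_def by (metis Rep_w1_inject)
  show "x \<le> y \<or> y \<le> x"
    using wo(4) Rep_w1[of x] Rep_w1[of y] le_refl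
    by (auto simp: less_eq_w1_def total_on_def) (metis Rep_w1_inject)
  fix P :: "w1 \<Rightarrow> bool" and a
  assume step: "\<And>x. (\<And>y. y < x \<Longrightarrow> P y) \<Longrightarrow> P x"
  have "wf (inv_image (omega1 - Id) Rep_w1)" using wo(5) by blast
  then show "P a"
  proof (induction a rule: wf_induct_rule)
    case (less x)
    show ?case
    proof (rule step)
      fix y assume "y < x"
      then show "P y" using less by (auto simp: less_w1_def Rep_w1_inject)
    qed
  qed
qed

end

lemma countable_lessThan_w1: "countable {..<x::w1}"
proof -
  have "Rep_w1 ` {..<x} \<subseteq> underS omega1 (Rep_w1 x)"
    by (auto simp: underS_def less_w1_def Rep_w1_inject)
  then have "countable (Rep_w1 ` {..<x})"
    using countable_underS_omega1[OF Rep_w1] countable_subset by blast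
  moreover have "inj_on Rep_w1 {..<x}" by (auto simp: inj_on_def Rep_w1_inject)
  ultimately show ?thesis by (rule countable_image_inj_on)
qed

text \<open>
  Otherwise the countable initial segments given by the elements of \<open>A\<close> would cover \<open>\<omega>\<^sub>1\<close>.
\<close>

lemma countable_imp_bounded_w1:
  assumes "countable A"
  shows "\<exists>b::w1. \<forall>a\<in>A. a < b"
proof (rule ccontr)
  assume "\<nexists>b. \<forall>a\<in>A. a < b"
  then have "UNIV = (\<Union>a\<in>A. insert a {..<a})"
    by (fastforce simp: not_less order_le_less)
  moreover have "countable (\<Union>a\<in>A. insert a {..<a})"
    using assms countable_lessThan_w1 by auto
  ultimately have "countable (Rep_w1 ` UNIV)" by simp
  moreover have "Rep_w1 ` UNIV = Field omega1"
    by (rule type_definition.Rep_range[OF type_definition_w1])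
  ultimately show False using uncountable_Field_omega1 by simp
qed

lemma greater_w1: "\<exists>b::w1. a < b"
  using countable_imp_bounded_w1[of "{a}"] by auto

section \<open>A coherent family of summable labellings\<close>

definition eq_mod_finite :: "w1 \<Rightarrow> (w1 \<Rightarrow> 'a) \<Rightarrow> (w1 \<Rightarrow> 'a) \<Rightarrow> bool" where
  "eq_mod_finite \<alpha> f g \<longleftrightarrow> finite {\<xi>. \<xi> < \<alpha> \<and> f \<xi> \<noteq> g \<xi>}"

lemma eq_mod_finite_refl: "eq_mod_finite \<alpha> f f"
  and eq_mod_finite_sym: "eq_mod_finite \<alpha> f g \<Longrightarrow> eq_mod_finite \<alpha> g f"
  by (simp_all add: eq_mod_finite_def eq_commute)

lemma eq_mod_finite_trans:
  assumes "eq_mod_finite \<alpha> f g" "eq_mod_finite \<alpha> g h"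
  shows "eq_mod_finite \<alpha> f h"
proof -
  have "{\<xi>. \<xi> < \<alpha> \<and> f \<xi> \<noteq> h \<xi>} \<subseteq> {\<xi>. \<xi> < \<alpha> \<and> f \<xi> \<noteq> g \<xi>} \<union> {\<xi>. \<xi> < \<alpha> \<and> g \<xi> \<noteq> h \<xi>}" by auto
  then show ?thesis using assms unfolding eq_mod_finite_def by (meson finite_UnI finite_subset)
qed

lemma eq_mod_finite_mono:
  assumes "eq_mod_finite \<alpha> f g" "\<beta> \<le> \<alpha>"
  shows "eq_mod_finite \<beta> f g"
  using assms unfolding eq_mod_finite_def by (auto elim: finite_subset[rotated])

definition summable_labels :: "w1 \<Rightarrow> (w1 \<Rightarrow> int) \<Rightarrow> bool" where
  "summable_labels \<alpha> f \<longleftrightarrow> (\<lambda>\<xi>. (1/2::real) ^ nat \<bar>f \<xi>\<bar>) summable_on {..<\<alpha>}"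

lemma summable_labels_eq_mod_finite:
  assumes "summable_labels \<alpha> f" "eq_mod_finite \<alpha> f g"
  shows "summable_labels \<alpha> g"
proof -
  let ?D = "{\<xi>. \<xi> < \<alpha> \<and> f \<xi> \<noteq> g \<xi>}"
  have "(\<lambda>\<xi>. (1/2::real) ^ nat \<bar>f \<xi>\<bar>) summable_on ({..<\<alpha>} - ?D)"
    using assms(1) unfolding summable_labels_def by (rule summable_on_subset_banach) auto
  then have "(\<lambda>\<xi>. (1/2::real) ^ nat \<bar>g \<xi>\<bar>) summable_on ({..<\<alpha>} - ?D)"
    by (rule summable_on_cong[THEN iffD1, rotated]) auto
  moreover have "(\<lambda>\<xi>. (1/2::real) ^ nat \<bar>g \<xi>\<bar>) summable_on ?D"
    using assms(2) by (intro summable_on_finite) (simp add: eq_mod_finite_def)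
  ultimately have "(\<lambda>\<xi>. (1/2::real) ^ nat \<bar>g \<xi>\<bar>) summable_on (({..<\<alpha>} - ?D) \<union> ?D)"
    by (rule summable_on_union)
  moreover have "({..<\<alpha>} - ?D) \<union> ?D = {..<\<alpha>}" by auto
  ultimately show ?thesis by (simp add: summable_labels_def)
qed

text \<open>
  Only finitely many terms account for the bulk of the sum; these get a very large label instead.
\<close>

lemma summable_labels_small_modification:
  assumes "summable_labels \<alpha> f" "\<epsilon> > 0"
  shows "\<exists>g. eq_mod_finite \<alpha> f g \<and> (\<forall>S. finite S \<and> S \<subseteq> {..<\<alpha>} \<longrightarrow> (\<Sum>\<xi>\<in>S. (1/2::real) ^ nat \<bar>g \<xi>\<bar>) \<le> \<epsilon>)"
proof -
  let ?w = "\<lambda>\<xi>. (1/2::real) ^ nat \<bar>f \<xi>\<bar>"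
  have summ: "?w summable_on {..<\<alpha>}" using assms(1) by (simp add: summable_labels_def)
  obtain F where F: "finite F" "F \<subseteq> {..<\<alpha>}" and close: "dist (sum ?w F) (infsum ?w {..<\<alpha>}) \<le> \<epsilon> / 2"
    using infsum_finite_approximation[OF summ, of "\<epsilon> / 2"] assms(2) by auto
  have tail: "sum ?w S \<le> \<epsilon> / 2" if "finite S" "S \<subseteq> {..<\<alpha>} - F" for S
  proof -
    have "sum ?w F + sum ?w S = sum ?w (F \<union> S)"
      using that F by (subst sum.union_disjoint) auto
    also have "\<dots> \<le> infsum ?w {..<\<alpha>}"
      using that F by (intro finite_sum_le_infsum summ) auto
    finally show ?thesis using close unfolding dist_real_def by linarith
  qed
  have "(\<lambda>n. real (card F) * (1/2) ^ n) \<longlonglongrightarrow> real (card F) * 0"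
    by (intro tendsto_mult tendsto_const LIMSEQ_power_zero) auto
  then have "\<forall>\<^sub>F n in sequentially. real (card F) * (1/2) ^ n < \<epsilon> / 2"
    using assms(2) by (intro order_tendstoD) auto
  then obtain n where n: "real (card F) * (1/2) ^ n < \<epsilon> / 2"
    by (auto simp: eventually_sequentially)
  define g where "g = (\<lambda>\<xi>. if \<xi> \<in> F then int n else f \<xi>)"
  have "eq_mod_finite \<alpha> f g"
    unfolding eq_mod_finite_def by (rule finite_subset[OF _ F(1)]) (auto simp: g_def)
  moreover have "(\<Sum>\<xi>\<in>S. (1/2::real) ^ nat \<bar>g \<xi>\<bar>) \<le> \<epsilon>" if S: "finite S" "S \<subseteq> {..<\<alpha>}" for S
  proof -
    have "(\<Sum>\<xi>\<in>S. (1/2::real) ^ nat \<bar>g \<xi>\<bar>) =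
        (\<Sum>\<xi>\<in>S - F. (1/2::real) ^ nat \<bar>g \<xi>\<bar>) + (\<Sum>\<xi>\<in>S \<inter> F. (1/2::real) ^ nat \<bar>g \<xi>\<bar>)"
      using S(1) by (subst sum.Int_Diff[of S _ F]) auto
    also have "(\<Sum>\<xi>\<in>S - F. (1/2::real) ^ nat \<bar>g \<xi>\<bar>) = sum ?w (S - F)"
      by (rule sum.cong) (auto simp: g_def)
    also have "\<dots> \<le> \<epsilon> / 2" using S by (intro tail) auto
    also have "(\<Sum>\<xi>\<in>S \<inter> F. (1/2::real) ^ nat \<bar>g \<xi>\<bar>) = real (card (S \<inter> F)) * (1/2) ^ n"
      by (simp add: g_def)
    also have "\<dots> \<le> real (card F) * (1/2) ^ n"
      using F(1) by (intro mult_right_mono) (auto intro: card_mono)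
    finally show ?thesis using n by simp
  qed
  ultimately show ?thesis by blast
qed

text \<open>
  The extension step of the recursion, uniformly for successors and limits. Let \<open>b 0, b 1, \<dots>\<close> enumerate
  the ordinals below \<open>\<alpha>\<close>. On the \<open>n\<close>-th piece, which consists of the ordinals below \<open>b n\<close> that are above
  all earlier \<open>b i\<close>, use \<open>e (b n)\<close> after a finite modification that makes the sum over this piece at
  most \<open>2\<^bsup>-n\<^esup>\<close>; the end points \<open>b n\<close> get the label \<open>n\<close>. The total sum is finite, and below
  any \<open>\<beta> < \<alpha>\<close> only finitely many pieces matter, each of which agrees with \<open>e \<beta>\<close> up to finitely many
  places.
\<close>

lemma coherent_extension:
  fixes \<alpha> :: w1
  assumes summ: "\<And>\<beta>. \<beta> < \<alpha> \<Longrightarrow> summable_labels \<beta> (e \<beta>)"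
    and coh: "\<And>\<beta> \<gamma>. \<beta> < \<gamma> \<Longrightarrow> \<gamma> < \<alpha> \<Longrightarrow> eq_mod_finite \<beta> (e \<beta>) (e \<gamma>)"
  shows "\<exists>g. summable_labels \<alpha> g \<and> (\<forall>\<beta><\<alpha>. eq_mod_finite \<beta> (e \<beta>) g)"
proof (cases "{..<\<alpha>} = {}")
  case True
  then show ?thesis by (auto simp: summable_labels_def)
next
  case False
  define b where "b = from_nat_into {..<\<alpha>}"
  have b: "b n < \<alpha>" for n
    using from_nat_into[OF False, of n] by (simp add: b_def)
  have b_surj: "\<exists>n. \<beta> \<le> b n" if "\<beta> < \<alpha>" for \<beta>
    using from_nat_into_surj[OF countable_lessThan_w1, of \<beta> \<alpha>] that by (force simp: b_def)
  have "\<forall>n. \<exists>g. eq_mod_finite (b n) (e (b n)) g \<and>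
      (\<forall>S. finite S \<and> S \<subseteq> {..<b n} \<longrightarrow> (\<Sum>\<xi>\<in>S. (1/2::real) ^ nat \<bar>g \<xi>\<bar>) \<le> (1/2) ^ n)"
    using summable_labels_small_modification[OF summ[OF b]] by simp
  then obtain G where G: "\<And>n. eq_mod_finite (b n) (e (b n)) (G n)"
    and small: "\<And>n S. finite S \<Longrightarrow> S \<subseteq> {..<b n} \<Longrightarrow> (\<Sum>\<xi>\<in>S. (1/2::real) ^ nat \<bar>G n \<xi>\<bar>) \<le> (1/2) ^ n"
    by metis
  define N where "N = (\<lambda>\<xi>. LEAST n. \<xi> \<le> b n)"
  define g where "g = (\<lambda>\<xi>. if \<xi> = b (N \<xi>) then int (N \<xi>) else G (N \<xi>) \<xi>)"
  have N: "\<xi> \<le> b (N \<xi>)" if "\<xi> < \<alpha>" for \<xi>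
    unfolding N_def using b_surj[OF that] by (rule LeastI_ex)
  have N_le: "N \<xi> \<le> n" if "\<xi> \<le> b n" for \<xi> n
    unfolding N_def using that by (rule Least_le)
  \<comment> \<open>At most \<open>2\<^bsup>-n\<^esup>\<close> comes from \<open>G n\<close> and at most \<open>2\<^bsup>-n\<^esup>\<close> from the end point \<open>b n\<close>.\<close>
  have piece: "(\<Sum>\<xi>\<in>{\<xi>\<in>S. N \<xi> = n}. (1/2::real) ^ nat \<bar>g \<xi>\<bar>) \<le> 2 * (1/2) ^ n"
    if S: "finite S" "S \<subseteq> {..<\<alpha>}" for S n
  proof -
    let ?S = "{\<xi>\<in>S. N \<xi> = n}"
    have "(\<Sum>\<xi>\<in>?S. (1/2::real) ^ nat \<bar>g \<xi>\<bar>) =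
        (\<Sum>\<xi>\<in>?S - {b n}. (1/2::real) ^ nat \<bar>g \<xi>\<bar>) + (\<Sum>\<xi>\<in>?S \<inter> {b n}. (1/2::real) ^ nat \<bar>g \<xi>\<bar>)"
      using S(1) by (subst sum.Int_Diff[of ?S _ "{b n}"]) auto
    also have "(\<Sum>\<xi>\<in>?S - {b n}. (1/2::real) ^ nat \<bar>g \<xi>\<bar>) = (\<Sum>\<xi>\<in>?S - {b n}. (1/2::real) ^ nat \<bar>G n \<xi>\<bar>)"
      by (rule sum.cong) (auto simp: g_def)
    also have "\<dots> \<le> (1/2) ^ n"
    proof (rule small)
      show "?S - {b n} \<subseteq> {..<b n}" using S(2) N by force
    qed (use S in auto)
    also have "(\<Sum>\<xi>\<in>?S \<inter> {b n}. (1/2::real) ^ nat \<bar>g \<xi>\<bar>) \<le> (1/2) ^ n"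
    proof (cases "b n \<in> ?S")
      case True
      then have "?S \<inter> {b n} = {b n}" "N (b n) = n" by auto
      then show ?thesis by (simp add: g_def)
    next
      case False
      then have "?S \<inter> {b n} = {}" by auto
      then show ?thesis by simp
    qed
    finally show ?thesis by simp
  qed
  have bound: "(\<Sum>\<xi>\<in>S. (1/2::real) ^ nat \<bar>g \<xi>\<bar>) \<le> 4" if S: "finite S" "S \<subseteq> {..<\<alpha>}" for S
  proof -
    obtain M where M: "\<And>\<xi>. \<xi> \<in> S \<Longrightarrow> N \<xi> \<le> M"
      using finite_nat_set_iff_bounded_le[of "N ` S"] S(1) by auto
    have "(\<Sum>\<xi>\<in>S. (1/2::real) ^ nat \<bar>g \<xi>\<bar>) =
        (\<Sum>n\<in>{..M}. \<Sum>\<xi>\<in>{\<xi>\<in>S. N \<xi> = n}. (1/2::real) ^ nat \<bar>g \<xi>\<bar>)"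
      by (rule sum.group[symmetric]) (use S M in auto)
    also have "\<dots> \<le> (\<Sum>n\<in>{..M}. 2 * (1/2) ^ n)"
      by (intro sum_mono piece S)
    also have "\<dots> = 2 * (\<Sum>n\<in>{..M}. (1/2) ^ n)" by (simp add: sum_distrib_left)
    also have "(\<Sum>n\<in>{..M}. (1/2::real) ^ n) = 2 - (1/2) ^ M"
      by (induction M) auto
    also have "2 * (2 - (1/2) ^ M) \<le> (4::real)" by simp
    finally show ?thesis by simp
  qed
  have "summable_labels \<alpha> g"
    unfolding summable_labels_def
    by (rule nonneg_bdd_above_summable_on) (auto intro!: bdd_aboveI[of _ 4] bound)
  moreover have "eq_mod_finite \<beta> (e \<beta>) g" if "\<beta> < \<alpha>" for \<beta>
  proof -
    obtain n where n: "\<beta> \<le> b n" using b_surj[OF \<open>\<beta> < \<alpha>\<close>] by blast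
    let ?E = "\<lambda>i. {b i} \<union> {\<xi>. \<xi> < min \<beta> (b i) \<and> e \<beta> \<xi> \<noteq> G i \<xi>}"
    have "finite (?E i)" for i
    proof -
      have "eq_mod_finite (min \<beta> (b i)) (e \<beta>) (e (b i))"
      proof (cases \<beta> "b i" rule: linorder_cases)
        case less
        then show ?thesis using coh b by simp
      next
        case greater
        then show ?thesis using coh[OF greater that] eq_mod_finite_sym by simp
      qed (simp add: eq_mod_finite_refl)
      then have "eq_mod_finite (min \<beta> (b i)) (e \<beta>) (G i)"
        using eq_mod_finite_mono[OF G] by (rule eq_mod_finite_trans) simp
      then show ?thesis by (simp add: eq_mod_finite_def)
    qed
    moreover have "{\<xi>. \<xi> < \<beta> \<and> e \<beta> \<xi> \<noteq> g \<xi>} \<subseteq> (\<Union>i\<le>n. ?E i)"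
    proof
      fix \<xi> assume \<xi>: "\<xi> \<in> {\<xi>. \<xi> < \<beta> \<and> e \<beta> \<xi> \<noteq> g \<xi>}"
      then have "N \<xi> \<le> n" "\<xi> \<le> b (N \<xi>)" using n N_le N that by auto
      moreover have "\<xi> \<in> ?E (N \<xi>)"
        using \<xi> \<open>\<xi> \<le> b (N \<xi>)\<close> by (auto simp: g_def order_le_less)
      ultimately show "\<xi> \<in> (\<Union>i\<le>n. ?E i)" by blast
    qed
    ultimately show ?thesis
      unfolding eq_mod_finite_def by (meson finite_UN finite_atMost finite_subset)
  qed
  ultimately show ?thesis by blast
qed

theorem coherent_labellings_exist:
  "\<exists>e :: w1 \<Rightarrow> w1 \<Rightarrow> int. (\<forall>\<alpha>. summable_labels \<alpha> (e \<alpha>)) \<and>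
     (\<forall>\<alpha> \<beta>. \<beta> < \<alpha> \<longrightarrow> eq_mod_finite \<beta> (e \<beta>) (e \<alpha>))"
proof -
  let ?P = "\<lambda>(e :: w1 \<Rightarrow> w1 \<Rightarrow> int) \<alpha> g. summable_labels \<alpha> g \<and> (\<forall>\<beta><\<alpha>. eq_mod_finite \<beta> (e \<beta>) g)"
  have "\<exists>e. \<forall>\<alpha>. ?P e \<alpha> (e \<alpha>)"
  proof (rule dependent_wellorder_choice)
    show "?P f \<alpha> g = ?P f' \<alpha> g" if "\<And>\<beta>. \<beta> < \<alpha> \<Longrightarrow> f \<beta> = f' \<beta>" for g f f' and \<alpha> :: w1
      using that by auto
    show "\<exists>g. ?P e \<alpha> g" if "\<And>\<beta>. \<beta> < \<alpha> \<Longrightarrow> ?P e \<beta> (e \<beta>)" for \<alpha> e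
      using coherent_extension[of \<alpha> e] that by auto
  qed
  then show ?thesis by blast
qed

section \<open>Gluing charts\<close>

text \<open>
  Charts are glued along the sets where they agree. Each change of charts is the restriction of a
  continuous map \<open>\<theta>\<close> that is defined on the whole space. This has two consequences: the overlap of two
  charts is open, as the preimage of a chart domain under \<open>\<theta>\<close>, and the result is Hausdorff, because the
  graph of \<open>\<theta>\<close> is closed.
\<close>

locale gluing =
  fixes I :: "'i set" and S :: "'i \<Rightarrow> 'b::t2_space set" and \<Psi> :: "'i \<Rightarrow> 'b \<Rightarrow> 'a"
  assumes open_S: "\<And>v. v \<in> I \<Longrightarrow> open (S v)"
    and transition: "\<And>v w. \<lbrakk>v \<in> I; w \<in> I\<rbrakk> \<Longrightarrow>
      \<exists>\<theta>. continuous_on UNIV \<theta> \<and> (\<forall>a\<in>S v. \<forall>b\<in>S w. \<Psi> v a = \<Psi> w b \<longleftrightarrow> b = \<theta> a)"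
begin

definition glued :: "'a topology" where
  "glued = topology (\<lambda>U. U \<subseteq> (\<Union>v\<in>I. \<Psi> v ` S v) \<and> (\<forall>v\<in>I. open {a \<in> S v. \<Psi> v a \<in> U}))"

lemma openin_glued:
  "openin glued U \<longleftrightarrow> U \<subseteq> (\<Union>v\<in>I. \<Psi> v ` S v) \<and> (\<forall>v\<in>I. open {a \<in> S v. \<Psi> v a \<in> U})"
proof -
  let ?P = "\<lambda>U. U \<subseteq> (\<Union>v\<in>I. \<Psi> v ` S v) \<and> (\<forall>v\<in>I. open {a \<in> S v. \<Psi> v a \<in> U})"
  have "istopology ?P"
    unfolding istopology_def
  proof (rule conjI; intro allI impI)
    fix U V assume U: "?P U" and V: "?P V"
    have "{a \<in> S v. \<Psi> v a \<in> U \<inter> V} = {a \<in> S v. \<Psi> v a \<in> U} \<inter> {a \<in> S v. \<Psi> v a \<in> V}" for v by auto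
    then have "open {a \<in> S v. \<Psi> v a \<in> U \<inter> V}" if "v \<in> I" for v
      using U V that by (simp add: open_Int)
    then show "?P (U \<inter> V)" using U by blast
  next
    fix \<K> assume K: "\<forall>U\<in>\<K>. ?P U"
    have "{a \<in> S v. \<Psi> v a \<in> \<Union>\<K>} = (\<Union>U\<in>\<K>. {a \<in> S v. \<Psi> v a \<in> U})" for v by auto
    then have "open {a \<in> S v. \<Psi> v a \<in> \<Union>\<K>}" if "v \<in> I" for v
      using K that by (simp add: open_UN)
    then show "?P (\<Union>\<K>)" using K by blast
  qed
  then show ?thesis
    unfolding glued_def by (simp add: topology_inverse')
qed

lemma topspace_glued: "topspace glued = (\<Union>v\<in>I. \<Psi> v ` S v)"
proof
  show "topspace glued \<subseteq> (\<Union>v\<in>I. \<Psi> v ` S v)"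
    using openin_topspace[of glued] by (simp only: openin_glued)
  have "{a \<in> S v. \<Psi> v a \<in> (\<Union>v\<in>I. \<Psi> v ` S v)} = S v" if "v \<in> I" for v
    using that by blast
  then have "openin glued (\<Union>v\<in>I. \<Psi> v ` S v)"
    using open_S by (simp add: openin_glued)
  then show "(\<Union>v\<in>I. \<Psi> v ` S v) \<subseteq> topspace glued"
    by (rule openin_subset)
qed

lemma inj_chart:
  assumes "v \<in> I" "a \<in> S v" "b \<in> S v" "\<Psi> v a = \<Psi> v b"
  shows "a = b"
  using transition[OF assms(1,1)] assms(2-) by metis

lemma chart_open:
  assumes v: "v \<in> I" and O: "open O'" "O' \<subseteq> S v"
  shows "openin glued (\<Psi> v ` O')"
  unfolding openin_glued
proof (intro conjI ballI)
  show "\<Psi> v ` O' \<subseteq> (\<Union>v\<in>I. \<Psi> v ` S v)" using v O(2) by blast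
  fix w assume w: "w \<in> I"
  obtain \<theta> where \<theta>: "continuous_on UNIV \<theta>" "\<forall>a\<in>S w. \<forall>b\<in>S v. \<Psi> w a = \<Psi> v b \<longleftrightarrow> b = \<theta> a"
    using transition[OF w v] by blast
  have "{a \<in> S w. \<Psi> w a \<in> \<Psi> v ` O'} = S w \<inter> \<theta> -` O'"
    using \<theta>(2) O(2) by (auto simp: image_iff subset_iff)
  then show "open {a \<in> S w. \<Psi> w a \<in> \<Psi> v ` O'}"
    using open_S[OF w] \<theta>(1) O(1) by (simp add: open_Int open_vimage)
qed

lemma chart_cover_glued: "chart_cover I (\<lambda>v. top_of_set (S v)) \<Psi> glued"
  unfolding chart_cover_def
proof (intro conjI ballI)
  fix v assume v: "v \<in> I"
  show "continuous_map (top_of_set (S v)) glued (\<Psi> v)"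
    unfolding continuous_map
  proof (intro conjI allI impI)
    show "\<Psi> v ` topspace (top_of_set (S v)) \<subseteq> topspace glued"
      using v by (auto simp: topspace_glued)
    fix U assume "openin glued U"
    then show "openin (top_of_set (S v)) {a \<in> topspace (top_of_set (S v)). \<Psi> v a \<in> U}"
      using v open_S[OF v] by (auto simp: openin_glued openin_open_eq)
  qed
  show "open_map (top_of_set (S v)) glued (\<Psi> v)"
    unfolding open_map_def using chart_open[OF v] open_S[OF v] by (simp add: openin_open_eq)
qed (simp add: topspace_glued)

lemma chart_homeomorphic:
  assumes v: "v \<in> I" and O: "open O'" "O' \<subseteq> S v"
  shows "top_of_set O' homeomorphic_space subtopology glued (\<Psi> v ` O')"
proof -
  have cont: "continuous_map (top_of_set (S v)) glued (\<Psi> v)"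
    using chart_cover_glued v by (simp add: chart_cover_def)
  have "homeomorphic_map (top_of_set O') (subtopology glued (\<Psi> v ` O')) (\<Psi> v)"
  proof (rule bijective_open_imp_homeomorphic_map)
    show "continuous_map (top_of_set O') (subtopology glued (\<Psi> v ` O')) (\<Psi> v)"
      using continuous_map_from_subtopology[OF cont, of O'] O(2)
      by (auto simp: continuous_map_in_subtopology subtopology_subtopology Int_absorb1)
    show "open_map (top_of_set O') (subtopology glued (\<Psi> v ` O')) (\<Psi> v)"
      unfolding open_map_def
    proof (intro allI impI)
      fix U assume "openin (top_of_set O') U"
      then have U: "open U" "U \<subseteq> O'" using O(1) by (auto simp: openin_open_eq)
      then have "openin glued (\<Psi> v ` U)" using O(2) by (intro chart_open[OF v]) auto
      then show "openin (subtopology glued (\<Psi> v ` O')) (\<Psi> v ` U)"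
        unfolding openin_subtopology using U(2) by (metis Int_absorb2 image_mono)
    qed
    have "\<Psi> v ` O' \<subseteq> topspace glued" using v O(2) by (auto simp: topspace_glued)
    then show "\<Psi> v ` topspace (top_of_set O') = topspace (subtopology glued (\<Psi> v ` O'))" by auto
    show "inj_on (\<Psi> v) (topspace (top_of_set O'))"
      using inj_chart[OF v] O(2) by (auto simp: inj_on_def subset_iff)
  qed
  then show ?thesis by (rule homeomorphic_map_imp_homeomorphic_space)
qed

lemma Hausdorff_glued: "Hausdorff_space glued"
  unfolding Hausdorff_space_def
proof (intro allI impI, elim conjE)
  fix x y assume "x \<in> topspace glued" "y \<in> topspace glued" "x \<noteq> y"
  then obtain v a w b where v: "v \<in> I" "a \<in> S v" "x = \<Psi> v a" and w: "w \<in> I" "b \<in> S w" "y = \<Psi> w b"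
    by (auto simp: topspace_glued)
  obtain \<theta> where \<theta>: "continuous_on UNIV \<theta>" "\<forall>a\<in>S v. \<forall>b\<in>S w. \<Psi> v a = \<Psi> w b \<longleftrightarrow> b = \<theta> a"
    using transition[OF v(1) w(1)] by blast
  have "b \<noteq> \<theta> a" using \<theta>(2) v w \<open>x \<noteq> y\<close> by auto
  then obtain A B where AB: "open A" "open B" "\<theta> a \<in> A" "b \<in> B" "A \<inter> B = {}"
    using hausdorff[of "\<theta> a" b] by auto
  let ?U = "S v \<inter> \<theta> -` A" and ?V = "S w \<inter> B"
  have "openin glued (\<Psi> v ` ?U)" "openin glued (\<Psi> w ` ?V)"
    using v(1) w(1) open_S \<theta>(1) AB by (auto intro!: chart_open open_Int open_vimage)
  moreover have "x \<in> \<Psi> v ` ?U" "y \<in> \<Psi> w ` ?V" using v w AB by auto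
  moreover have "disjnt (\<Psi> v ` ?U) (\<Psi> w ` ?V)"
    using \<theta>(2) AB(5) by (fastforce simp: disjnt_def)
  ultimately show "\<exists>U V. openin glued U \<and> openin glued V \<and> x \<in> U \<and> y \<in> V \<and> disjnt U V" by blast
qed


lemma glued_homotopy:
  assumes cont: "\<And>v. v \<in> I \<Longrightarrow> continuous_on ({0..1::real} \<times> S v) (\<gamma> v)"
    and into: "\<And>v t a. \<lbrakk>v \<in> I; t \<in> {0..1}; a \<in> S v\<rbrakk> \<Longrightarrow> \<gamma> v (t, a) \<in> S v"
    and compat: "\<And>v w t a b. \<lbrakk>v \<in> I; w \<in> I; t \<in> {0..1}; a \<in> S v; b \<in> S w; \<Psi> v a = \<Psi> w b\<rbrakk> \<Longrightarrow>
      \<Psi> v (\<gamma> v (t, a)) = \<Psi> w (\<gamma> w (t, b))"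
  obtains h where "continuous_map (prod_topology (top_of_set {0..1}) glued) glued h"
    "\<And>v t a. \<lbrakk>v \<in> I; t \<in> {0..1}; a \<in> S v\<rbrakk> \<Longrightarrow> h (t, \<Psi> v a) = \<Psi> v (\<gamma> v (t, a))"
proof -
  define pick where "pick = (\<lambda>x. SOME va. fst va \<in> I \<and> snd va \<in> S (fst va) \<and> x = \<Psi> (fst va) (snd va))"
  define h where "h = (\<lambda>(t, x). \<Psi> (fst (pick x)) (\<gamma> (fst (pick x)) (t, snd (pick x))))"
  have pick: "fst (pick (\<Psi> v a)) \<in> I \<and> snd (pick (\<Psi> v a)) \<in> S (fst (pick (\<Psi> v a))) \<and>
      \<Psi> v a = \<Psi> (fst (pick (\<Psi> v a))) (snd (pick (\<Psi> v a)))" if "v \<in> I" "a \<in> S v" for v a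
    unfolding pick_def by (rule someI[of _ "(v, a)"]) (use that in auto)
  have h: "h (t, \<Psi> v a) = \<Psi> v (\<gamma> v (t, a))" if "v \<in> I" "t \<in> {0..1}" "a \<in> S v" for v t a
    using compat[of "fst (pick (\<Psi> v a))" v t "snd (pick (\<Psi> v a))" a] pick[of v a] that by (simp add: h_def)
  have "continuous_map (prod_topology (top_of_set {0..1}) glued) glued h"
  proof (rule homotopy_from_charts[OF chart_cover_glued])
    fix v assume v: "v \<in> I"
    have "continuous_map (top_of_set ({0..1} \<times> S v)) (top_of_set (S v)) (\<gamma> v)"
      using cont[OF v] into[OF v] by (auto simp: continuous_map_in_subtopology)
    then have "continuous_map (top_of_set ({0..1} \<times> S v)) glued (\<Psi> v \<circ> \<gamma> v)"
      by (rule continuous_map_compose) (use chart_cover_glued v in \<open>simp add: chart_cover_def\<close>)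
    then show "continuous_map (prod_topology (top_of_set {0..1}) (top_of_set (S v))) glued (\<lambda>(t, a). h (t, \<Psi> v a))"
      unfolding prod_topology_subtopology_eu
      by (rule continuous_map_eq) (use h v in auto)
  qed
  then show ?thesis using h that by blast
qed

end

section \<open>Branches and their heights\<close>

definition bottom_level :: w1 where "bottom_level = (LEAST x. True)"
definition second_level :: w1 where "second_level = (LEAST x. bottom_level < x)"

lemma bottom_level_le [simp]: "bottom_level \<le> x"
  unfolding bottom_level_def by (simp add: Least_le)

lemma not_less_bottom_level [simp]: "\<not> x < bottom_level"
  by (simp add: not_less)

lemma bottom_level_less_second_level: "bottom_level < second_level"
  unfolding second_level_def using greater_w1 by (rule LeastI_ex)

lemma le_second_level_iff: "\<xi> \<le> second_level \<longleftrightarrow> \<xi> = bottom_level \<or> \<xi> = second_level"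
  using bottom_level_less_second_level Least_le[of "\<lambda>x. bottom_level < x" \<xi>] bottom_level_le[of \<xi>] unfolding second_level_def[symmetric]
  by (metis order.antisym order.strict_implies_order order_le_less)

definition coherent_family :: "w1 \<Rightarrow> w1 \<Rightarrow> int" where
  "coherent_family = (SOME e. (\<forall>\<alpha>. summable_labels \<alpha> (e \<alpha>)) \<and>
     (\<forall>\<alpha> \<beta>. \<beta> < \<alpha> \<longrightarrow> eq_mod_finite \<beta> (e \<beta>) (e \<alpha>)))"

lemma coherent_family:
  "summable_labels \<alpha> (coherent_family \<alpha>)"
  "\<beta> < \<alpha> \<Longrightarrow> eq_mod_finite \<beta> (coherent_family \<beta>) (coherent_family \<alpha>)"
  using someI_ex[OF coherent_labellings_exist] unfolding coherent_family_def by blast+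

text \<open>
  A pair \<open>(\<alpha>, u)\<close> stands for the restriction of \<open>u\<close> to the ordinals below \<open>\<alpha>\<close>. With total functions
  \<open>u\<close>, the prefixes of a branch are obtained by changing \<open>\<alpha>\<close> alone.
\<close>

definition branches :: "(w1 \<times> (w1 \<Rightarrow> int)) set" where
  "branches = {(\<alpha>, u). bottom_level < \<alpha> \<and> eq_mod_finite \<alpha> (coherent_family \<alpha>) u}"

lemma branch_prefix:
  assumes "(\<alpha>, u) \<in> branches" "bottom_level < \<beta>" "\<beta> \<le> \<alpha>"
  shows "(\<beta>, u) \<in> branches"
proof (cases "\<beta> = \<alpha>")
  case False
  then have "eq_mod_finite \<beta> (coherent_family \<beta>) (coherent_family \<alpha>)"
    using assms(3) by (intro coherent_family(2)) simp
  moreover have "eq_mod_finite \<beta> (coherent_family \<alpha>) u"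
    using assms(1) by (intro eq_mod_finite_mono[OF _ assms(3)]) (simp add: branches_def)
  ultimately have "eq_mod_finite \<beta> (coherent_family \<beta>) u"
    by (rule eq_mod_finite_trans)
  then show ?thesis
    using assms(2) by (simp add: branches_def)
qed (use assms in simp)

lemma branch_cong:
  assumes "(\<alpha>, u) \<in> branches" "\<And>\<xi>. \<xi> < \<alpha> \<Longrightarrow> u \<xi> = u' \<xi>"
  shows "(\<alpha>, u') \<in> branches"
proof -
  have "{\<xi>. \<xi> < \<alpha> \<and> coherent_family \<alpha> \<xi> \<noteq> u \<xi>} = {\<xi>. \<xi> < \<alpha> \<and> coherent_family \<alpha> \<xi> \<noteq> u' \<xi>}"
    using assms(2) by auto
  then show ?thesis using assms(1) by (simp add: branches_def eq_mod_finite_def)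
qed

text \<open>
  Coherence is what makes branches extendable to every countable length.
\<close>

lemma branch_extend:
  assumes "(\<alpha>, u) \<in> branches" "\<alpha> \<le> \<beta>"
  obtains u' where "(\<beta>, u') \<in> branches" "\<And>\<xi>. \<xi> < \<alpha> \<Longrightarrow> u' \<xi> = u \<xi>"
proof -
  let ?u = "\<lambda>\<xi>. if \<xi> < \<alpha> then u \<xi> else coherent_family \<beta> \<xi>"
  have "eq_mod_finite \<alpha> (coherent_family \<beta>) u"
  proof (cases "\<alpha> = \<beta>")
    case False
    then have "\<alpha> < \<beta>" using assms(2) by simp
    then have "eq_mod_finite \<alpha> (coherent_family \<beta>) (coherent_family \<alpha>)"
      by (rule eq_mod_finite_sym[OF coherent_family(2)])
    moreover have "eq_mod_finite \<alpha> (coherent_family \<alpha>) u"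
      using assms(1) by (simp add: branches_def)
    ultimately show ?thesis by (rule eq_mod_finite_trans)
  qed (use assms in \<open>simp add: branches_def\<close>)
  then have "finite {\<xi>. \<xi> < \<alpha> \<and> coherent_family \<beta> \<xi> \<noteq> u \<xi>}" by (simp add: eq_mod_finite_def)
  moreover have "{\<xi>. \<xi> < \<beta> \<and> coherent_family \<beta> \<xi> \<noteq> ?u \<xi>} \<subseteq> {\<xi>. \<xi> < \<alpha> \<and> coherent_family \<beta> \<xi> \<noteq> u \<xi>}" by auto
  ultimately have "eq_mod_finite \<beta> (coherent_family \<beta>) ?u"
    unfolding eq_mod_finite_def by (rule finite_subset[rotated])
  moreover have "bottom_level < \<beta>" using assms by (auto simp: branches_def intro: less_le_trans)
  ultimately have "(\<beta>, ?u) \<in> branches" by (simp add: branches_def)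
  then show thesis by (rule that) simp
qed

lemma branch_update:
  assumes "(\<alpha>, u) \<in> branches"
  shows "(\<alpha>, u(\<beta> := k)) \<in> branches"
proof -
  have "eq_mod_finite \<alpha> u (u(\<beta> := k))"
    unfolding eq_mod_finite_def by (rule finite_subset[of _ "{\<beta>}"]) auto
  then show ?thesis
    using assms eq_mod_finite_trans[of \<alpha> "coherent_family \<alpha>" u] by (simp add: branches_def)
qed

text \<open>
  Constant weights on the two lowest levels make the heights independent of the labels there, so that
  labels on these levels can be changed without changing any strip.
\<close>

definition weight :: "w1 \<Rightarrow> int \<Rightarrow> real" where
  "weight \<xi> k = (if \<xi> \<le> second_level then 1 else (1/2) ^ nat \<bar>k\<bar>)"

lemma weight_pos [simp]: "0 < weight \<xi> k" and weight_nonneg [simp]: "0 \<le> weight \<xi> k"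
  by (simp_all add: weight_def)

lemma weight_bottom_level [simp]: "weight bottom_level k = 1"
  by (simp add: weight_def)

lemma summable_weight:
  assumes "(\<alpha>, u) \<in> branches" "\<beta> \<le> \<alpha>"
  shows "(\<lambda>\<xi>. weight \<xi> (u \<xi>)) summable_on {..<\<beta>}"
proof -
  have "summable_labels \<alpha> u"
    using assms(1) summable_labels_eq_mod_finite[OF coherent_family(1)] by (auto simp: branches_def)
  then have "(\<lambda>\<xi>. (1/2::real) ^ nat \<bar>u \<xi>\<bar>) summable_on ({..<\<beta>} - {bottom_level, second_level})"
    unfolding summable_labels_def by (rule summable_on_subset_banach) (use assms(2) in auto)
  then have "(\<lambda>\<xi>. weight \<xi> (u \<xi>)) summable_on ({..<\<beta>} - {bottom_level, second_level})"
    by (rule summable_on_cong[THEN iffD1, rotated]) (auto simp: weight_def le_second_level_iff)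
  moreover have "(\<lambda>\<xi>. weight \<xi> (u \<xi>)) summable_on ({..<\<beta>} \<inter> {bottom_level, second_level})"
    by (intro summable_on_finite) auto
  ultimately have "(\<lambda>\<xi>. weight \<xi> (u \<xi>)) summable_on (({..<\<beta>} - {bottom_level, second_level}) \<union> ({..<\<beta>} \<inter> {bottom_level, second_level}))"
    by (rule summable_on_union)
  moreover have "({..<\<beta>} - {bottom_level, second_level}) \<union> ({..<\<beta>} \<inter> {bottom_level, second_level}) = {..<\<beta>}" by blast
  ultimately show ?thesis by simp
qed

definition height :: "(w1 \<Rightarrow> int) \<Rightarrow> w1 \<Rightarrow> real" where
  "height u \<beta> = infsum (\<lambda>\<xi>. weight \<xi> (u \<xi>)) {..<\<beta>}"

lemma height_bottom_level [simp]: "height u bottom_level = 0"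
proof -
  have "{..<bottom_level} = {}" by auto
  then show ?thesis by (simp add: height_def)
qed

lemma height_nonneg [simp]: "0 \<le> height u \<beta>"
  by (simp add: height_def infsum_nonneg)

lemma height_cong: "(\<And>\<xi>. \<xi> < \<beta> \<Longrightarrow> u \<xi> = u' \<xi>) \<Longrightarrow> height u \<beta> = height u' \<beta>"
  unfolding height_def by (rule infsum_cong) simp

lemma height_step:
  assumes "(\<alpha>, u) \<in> branches" "\<beta> < \<gamma>" "\<gamma> \<le> \<alpha>"
  shows "height u \<beta> + weight \<beta> (u \<beta>) \<le> height u \<gamma>"
proof -
  let ?w = "\<lambda>\<xi>. weight \<xi> (u \<xi>)"
  have summ: "?w summable_on {..<\<beta>}" "?w summable_on {..<\<gamma>}"
    using assms by (auto intro!: summable_weight[OF assms(1)])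
  have "height u \<beta> + weight \<beta> (u \<beta>) = infsum ?w (insert \<beta> {..<\<beta>})"
    using summ(1) by (subst infsum_insert) (auto simp: height_def)
  also have "\<dots> \<le> infsum ?w {..<\<gamma>}"
    using assms(2) summ
    by (intro infsum_mono_neutral) (auto simp: summable_on_insert_iff)
  finally show ?thesis by (simp add: height_def)
qed

text \<open>
  The block of level \<open>\<beta>\<close> on a branch covers the heights from \<open>height u \<beta>\<close> on, up to the next node. The
  bottom block has no lower end, so that the surface has no boundary.
\<close>

definition in_block :: "(w1 \<Rightarrow> int) \<Rightarrow> w1 \<Rightarrow> real \<Rightarrow> bool" where
  "in_block u \<beta> c \<longleftrightarrow> (\<beta> = bottom_level \<or> height u \<beta> \<le> c) \<and> c < height u \<beta> + weight \<beta> (u \<beta>)"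

lemma in_block_unique:
  assumes "(\<alpha>, u) \<in> branches" "\<beta> < \<alpha>" "\<gamma> < \<alpha>" "in_block u \<beta> c" "in_block u \<gamma> c"
  shows "\<beta> = \<gamma>"
proof -
  have False if "\<beta> < \<gamma>" "\<gamma> < \<alpha>" "in_block u \<beta> c" "in_block u \<gamma> c" for \<beta> \<gamma>
    using that height_step[OF assms(1) that(1)] bottom_level_le[of \<beta>] by (fastforce simp: in_block_def)
  then show ?thesis using assms by (metis linorder_neqE)
qed

text \<open>
  The set of the heights of the nodes is closed in the reals, since the height at a limit ordinal is
  the supremum of the heights before it. Hence there is a last node at or below \<open>c\<close>.
\<close>

lemma in_block_exists:
  assumes br: "(\<alpha>, u) \<in> branches" and c: "c < height u \<alpha>"
  shows "\<exists>\<beta><\<alpha>. in_block u \<beta> c"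
proof (cases "c < 0")
  case True
  then show ?thesis using br by (intro exI[of _ bottom_level]) (auto simp: branches_def in_block_def)
next
  case False
  let ?w = "\<lambda>\<xi>. weight \<xi> (u \<xi>)"
  define \<gamma> where "\<gamma> = (LEAST \<gamma>. c < height u \<gamma>)"
  have \<gamma>: "c < height u \<gamma>" unfolding \<gamma>_def using c by (rule LeastI)
  have \<gamma>_le: "\<gamma> \<le> \<alpha>" unfolding \<gamma>_def using c by (rule Least_le)
  have below: "height u \<xi> \<le> c" if "\<xi> < \<gamma>" for \<xi>
    using not_less_Least[OF that[unfolded \<gamma>_def]] by simp
  \<comment> \<open>Finitely many weights already exceed \<open>c\<close>; the last of their indices is the predecessor of \<open>\<gamma>\<close>.\<close>
  obtain F where F: "finite F" "F \<subseteq> {..<\<gamma>}" "c < sum ?w F"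
  proof -
    obtain F where F: "finite F" "F \<subseteq> {..<\<gamma>}" "dist (sum ?w F) (height u \<gamma>) \<le> (height u \<gamma> - c) / 2"
      using infsum_finite_approximation[OF summable_weight[OF br \<gamma>_le], of "(height u \<gamma> - c) / 2"] \<gamma>
      by (auto simp: height_def)
    have "height u \<gamma> - sum ?w F \<le> (height u \<gamma> - c) / 2"
      using F(3) unfolding dist_real_def by (rule abs_le_D2[THEN order_trans[rotated]]) simp
    also have "\<dots> < height u \<gamma> - c" using \<gamma> by simp
    finally have "c < sum ?w F" by simp
    with F show ?thesis using that by blast
  qed
  have "F \<noteq> {}" using F(3) False by auto
  define \<beta> where "\<beta> = Max F"
  have "\<beta> \<in> F" unfolding \<beta>_def using F(1) \<open>F \<noteq> {}\<close> by (rule Max_in)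
  then have "\<beta> < \<gamma>" using F(2) by auto
  have F_sub: "F \<subseteq> insert \<beta> {..<\<beta>}" using F(1) by (auto simp: \<beta>_def less_le)
  have summ: "?w summable_on {..<\<beta>}"
    using br \<gamma>_le \<open>\<beta> < \<gamma>\<close> by (intro summable_weight) auto
  have "sum ?w F \<le> infsum ?w (insert \<beta> {..<\<beta>})"
    using F(1) F_sub summ by (intro finite_sum_le_infsum) (auto simp: summable_on_insert_iff)
  also have "\<dots> = height u \<beta> + weight \<beta> (u \<beta>)"
    using summ by (subst infsum_insert) (auto simp: height_def)
  finally have "in_block u \<beta> c"
    using F(3) below[OF \<open>\<beta> < \<gamma>\<close>] by (simp add: in_block_def)
  moreover have "\<beta> < \<alpha>" using \<open>\<beta> < \<gamma>\<close> \<gamma>_le by (rule less_le_trans)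
  ultimately show ?thesis by blast
qed

definition block :: "w1 \<times> (w1 \<Rightarrow> int) \<Rightarrow> real \<Rightarrow> w1" where
  "block v c = (SOME \<beta>. \<beta> < fst v \<and> in_block (snd v) \<beta> c)"

lemma block:
  assumes "(\<alpha>, u) \<in> branches" "c < height u \<alpha>"
  shows "block (\<alpha>, u) c < \<alpha>" "in_block u (block (\<alpha>, u) c) c"
  using someI_ex[OF in_block_exists[OF assms, simplified Bex_def]] by (auto simp: block_def)

lemma block_eqI:
  assumes "(\<alpha>, u) \<in> branches" "\<beta> < \<alpha>" "in_block u \<beta> c"
  shows "block (\<alpha>, u) c = \<beta>"
proof -
  have "c < height u \<alpha>"
    using assms height_step[OF assms(1,2)] by (fastforce simp: in_block_def)
  then show ?thesis using block[OF assms(1)] in_block_unique[OF assms(1)] assms by blast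
qed

lemma in_block_cong:
  assumes "\<And>\<xi>. \<xi> \<le> \<beta> \<Longrightarrow> u \<xi> = u' \<xi>"
  shows "in_block u \<beta> c \<longleftrightarrow> in_block u' \<beta> c"
  using height_cong[of \<beta> u u'] assms by (simp add: in_block_def)

section \<open>Charts along the branches\<close>

type_synonym block_point = "w1 \<times> (w1 \<Rightarrow> int) \<times> real \<times> real"

text \<open>
  The prefix of length \<open>\<beta>\<close>, padded with zeros to have one representative.
\<close>

definition below :: "w1 \<Rightarrow> (w1 \<Rightarrow> int) \<Rightarrow> w1 \<Rightarrow> int" where
  "below \<beta> u = (\<lambda>\<xi>. if \<xi> < \<beta> then u \<xi> else 0)"

lemma below_eq_iff: "below \<beta> u = below \<beta> u' \<longleftrightarrow> (\<forall>\<xi><\<beta>. u \<xi> = u' \<xi>)"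
  by (auto simp: below_def fun_eq_iff)

text \<open>
  A point is represented by the node below it and by plane coordinates in the block of this node: the
  fraction \<open>z\<close> of the block that has been passed, and a lateral coordinate. Within a block the strip
  with label \<open>k\<close> is the sheared strip around the line of slope \<open>4 k\<close>.
\<close>

definition block_chart :: "w1 \<times> (w1 \<Rightarrow> int) \<Rightarrow> real \<times> real \<Rightarrow> block_point" where
  "block_chart v = (\<lambda>(c, \<sigma>).
     let \<beta> = block v c; k = snd v \<beta>; z = (c - height (snd v) \<beta>) / weight \<beta> k
     in (\<beta>, below \<beta> (snd v), z, 4 * of_int k * max 0 z + \<sigma>))"

definition strip :: "w1 \<times> (w1 \<Rightarrow> int) \<Rightarrow> (real \<times> real) set" where
  "strip v = {..<height (snd v) (fst v)} \<times> {-1<..<1}"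

lemma strip_iff [simp]: "(c, \<sigma>) \<in> strip (\<alpha>, u) \<longleftrightarrow> c < height u \<alpha> \<and> -1 < \<sigma> \<and> \<sigma> < 1"
  by (auto simp: strip_def)

lemma block_chart_eq:
  assumes "(\<alpha>, u) \<in> branches" "\<beta> < \<alpha>" "in_block u \<beta> c"
  shows "block_chart (\<alpha>, u) (c, \<sigma>) =
    (\<beta>, below \<beta> u, (c - height u \<beta>) / weight \<beta> (u \<beta>),
     4 * of_int (u \<beta>) * max 0 ((c - height u \<beta>) / weight \<beta> (u \<beta>)) + \<sigma>)"
  using block_eqI[OF assms] by (simp add: block_chart_def Let_def)

lemma block_chartE:
  assumes "(\<alpha>, u) \<in> branches" "c < height u \<alpha>"
  obtains \<beta> where "\<beta> < \<alpha>" "in_block u \<beta> c" "\<And>\<sigma>. block_chart (\<alpha>, u) (c, \<sigma>) =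
    (\<beta>, below \<beta> u, (c - height u \<beta>) / weight \<beta> (u \<beta>),
     4 * of_int (u \<beta>) * max 0 ((c - height u \<beta>) / weight \<beta> (u \<beta>)) + \<sigma>)"
  using block[OF assms] block_chart_eq[OF assms(1)] that by blast

text \<open>
  Up to the end of the block at \<open>\<beta>\<close>, the heights of the nodes and the slopes are determined by the labels
  up to \<open>\<beta>\<close>.
\<close>

lemma block_chart_agree:
  assumes v: "(\<alpha>, u) \<in> branches" and w: "(\<alpha>', u') \<in> branches"
    and \<beta>: "\<beta> < \<alpha>" "\<beta> < \<alpha>'" and agree: "\<And>\<xi>. \<xi> \<le> \<beta> \<Longrightarrow> u \<xi> = u' \<xi>"
    and c: "c < height u \<beta> + weight \<beta> (u \<beta>)"
  shows "block_chart (\<alpha>, u) (c, \<sigma>) = block_chart (\<alpha>', u') (c, \<sigma>)"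
proof -
  have "c < height u \<alpha>" using c height_step[OF v \<beta>(1)] by fastforce
  then obtain \<gamma> where \<gamma>: "\<gamma> < \<alpha>" "in_block u \<gamma> c" using in_block_exists[OF v] by blast
  have "\<gamma> \<le> \<beta>"
  proof (rule ccontr)
    assume "\<not> \<gamma> \<le> \<beta>"
    then have "\<beta> < \<gamma>" by simp
    then have "height u \<gamma> \<le> c" using \<gamma>(2) by (auto simp: in_block_def)
    then show False using height_step[OF v \<open>\<beta> < \<gamma>\<close>] \<gamma>(1) c by fastforce
  qed
  then have eq: "u \<xi> = u' \<xi>" if "\<xi> \<le> \<gamma>" for \<xi> using that agree by simp
  have "in_block u' \<gamma> c" using \<gamma>(2) in_block_cong[of \<gamma> u u'] eq by simp
  moreover have "\<gamma> < \<alpha>'" using \<open>\<gamma> \<le> \<beta>\<close> \<beta>(2) by simp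
  moreover have "below \<gamma> u = below \<gamma> u'" "height u \<gamma> = height u' \<gamma>" "u \<gamma> = u' \<gamma>"
    using eq height_cong[of \<gamma> u u'] by (auto simp: below_eq_iff)
  ultimately show ?thesis
    using block_chart_eq[OF v \<gamma>] block_chart_eq[OF w, of \<gamma>] by simp
qed

text \<open>
  Either the two branches agree up to the point, and then the coordinates are equal; or the point lies
  in the block where the branches fork. As strips have width \<open>2\<close> and the slopes differ by at least
  \<open>4\<close>, this is possible in the lower half of the block only.
\<close>

lemma block_chart_overlapE:
  assumes v: "(\<alpha>, u) \<in> branches" and w: "(\<alpha>', u') \<in> branches"
    and p: "(c, \<sigma>) \<in> strip (\<alpha>, u)" and q: "(c', \<sigma>') \<in> strip (\<alpha>', u')"
    and eq: "block_chart (\<alpha>, u) (c, \<sigma>) = block_chart (\<alpha>', u') (c', \<sigma>')"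
  obtains (same) \<beta> where "\<beta> < \<alpha>" "\<beta> < \<alpha>'" "\<And>\<xi>. \<xi> \<le> \<beta> \<Longrightarrow> u \<xi> = u' \<xi>"
      "in_block u \<beta> c" "c' = c" "\<sigma>' = \<sigma>"
  | (fork) \<beta> z where "\<beta> < \<alpha>" "\<beta> < \<alpha>'" "\<And>\<xi>. \<xi> < \<beta> \<Longrightarrow> u \<xi> = u' \<xi>" "u \<beta> \<noteq> u' \<beta>"
      "in_block u \<beta> c" "in_block u' \<beta> c'" "height u' \<beta> = height u \<beta>" "z < 1/2"
      "c = height u \<beta> + weight \<beta> (u \<beta>) * z" "c' = height u \<beta> + weight \<beta> (u' \<beta>) * z"
      "\<sigma>' = \<sigma> + 4 * of_int (u \<beta> - u' \<beta>) * max 0 z"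
proof -
  obtain \<beta> where \<beta>: "\<beta> < \<alpha>" "in_block u \<beta> c" and 1: "block_chart (\<alpha>, u) (c, \<sigma>) =
      (\<beta>, below \<beta> u, (c - height u \<beta>) / weight \<beta> (u \<beta>),
       4 * of_int (u \<beta>) * max 0 ((c - height u \<beta>) / weight \<beta> (u \<beta>)) + \<sigma>)"
    using block_chartE[OF v, of c] p by auto
  obtain \<gamma> where \<gamma>: "\<gamma> < \<alpha>'" "in_block u' \<gamma> c'" and 2: "block_chart (\<alpha>', u') (c', \<sigma>') =
      (\<gamma>, below \<gamma> u', (c' - height u' \<gamma>) / weight \<gamma> (u' \<gamma>),
       4 * of_int (u' \<gamma>) * max 0 ((c' - height u' \<gamma>) / weight \<gamma> (u' \<gamma>)) + \<sigma>')"
    using block_chartE[OF w, of c'] q by auto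
  define z where "z = (c - height u \<beta>) / weight \<beta> (u \<beta>)"
  have "\<gamma> = \<beta>" using eq 1 2 by simp
  have agree: "u \<xi> = u' \<xi>" if "\<xi> < \<beta>" for \<xi>
    using eq 1 2 that by (auto simp: below_eq_iff)
  then have h: "height u' \<beta> = height u \<beta>" using height_cong[of \<beta> u u'] by simp
  have z': "(c' - height u \<beta>) / weight \<beta> (u' \<beta>) = z"
    and Y: "4 * of_int (u \<beta>) * max 0 z + \<sigma> = 4 * of_int (u' \<beta>) * max 0 z + \<sigma>'"
    using eq 1 2 h \<open>\<gamma> = \<beta>\<close> by (auto simp: z_def)
  have c: "c = height u \<beta> + weight \<beta> (u \<beta>) * z"
    using less_imp_neq[OF weight_pos[of \<beta> "u \<beta>"]] by (simp add: z_def)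
  have c': "c' = height u \<beta> + weight \<beta> (u' \<beta>) * z"
    using less_imp_neq[OF weight_pos[of \<beta> "u' \<beta>"]] by (simp add: z'[symmetric])
  show ?thesis
  proof (cases "u \<beta> = u' \<beta>")
    case True
    then have "c' = c" "\<sigma>' = \<sigma>" using c c' Y by auto
    moreover have "u \<xi> = u' \<xi>" if "\<xi> \<le> \<beta>" for \<xi> using that agree True by (cases "\<xi> = \<beta>") auto
    ultimately show ?thesis using same \<beta> \<gamma> \<open>\<gamma> = \<beta>\<close> by blast
  next
    case False
    have \<sigma>': "\<sigma>' = \<sigma> + 4 * of_int (u \<beta> - u' \<beta>) * max 0 z" using Y by (simp add: algebra_simps)
    have "1 \<le> \<bar>real_of_int (u \<beta> - u' \<beta>)\<bar>" using False by linarith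
    then have "4 * max 0 z \<le> \<bar>real_of_int (u \<beta> - u' \<beta>)\<bar> * (4 * max 0 z)"
      by (intro mult_le_cancel_right1[THEN iffD2]) auto
    also have "\<dots> = \<bar>\<sigma>' - \<sigma>\<bar>" by (simp add: \<sigma>' abs_mult del: of_int_diff)
    also have "\<dots> < 2" using p q by auto
    finally have "z < 1/2" by auto
    then show ?thesis using fork[OF \<beta>(1) _ agree False \<beta>(2)] \<gamma> \<open>\<gamma> = \<beta>\<close> h c c' \<sigma>' by blast
  qed
qed

lemma bottom_level_less_iff: "bottom_level < \<beta> \<longleftrightarrow> \<beta> \<noteq> bottom_level"
  by (metis bottom_level_le order_le_less not_less_bottom_level)

text \<open>
  If the branches agree on their common length, the change of charts is the identity. Otherwise let
  \<open>h\<close> be the height of the fork: up to \<open>h\<close> it is the identity, and beyond \<open>h\<close> it rescales the height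
  and shears the strip. The formula is continuous on the whole plane; beyond the overlap it leaves the
  strip and identifies nothing.
\<close>

lemma block_chart_transition:
  assumes v: "v \<in> branches" and w: "w \<in> branches"
  shows "\<exists>\<theta>. continuous_on UNIV \<theta> \<and>
    (\<forall>p\<in>strip v. \<forall>q\<in>strip w. block_chart v p = block_chart w q \<longleftrightarrow> q = \<theta> p)"
proof -
  obtain \<alpha> u \<alpha>' u' where vw: "v = (\<alpha>, u)" "w = (\<alpha>', u')" by fastforce
  note v = v[unfolded vw] and w = w[unfolded vw]
  show ?thesis
  proof (cases "\<exists>\<xi>. \<xi> < \<alpha> \<and> \<xi> < \<alpha>' \<and> u \<xi> \<noteq> u' \<xi>")
    case False
    have "block_chart v p = block_chart w q \<longleftrightarrow> q = p" if p: "p \<in> strip v" and q: "q \<in> strip w" for p q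
    proof
      obtain c \<sigma> c' \<sigma>' where cs: "p = (c, \<sigma>)" "q = (c', \<sigma>')" by fastforce
      assume "block_chart v p = block_chart w q"
      then show "q = p"
        using p q unfolding vw cs by (elim block_chart_overlapE[OF v w, rotated 2]) (use False in auto)
    next
      obtain c \<sigma> where cs: "p = (c, \<sigma>)" by fastforce
      assume qp: "q = p"
      obtain \<beta> where "\<beta> < \<alpha>" "\<beta> < \<alpha>'" "in_block u \<beta> c \<or> in_block u' \<beta> c"
      proof (cases "\<alpha> \<le> \<alpha>'")
        case True
        obtain \<beta> where "\<beta> < \<alpha>" "in_block u \<beta> c"
          using in_block_exists[OF v, of c] p unfolding vw cs by auto
        moreover from this True have "\<beta> < \<alpha>'" by simp
        ultimately show ?thesis using that by blast
      next
        case False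
        then obtain \<beta> where "\<beta> < \<alpha>'" "in_block u' \<beta> c"
          using in_block_exists[OF w, of c] q unfolding vw cs qp by auto
        moreover from this False have "\<beta> < \<alpha>" by simp
        ultimately show ?thesis using that by blast
      qed
      moreover from this have eq: "u \<xi> = u' \<xi>" if "\<xi> \<le> \<beta>" for \<xi>
        using False that by (meson le_less_trans)
      ultimately have "in_block u \<beta> c" using in_block_cong[of \<beta> u u'] by blast
      then show "block_chart v p = block_chart w q"
        unfolding vw cs qp
        using block_chart_agree[OF v w \<open>\<beta> < \<alpha>\<close> \<open>\<beta> < \<alpha>'\<close> eq] by (simp add: in_block_def)
    qed
    then show ?thesis by (intro exI[of _ "\<lambda>p. p"]) auto
  next
    case True
    define \<delta> where "\<delta> = (LEAST \<xi>. \<xi> < \<alpha> \<and> \<xi> < \<alpha>' \<and> u \<xi> \<noteq> u' \<xi>)"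
    have \<delta>: "\<delta> < \<alpha>" "\<delta> < \<alpha>'" "u \<delta> \<noteq> u' \<delta>"
      using LeastI_ex[OF True] by (auto simp: \<delta>_def)
    have agree: "u \<xi> = u' \<xi>" if "\<xi> < \<delta>" for \<xi>
      using not_less_Least[OF that[unfolded \<delta>_def]] that \<delta> by (auto dest: less_trans)
    define h where "h = height u \<delta>"
    define a where "a = weight \<delta> (u \<delta>)"
    define b where "b = weight \<delta> (u' \<delta>)"
    define d where "d = real_of_int (u \<delta> - u' \<delta>)"
    have h': "height u' \<delta> = h" using height_cong[of \<delta> u u'] agree by (simp add: h_def)
    have ab: "0 < a" "0 < b" by (simp_all add: a_def b_def)
    define \<theta> where "\<theta> = (\<lambda>p. (min (fst p) h + b / a * max 0 (fst p - h), snd p + 4 * d / a * max 0 (fst p - h)))"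
    have "continuous_on UNIV \<theta>"
      unfolding \<theta>_def by (intro continuous_intros) (use ab in auto)
    moreover have "block_chart v p = block_chart w q \<longleftrightarrow> q = \<theta> p" if p: "p \<in> strip v" and q: "q \<in> strip w" for p q
    proof -
      obtain c \<sigma> c' \<sigma>' where cs: "p = (c, \<sigma>)" "q = (c', \<sigma>')" by fastforce
      note p = p[unfolded vw cs] and q = q[unfolded vw cs]
      show ?thesis
      proof
        assume "block_chart v p = block_chart w q"
        then have eq: "block_chart (\<alpha>, u) (c, \<sigma>) = block_chart (\<alpha>', u') (c', \<sigma>')" by (simp add: vw cs)
        from v w p q eq show "q = \<theta> p"
        proof (cases rule: block_chart_overlapE)
          case (same \<beta>)
          then have "\<beta> < \<delta>" using \<delta>(3) by (meson not_le)
          then have "c < h"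
            using height_step[OF v \<open>\<beta> < \<delta>\<close> less_imp_le[OF \<delta>(1)]] same(4) by (auto simp: in_block_def h_def)
          then show ?thesis using same by (simp add: \<theta>_def cs)
        next
          case (fork \<beta> z)
          have "\<beta> = \<delta>"
            using fork(3,4) agree \<delta>(3) by (metis linorder_neqE)
          have cz: "c = h + a * z" "c' = h + b * z" "\<sigma>' = \<sigma> + 4 * d * max 0 z"
            using fork \<open>\<beta> = \<delta>\<close> by (simp_all add: h_def a_def b_def d_def)
          \<comment> \<open>Only the bottom block contains points with \<open>z < 0\<close>; there both weights are \<open>1\<close>.\<close>
          show ?thesis
          proof (cases "0 \<le> z")
            case True
            then show ?thesis
              using ab by (simp add: \<theta>_def cs cz)
          next
            case False
            then have "c < h" using fork ab \<open>\<beta> = \<delta>\<close> by (auto simp: h_def a_def mult_pos_neg)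
            then have "\<delta> = bottom_level" using fork(5) \<open>\<beta> = \<delta>\<close> by (auto simp: in_block_def h_def)
            then have "c' = c" "\<sigma>' = \<sigma>" using fork \<open>\<beta> = \<delta>\<close> False by auto
            then show ?thesis using \<open>c < h\<close> by (simp add: \<theta>_def cs)
          qed
        qed
      next
        assume q\<theta>: "q = \<theta> p"
        show "block_chart v p = block_chart w q"
        proof (cases "c < h")
          case True
          then have cs': "c' = c" "\<sigma>' = \<sigma>" using q\<theta> by (auto simp: \<theta>_def cs)
          show ?thesis
          proof (cases "\<delta> = bottom_level")
            case b: True
            then have "in_block u bottom_level c" "in_block u' bottom_level c" "c < 0"
              using True by (auto simp: in_block_def h_def)
            moreover have "below bottom_level u = below bottom_level u'" by (simp add: below_eq_iff)
            ultimately show ?thesis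
              using block_chart_eq[OF v, of bottom_level] block_chart_eq[OF w, of bottom_level] \<delta> b by (simp add: vw cs cs')
          next
            case False
            then have "bottom_level < \<delta>" by (simp add: bottom_level_less_iff)
            then obtain \<beta> where \<beta>: "\<beta> < \<delta>" "in_block u \<beta> c"
              using in_block_exists[OF branch_prefix[OF v _ less_imp_le[OF \<delta>(1)]], of c] True by (auto simp: h_def)
            then show ?thesis
              unfolding vw cs cs' using \<delta> agree
              by (intro block_chart_agree[OF v w, of \<beta>]) (auto simp: in_block_def)
          qed
        next
          case False
          define z where "z = (c - h) / a"
          have z0: "0 \<le> z" using False ab by (simp add: z_def)
          have c: "c = h + a * z" using ab by (simp add: z_def)
          have c': "c' = h + b * z" and \<sigma>': "\<sigma>' = \<sigma> + 4 * d * z"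
            using q\<theta> False ab by (auto simp: \<theta>_def cs z_def)
          have "1 \<le> \<bar>d\<bar>" using \<delta>(3) unfolding d_def by linarith
          then have "4 * z \<le> \<bar>d\<bar> * (4 * z)"
            using z0 mult_right_mono[of 1 "\<bar>d\<bar>" "4 * z"] by simp
          also have "\<dots> = \<bar>\<sigma>' - \<sigma>\<bar>" using z0 by (simp add: \<sigma>' abs_mult)
          also have "\<dots> < 2" using p q by auto
          finally have z1: "z < 1" by simp
          have "in_block u \<delta> c"
            using z0 z1 ab c by (simp add: in_block_def h_def[symmetric] a_def[symmetric])
          moreover have "in_block u' \<delta> c'"
            using z0 z1 ab c' by (simp add: in_block_def h' b_def[symmetric])
          moreover have "below \<delta> u = below \<delta> u'" using agree by (simp add: below_eq_iff)
          ultimately show ?thesis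
            using block_chart_eq[OF v \<delta>(1)] block_chart_eq[OF w \<delta>(2)] z0 ab c c' \<sigma>'
            by (simp add: vw cs h_def[symmetric] h' a_def[symmetric] b_def[symmetric])
              (simp add: d_def algebra_simps)
        qed
      qed
    qed
    ultimately show ?thesis by blast
  qed
qed

section \<open>The surface\<close>

definition block_points :: "block_point set" where
  "block_points = (\<Union>v\<in>branches. block_chart v ` strip v)"

text \<open>
  A function that agrees with \<open>coherent_family \<beta>\<close> up to a finite set is determined by its values on this
  finite set.
\<close>

lemma countable_prefixes: "countable {below \<beta> u | u. eq_mod_finite \<beta> (coherent_family \<beta>) u}"
proof -
  let ?N = "{below \<beta> u | u. eq_mod_finite \<beta> (coherent_family \<beta>) u}"
  let ?g = "\<lambda>f. {(\<xi>, f \<xi>) | \<xi>. \<xi> < \<beta> \<and> coherent_family \<beta> \<xi> \<noteq> f \<xi>}"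
  have "countable {A. finite A \<and> A \<subseteq> {..<\<beta>} \<times> (UNIV :: int set)}"
    using countable_lessThan_w1 by (intro countable_Collect_finite_subset) auto
  moreover have "?g ` ?N \<subseteq> {A. finite A \<and> A \<subseteq> {..<\<beta>} \<times> UNIV}"
  proof safe
    fix u assume "eq_mod_finite \<beta> (coherent_family \<beta>) u"
    then have "finite ((\<lambda>\<xi>. (\<xi>, u \<xi>)) ` {\<xi>. \<xi> < \<beta> \<and> coherent_family \<beta> \<xi> \<noteq> u \<xi>})"
      by (simp add: eq_mod_finite_def)
    then show "finite (?g (below \<beta> u))"
      by (rule finite_subset[rotated]) (auto simp: below_def)
  qed auto
  ultimately have "countable (?g ` ?N)" by (rule countable_subset[rotated])
  moreover have "inj_on ?g ?N"
  proof (rule inj_onI)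
    fix f f' assume f: "f \<in> ?N" "f' \<in> ?N" and eq: "?g f = ?g f'"
    have "f \<xi> = f' \<xi>" for \<xi>
    proof (cases "\<xi> < \<beta>")
      case True
      then show ?thesis using eq by (auto simp: set_eq_iff) (metis)
    next
      case False
      then show ?thesis using f by (auto simp: below_def)
    qed
    then show "f = f'" by auto
  qed
  ultimately show ?thesis by (rule countable_image_inj_on)
qed

lemma block_point_prefix:
  assumes "(\<beta>, f, r) \<in> block_points"
  shows "f \<in> {below \<beta> u | u. eq_mod_finite \<beta> (coherent_family \<beta>) u}"
proof -
  obtain \<alpha> u c \<sigma> where v: "(\<alpha>, u) \<in> branches" "c < height u \<alpha>" and p: "(\<beta>, f, r) = block_chart (\<alpha>, u) (c, \<sigma>)"
    using assms by (auto simp: block_points_def strip_def)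
  obtain \<gamma> where "\<gamma> < \<alpha>" "\<gamma> = \<beta>" "f = below \<beta> u"
    using block_chartE[OF v] p by (metis prod.inject)
  moreover have "eq_mod_finite \<beta> (coherent_family \<beta>) u"
  proof (cases "\<beta> = bottom_level")
    case False
    then have "bottom_level < \<beta>" by (simp add: bottom_level_less_iff)
    then have "(\<beta>, u) \<in> branches"
      using branch_prefix[OF v(1)] calculation by simp
    then show ?thesis by (simp add: branches_def)
  qed (simp add: eq_mod_finite_def)
  ultimately show ?thesis by blast
qed

lemma block_points_lepoll_reals: "block_points \<lesssim> (UNIV :: real set)"
proof -
  have rr: "(UNIV :: real set) \<times> (UNIV :: real set) \<lesssim> (UNIV :: real set)"
    using card_of_ordLeq[THEN iffD2, OF ordIso_imp_ordLeq[OF card_of_Times_same_infinite[OF infinite_UNIV_char_0]]]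
    unfolding lepoll_def .
  have "(UNIV :: w1 set) \<lesssim> (UNIV :: nat set set)"
    unfolding lepoll_def by (intro exI[of _ Rep_w1]) (simp add: inj_on_def Rep_w1_inject)
  then have w1: "(UNIV :: w1 set) \<lesssim> (UNIV :: real set)"
    using nat_sets_eqpoll_reals lepoll_trans1 lepoll_trans eqpoll_imp_lepoll by blast
  obtain k :: "w1 \<Rightarrow> real" where k: "inj k" using w1 by (auto simp: lepoll_def)
  obtain m :: "real \<times> real \<Rightarrow> real" where m: "inj m" using rr by (auto simp: lepoll_def)
  let ?N = "\<lambda>\<beta>. {below \<beta> u | u. eq_mod_finite \<beta> (coherent_family \<beta>) u}"
  let ?f = "\<lambda>(\<beta>, f, z, y). m (m (k \<beta>, real (to_nat_on (?N \<beta>) f)), m (z, y))"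
  have "inj_on ?f block_points"
  proof (rule inj_onI)
    fix p q assume p: "p \<in> block_points" and q: "q \<in> block_points" and eq: "?f p = ?f q"
    obtain \<beta> f z y where P: "p = (\<beta>, f, z, y)" by (metis prod_cases4)
    obtain \<gamma> g z' y' where Q: "q = (\<gamma>, g, z', y')" by (metis prod_cases4)
    have 1: "k \<beta> = k \<gamma>" "to_nat_on (?N \<beta>) f = to_nat_on (?N \<gamma>) g" "z = z'" "y = y'"
      using eq unfolding P Q by (simp_all add: inj_eq[OF m])
    then have "\<beta> = \<gamma>" using k by (simp add: injD)
    moreover have "f = g"
    proof -
      have "f \<in> ?N \<beta>" "g \<in> ?N \<beta>"
        using block_point_prefix[OF p[unfolded P]] block_point_prefix[OF q[unfolded Q]] \<open>\<beta> = \<gamma>\<close>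
        by simp_all
      then show ?thesis
        using 1(2) to_nat_on_inj[OF countable_prefixes[of \<beta>]] \<open>\<beta> = \<gamma>\<close> by simp
    qed
    ultimately show "p = q" using 1 by (simp add: P Q)
  qed
  then show ?thesis unfolding lepoll_def by blast
qed

text \<open>
  The points are coded by real numbers: there are at most continuum many of them, as a node is given by
  a countable ordinal and one of countably many prefixes.
\<close>

definition code :: "block_point \<Rightarrow> real" where
  "code = (SOME f. inj_on f block_points)"

lemma inj_on_code: "inj_on code block_points"
  using someI_ex[of "\<lambda>f::block_point \<Rightarrow> real. inj_on f block_points"] block_points_lepoll_reals
  unfolding code_def lepoll_def by blast

definition chart :: "w1 \<times> (w1 \<Rightarrow> int) \<Rightarrow> real \<times> real \<Rightarrow> real" where
  "chart v p = code (block_chart v p)"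

lemma block_chart_mem: "v \<in> branches \<Longrightarrow> p \<in> strip v \<Longrightarrow> block_chart v p \<in> block_points"
  by (auto simp: block_points_def)

lemma chart_eq_iff:
  assumes "v \<in> branches" "w \<in> branches" "p \<in> strip v" "q \<in> strip w"
  shows "chart v p = chart w q \<longleftrightarrow> block_chart v p = block_chart w q"
  using assms inj_on_eq_iff[OF inj_on_code] block_chart_mem by (simp add: chart_def)

interpretation bush: gluing branches strip chart
proof
  show "open (strip v)" for v
    by (simp add: strip_def open_Times)
  show "\<exists>\<theta>. continuous_on UNIV \<theta> \<and> (\<forall>p\<in>strip v. \<forall>q\<in>strip w. chart v p = chart w q \<longleftrightarrow> q = \<theta> p)"
    if "v \<in> branches" "w \<in> branches" for v w
    using block_chart_transition[OF that] chart_eq_iff[OF that] by simp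
qed

abbreviation bush :: "real topology" where
  "bush \<equiv> bush.glued"

section \<open>Contractibility\<close>

text \<open>
  On each block, its lower half is collapsed to the bottom and its upper half is stretched over the
  whole block; nodes stay fixed. In the bottom block the part of negative height is collapsed, too.
\<close>

definition squeeze :: "w1 \<times> (w1 \<Rightarrow> int) \<Rightarrow> real \<Rightarrow> real" where
  "squeeze v c = (let \<beta> = block v c; h = height (snd v) \<beta> in h + max 0 (2 * (c - h) - weight \<beta> (snd v \<beta>)))"

lemma squeeze_eq:
  assumes "(\<alpha>, u) \<in> branches" "\<beta> < \<alpha>" "in_block u \<beta> c"
  shows "squeeze (\<alpha>, u) c = height u \<beta> + max 0 (2 * (c - height u \<beta>) - weight \<beta> (u \<beta>))"
  using block_eqI[OF assms] by (simp add: squeeze_def Let_def)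

lemma squeeze_in_block:
  assumes "(\<alpha>, u) \<in> branches" "\<beta> < \<alpha>" "in_block u \<beta> c"
  shows "height u \<beta> \<le> squeeze (\<alpha>, u) c" "squeeze (\<alpha>, u) c < height u \<beta> + weight \<beta> (u \<beta>)"
  using assms weight_pos[of \<beta> "u \<beta>"] by (auto simp: squeeze_eq in_block_def)

lemma squeeze_bounds:
  assumes v: "(\<alpha>, u) \<in> branches" and c: "c < height u \<alpha>"
  shows "0 \<le> squeeze (\<alpha>, u) c" "squeeze (\<alpha>, u) c < height u \<alpha>"
proof -
  obtain \<beta> where \<beta>: "\<beta> < \<alpha>" "in_block u \<beta> c" using in_block_exists[OF v c] by blast
  show "0 \<le> squeeze (\<alpha>, u) c"
    using squeeze_in_block(1)[OF v \<beta>] height_nonneg[of u \<beta>] by linarith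
  show "squeeze (\<alpha>, u) c < height u \<alpha>"
    using squeeze_in_block(2)[OF v \<beta>] height_step[OF v \<beta>(1) order_refl] by linarith
qed

text \<open>
  The bound holds on a single block and adds up over a chain of blocks because the ends of blocks are
  fixed. This gives continuity at limit levels, where infinitely many blocks accumulate.
\<close>

lemma squeeze_lipschitz:
  assumes v: "(\<alpha>, u) \<in> branches" and c: "c \<le> c'" "c' < height u \<alpha>"
  shows "squeeze (\<alpha>, u) c \<le> squeeze (\<alpha>, u) c'" "squeeze (\<alpha>, u) c' - squeeze (\<alpha>, u) c \<le> 2 * (c' - c)"
proof -
  obtain \<beta> where \<beta>: "\<beta> < \<alpha>" "in_block u \<beta> c" using in_block_exists[OF v, of c] c by auto
  obtain \<gamma> where \<gamma>: "\<gamma> < \<alpha>" "in_block u \<gamma> c'" using in_block_exists[OF v c(2)] by blast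
  have "squeeze (\<alpha>, u) c \<le> squeeze (\<alpha>, u) c' \<and> squeeze (\<alpha>, u) c' - squeeze (\<alpha>, u) c \<le> 2 * (c' - c)"
  proof (cases \<beta> \<gamma> rule: linorder_cases)
    case equal
    then show ?thesis using squeeze_eq[OF v \<beta>] squeeze_eq[OF v \<gamma>] c by auto
  next
    case greater
    then have "height u \<beta> \<le> c" using \<beta> by (auto simp: in_block_def)
    moreover have "c' < height u \<gamma> + weight \<gamma> (u \<gamma>)" using \<gamma> by (simp add: in_block_def)
    ultimately show ?thesis using height_step[OF v greater less_imp_le[OF \<beta>(1)]] c by linarith
  next
    case less
    have step: "height u \<beta> + weight \<beta> (u \<beta>) \<le> height u \<gamma>"
      using height_step[OF v less less_imp_le[OF \<gamma>(1)]] .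
    have "height u \<gamma> \<le> c'" "c' < height u \<gamma> + weight \<gamma> (u \<gamma>)" "c < height u \<beta> + weight \<beta> (u \<beta>)"
      using less \<beta> \<gamma> by (auto simp: in_block_def)
    then have up: "squeeze (\<alpha>, u) c' \<le> c'"
      unfolding squeeze_eq[OF v \<gamma>] by simp
    have "2 * c - (height u \<beta> + weight \<beta> (u \<beta>)) \<le> squeeze (\<alpha>, u) c"
      unfolding squeeze_eq[OF v \<beta>] by simp
    then have "squeeze (\<alpha>, u) c' - squeeze (\<alpha>, u) c \<le> c' - (2 * c - (height u \<beta> + weight \<beta> (u \<beta>)))"
      using up by (rule diff_mono[rotated])
    also have "\<dots> \<le> 2 * (c' - c)"
      using step \<open>height u \<gamma> \<le> c'\<close> by simp
    finally show ?thesis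
      using step squeeze_in_block(2)[OF v \<beta>] squeeze_in_block(1)[OF v \<gamma>] by simp
  qed
  then show "squeeze (\<alpha>, u) c \<le> squeeze (\<alpha>, u) c'" "squeeze (\<alpha>, u) c' - squeeze (\<alpha>, u) c \<le> 2 * (c' - c)"
    by blast+
qed

lemma continuous_on_squeeze:
  assumes v: "(\<alpha>, u) \<in> branches"
  shows "continuous_on {..<height u \<alpha>} (squeeze (\<alpha>, u))"
proof -
  have "dist (squeeze (\<alpha>, u) c) (squeeze (\<alpha>, u) c') \<le> 2 * dist c c'"
    if "c \<in> {..<height u \<alpha>}" "c' \<in> {..<height u \<alpha>}" for c c'
    using that squeeze_lipschitz[OF v, of c c'] squeeze_lipschitz[OF v, of c' c]
    by (cases "c \<le> c'") (auto simp: dist_real_def)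
  then have "2-lipschitz_on {..<height u \<alpha>} (squeeze (\<alpha>, u))"
    by (intro lipschitz_onI) auto
  then show ?thesis by (rule lipschitz_on_continuous_on)
qed

text \<open>
  The two stages of the contraction are compatible with the change of charts. At a fork, the common
  points lie in the lower half of the block. There the first stage is the homothety with factor \<open>1 - t\<close>
  centred at the node, which looks the same in both strips, whatever their slopes; and the second stage
  acts on points that have arrived at the node.
\<close>

lemma squeeze_overlap:
  assumes v: "(\<alpha>, u) \<in> branches" and w: "(\<alpha>', u') \<in> branches"
    and p: "(c, \<sigma>) \<in> strip (\<alpha>, u)" and q: "(c', \<sigma>') \<in> strip (\<alpha>', u')"
    and eq: "block_chart (\<alpha>, u) (c, \<sigma>) = block_chart (\<alpha>', u') (c', \<sigma>')"
    and t: "t \<in> {0..1}"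
  shows "block_chart (\<alpha>, u) ((1 - t) * c + t * squeeze (\<alpha>, u) c, (1 - t) * \<sigma>) =
         block_chart (\<alpha>', u') ((1 - t) * c' + t * squeeze (\<alpha>', u') c', (1 - t) * \<sigma>')" (is ?thesis1)
    and "block_chart (\<alpha>, u) ((1 - t) * squeeze (\<alpha>, u) c, 0) =
         block_chart (\<alpha>', u') ((1 - t) * squeeze (\<alpha>', u') c', 0)" (is ?thesis2)
proof -
  have t01: "0 \<le> t" "0 \<le> 1 - t" "1 - t \<le> 1" using t by auto
  from v w p q eq have "?thesis1 \<and> ?thesis2"
  proof (cases rule: block_chart_overlapE)
    case (same \<beta>)
    have h: "height u' \<beta> = height u \<beta>" using height_cong[of \<beta> u u'] same(3) by simp
    have blk': "in_block u' \<beta> c" using same(3,4) in_block_cong[of \<beta> u u'] by simp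
    have sq: "squeeze (\<alpha>', u') c = squeeze (\<alpha>, u) c"
      using squeeze_eq[OF v same(1,4)] squeeze_eq[OF w same(2) blk'] same(3)[of \<beta>] h by simp
    let ?s = "squeeze (\<alpha>, u) c" and ?top = "height u \<beta> + weight \<beta> (u \<beta>)"
    have s: "?s < ?top" using squeeze_in_block(2)[OF v same(1,4)] .
    have c: "c < ?top" using same(4) by (simp add: in_block_def)
    have "(1 - t) * c + t * ?s < ?top"
      using convex_bound_lt[OF c s t01(2,1)] by simp
    then have ?thesis1
      using block_chart_agree[OF v w same(1-3)] by (simp add: same(5,6) sq)
    moreover have "(1 - t) * ?s \<le> ?s"
      using t01 squeeze_bounds(1)[OF v, of c] p by (intro mult_left_le_one_le) auto
    then have "(1 - t) * ?s < ?top" using s by simp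
    then have ?thesis2
      using block_chart_agree[OF v w same(1-3)] by (simp add: same(5,6) sq)
    ultimately show ?thesis by simp
  next
    case (fork \<beta> z)
    let ?h = "height u \<beta>" and ?a = "weight \<beta> (u \<beta>)" and ?b = "weight \<beta> (u' \<beta>)"
    have pos: "0 < ?a" "0 < ?b" by simp_all
    have below: "below \<beta> u = below \<beta> u'" using fork(3) by (simp add: below_eq_iff)
    have "2 * (c - ?h) - ?a = ?a * (2 * z - 1)" "2 * (c' - ?h) - ?b = ?b * (2 * z - 1)"
      using fork by (simp_all add: algebra_simps)
    then have "2 * (c - ?h) - ?a \<le> 0" "2 * (c' - ?h) - ?b \<le> 0"
      using fork(8) pos by (simp_all add: mult_nonneg_nonpos)
    then have sq: "squeeze (\<alpha>, u) c = ?h" "squeeze (\<alpha>', u') c' = ?h"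
      using squeeze_eq[OF v fork(1,5)] squeeze_eq[OF w fork(2,6)] fork(7) by simp_all
    define z' where "z' = (1 - t) * z"
    have c1: "(1 - t) * c + t * squeeze (\<alpha>, u) c = ?h + ?a * z'"
      "(1 - t) * c' + t * squeeze (\<alpha>', u') c' = ?h + ?b * z'"
      unfolding sq z'_def by (subst fork(9), simp add: algebra_simps) (subst fork(10), simp add: algebra_simps)
    have z'1: "z' < 1"
    proof (cases "0 \<le> z")
      case True
      then have "z' \<le> z" unfolding z'_def using t01 by (intro mult_left_le_one_le) auto
      then show ?thesis using fork(8) by simp
    next
      case False
      then have "z' \<le> 0" unfolding z'_def using t01 by (simp add: mult_nonneg_nonpos)
      then show ?thesis by simp
    qed
    have z'0: "0 \<le> z'" if "\<beta> \<noteq> bottom_level"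
    proof -
      have "0 \<le> ?a * z" using fork(5,9) that by (auto simp: in_block_def)
      then show ?thesis using pos t01 by (simp add: zero_le_mult_iff z'_def)
    qed
    have blk: "in_block u \<beta> (?h + ?a * z')" "in_block u' \<beta> (?h + ?b * z')"
      using z'0 z'1 pos fork(7) by (cases "\<beta> = bottom_level"; simp add: in_block_def)+
    have max: "max 0 z' = (1 - t) * max 0 z"
      using t01 by (auto simp: z'_def max_def mult_le_0_iff zero_le_mult_iff)
    have Y: "4 * of_int (u \<beta>) * max 0 z' + (1 - t) * \<sigma> = 4 * of_int (u' \<beta>) * max 0 z' + (1 - t) * \<sigma>'"
      unfolding max fork(11) by (simp add: algebra_simps)
    have 1: ?thesis1
      unfolding c1 using block_chart_eq[OF v fork(1) blk(1)] block_chart_eq[OF w fork(2) blk(2)] below pos Y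
      by (simp add: fork(7))
    have 2: ?thesis2
    proof (cases "(1 - t) * ?h < ?h")
      case False
      have "(1 - t) * ?h \<le> ?h" using t01 by (intro mult_left_le_one_le) auto
      then have eq: "(1 - t) * ?h = ?h" using False by linarith
      have "in_block u \<beta> ?h" "in_block u' \<beta> ?h" using pos by (auto simp: in_block_def fork(7))
      then show ?thesis
        unfolding sq eq using block_chart_eq[OF v fork(1)] block_chart_eq[OF w fork(2)] below by (simp add: fork(7))
    next
      case True
      then have "\<beta> \<noteq> bottom_level" by auto
      then have "(\<beta>, u) \<in> branches"
        using branch_prefix[OF v _ less_imp_le[OF fork(1)]] by (simp add: bottom_level_less_iff)
      then obtain \<gamma> where \<gamma>: "\<gamma> < \<beta>" "in_block u \<gamma> ((1 - t) * ?h)"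
        using in_block_exists True by blast
      then show ?thesis
        unfolding sq using fork(1,2,3)
        by (intro block_chart_agree[OF v w, of \<gamma>]) (auto simp: in_block_def)
    qed
    show ?thesis using 1 2 by blast
  qed
  then show ?thesis1 ?thesis2 by blast+
qed

lemma branches_nonempty: "(second_level, coherent_family second_level) \<in> branches"
  using bottom_level_less_second_level by (simp add: branches_def eq_mod_finite_refl)

lemma chart_root:
  assumes "v \<in> branches" "w \<in> branches"
  shows "(0, 0) \<in> strip v" "chart v (0, 0) = chart w (0, 0)"
proof -
  have root: "(0, 0) \<in> strip (\<alpha>, u) \<and> block_chart (\<alpha>, u) (0, 0) = (bottom_level, \<lambda>_. 0, 0, 0)"
    if "(\<alpha>, u) \<in> branches" for \<alpha> u
  proof -
    have "bottom_level < \<alpha>" using that by (simp add: branches_def)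
    moreover have "0 < height u \<alpha>"
      using height_step[OF that \<open>bottom_level < \<alpha>\<close> order_refl] by simp
    ultimately show ?thesis
      using block_chart_eq[OF that, of bottom_level 0 0] by (simp add: in_block_def below_def)
  qed
  obtain \<alpha> u \<alpha>' u' where "v = (\<alpha>, u)" "w = (\<alpha>', u')" by fastforce
  then show "(0, 0) \<in> strip v" "chart v (0, 0) = chart w (0, 0)"
    using root assms by (simp_all add: chart_def)
qed

text \<open>
  The first homotopy takes \<open>(c, \<sigma>)\<close> to \<open>(squeeze c, 0)\<close>, the second one multiplies the heights
  \<open>squeeze c\<close> by \<open>1 - t\<close>, so all points meet at height \<open>0\<close> on the centre line of the bottom block.
\<close>

theorem contractible_bush: "contractible_space bush"
proof -
  let ?\<gamma>1 = "\<lambda>v (t, c, \<sigma>). ((1 - t) * c + t * squeeze v c, (1 - t) * \<sigma>)"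
  let ?\<gamma>2 = "\<lambda>v (t, c, \<sigma>::real). ((1 - t) * squeeze v c, 0)"
  have sq_cont: "continuous_on ({0..1::real} \<times> strip v) (\<lambda>x. squeeze v (fst (snd x)))" if "v \<in> branches" for v
  proof -
    obtain \<alpha> u where v: "v = (\<alpha>, u)" by force
    have "continuous_on {..<height u \<alpha>} (squeeze v)" using continuous_on_squeeze that v by simp
    then show ?thesis
      by (rule continuous_on_compose2) (auto simp: v strip_def intro!: continuous_intros)
  qed
  have into1: "?\<gamma>1 v (t, a) \<in> strip v" if "v \<in> branches" "t \<in> {0..1}" "a \<in> strip v" for v t a
  proof -
    obtain \<alpha> u where v: "v = (\<alpha>, u)" by force
    obtain c \<sigma> where a: "a = (c, \<sigma>)" by force
    have "(1 - t) * c + t * squeeze v c < height u \<alpha>"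
      using convex_bound_lt[of c "height u \<alpha>" "squeeze v c" "1 - t" t] squeeze_bounds(2)[of \<alpha> u c] that
      by (simp add: v a)
    moreover have "\<bar>(1 - t) * \<sigma>\<bar> \<le> 1 * \<bar>\<sigma>\<bar>"
      unfolding abs_mult using that by (intro mult_right_mono) auto
    ultimately show ?thesis using that by (auto simp: v a abs_if split: if_splits)
  qed
  have into2: "?\<gamma>2 v (t, a) \<in> strip v" if "v \<in> branches" "t \<in> {0..1}" "a \<in> strip v" for v t a
  proof -
    obtain \<alpha> u where v: "v = (\<alpha>, u)" by force
    obtain c \<sigma> where a: "a = (c, \<sigma>)" by force
    have "(1 - t) * squeeze v c \<le> squeeze v c"
      using squeeze_bounds(1)[of \<alpha> u c] that by (intro mult_left_le_one_le) (auto simp: v a)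
    then show ?thesis using squeeze_bounds(2)[of \<alpha> u c] that by (simp add: v a)
  qed
  obtain h1 where h1: "continuous_map (prod_topology (top_of_set {0..1}) bush) bush h1"
    "\<And>v t a. \<lbrakk>v \<in> branches; t \<in> {0..1}; a \<in> strip v\<rbrakk> \<Longrightarrow> h1 (t, chart v a) = chart v (?\<gamma>1 v (t, a))"
  proof (rule bush.glued_homotopy[of ?\<gamma>1])
    show "continuous_on ({0..1} \<times> strip v) (?\<gamma>1 v)" if "v \<in> branches" for v
      unfolding case_prod_unfold using sq_cont[OF that] by (intro continuous_intros)
    show "chart v (?\<gamma>1 v (t, a)) = chart w (?\<gamma>1 w (t, b))"
      if "v \<in> branches" "w \<in> branches" "t \<in> {0..1}" "a \<in> strip v" "b \<in> strip w" "chart v a = chart w b" for v w t a b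
    proof -
      obtain \<alpha> u \<alpha>' u' c \<sigma> c' \<sigma>' where "v = (\<alpha>, u)" "w = (\<alpha>', u')" "a = (c, \<sigma>)" "b = (c', \<sigma>')"
        by (metis surj_pair)
      then show ?thesis
        using squeeze_overlap(1)[of \<alpha> u \<alpha>' u' c \<sigma> c' \<sigma>' t] that chart_eq_iff[of v w a b] by (simp add: chart_def)
    qed
  qed (use into1 in auto)
  obtain h2 where h2: "continuous_map (prod_topology (top_of_set {0..1}) bush) bush h2"
    "\<And>v t a. \<lbrakk>v \<in> branches; t \<in> {0..1}; a \<in> strip v\<rbrakk> \<Longrightarrow> h2 (t, chart v a) = chart v (?\<gamma>2 v (t, a))"
  proof (rule bush.glued_homotopy[of ?\<gamma>2])
    show "continuous_on ({0..1} \<times> strip v) (?\<gamma>2 v)" if "v \<in> branches" for v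
      unfolding case_prod_unfold using sq_cont[OF that] by (intro continuous_intros)
    show "chart v (?\<gamma>2 v (t, a)) = chart w (?\<gamma>2 w (t, b))"
      if "v \<in> branches" "w \<in> branches" "t \<in> {0..1}" "a \<in> strip v" "b \<in> strip w" "chart v a = chart w b" for v w t a b
    proof -
      obtain \<alpha> u \<alpha>' u' c \<sigma> c' \<sigma>' where "v = (\<alpha>, u)" "w = (\<alpha>', u')" "a = (c, \<sigma>)" "b = (c', \<sigma>')"
        by (metis surj_pair)
      then show ?thesis
        using squeeze_overlap(2)[of \<alpha> u \<alpha>' u' c \<sigma> c' \<sigma>' t] that chart_eq_iff[of v w a b] by (simp add: chart_def)
    qed
  qed (use into2 in auto)
  let ?root = "chart (second_level, coherent_family second_level) (0, 0)"
  have 1: "homotopic_with (\<lambda>_. True) bush bush id (\<lambda>x. h1 (1, x))"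
  proof (rule homotopicI[OF h1(1)])
    fix x assume "x \<in> topspace bush"
    then obtain v a where v: "v \<in> branches" "a \<in> strip v" "x = chart v a" by (auto simp: bush.topspace_glued)
    then show "h1 (0, x) = id x" using h1(2)[of v 0 a] by (cases a) simp
  qed simp
  have 2: "homotopic_with (\<lambda>_. True) bush bush (\<lambda>x. h1 (1, x)) (\<lambda>_. ?root)"
  proof (rule homotopicI[OF h2(1)])
    fix x assume "x \<in> topspace bush"
    then obtain v a where v: "v \<in> branches" "a \<in> strip v" "x = chart v a" by (auto simp: bush.topspace_glued)
    then show "h2 (0, x) = h1 (1, x)" using h1(2)[of v 1 a] h2(2)[of v 0 a] by (cases a) simp
    show "h2 (1, x) = ?root"
      using v h2(2)[of v 1 a] chart_root(2)[OF _ branches_nonempty, of v] by (cases a) simp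
  qed
  show ?thesis
    unfolding contractible_space_def using homotopic_with_trans[OF 1 2] by blast
qed

theorem surface_bush: "surface bush"
  unfolding surface_def
proof (intro conjI ballI)
  show "connected_space bush"
    using contractible_bush by (rule contractible_imp_connected_space)
  show "Hausdorff_space bush" by (rule bush.Hausdorff_glued)
  fix x assume "x \<in> topspace bush"
  then obtain v a where v: "v \<in> branches" "a \<in> strip v" "x = chart v a" by (auto simp: bush.topspace_glued)
  obtain r where r: "0 < r" "ball a r \<subseteq> strip v"
    using bush.open_S[OF v(1)] v(2) openE by blast
  let ?U = "chart v ` ball a r"
  have U: "openin bush ?U" using bush.chart_open[OF v(1) open_ball r(2)] .
  have "top_of_set (ball a r) homeomorphic_space subtopology bush ?U"
    using bush.chart_homeomorphic[OF v(1) open_ball r(2)] .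
  moreover have "top_of_set (ball a r) homeomorphic_space (euclidean :: (real \<times> real) topology)"
  proof -
    obtain f g where "homeomorphism (ball a r) (UNIV :: (real \<times> real) set) f g"
      using homeomorphic_ball_UNIV[OF r(1), of a] unfolding homeomorphic_def by blast
    then have "homeomorphic_maps (top_of_set (ball a r)) euclidean f g"
      by (auto simp: homeomorphism_def homeomorphic_maps_def continuous_map_in_subtopology)
    then show ?thesis by (auto simp: homeomorphic_space_def)
  qed
  ultimately have "subtopology bush ?U homeomorphic_space (euclidean :: (real \<times> real) topology)"
    using homeomorphic_space_sym homeomorphic_space_trans by blast
  moreover have "x \<in> ?U" using v(3) r(1) by simp
  ultimately show "\<exists>U N. openin bush U \<and> x \<in> U \<and> U \<subseteq> N \<and> N \<subseteq> topspace bush \<and>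
      subtopology bush N homeomorphic_space (euclidean :: (real \<times> real) topology)"
    using U openin_subset[OF U] by blast
qed

section \<open>Type I\<close>

definition decode :: "real \<Rightarrow> block_point" where
  "decode = inv_into block_points code"

definition level :: "real \<Rightarrow> w1" where
  "level x = fst (decode x)"

definition node :: "real \<Rightarrow> w1 \<Rightarrow> int" where
  "node x = fst (snd (decode x))"

lemma decode_chart: "v \<in> branches \<Longrightarrow> p \<in> strip v \<Longrightarrow> decode (chart v p) = block_chart v p"
  using inv_into_f_f[OF inj_on_code block_chart_mem] by (simp add: decode_def chart_def)

lemma chart_in_bush: "v \<in> branches \<Longrightarrow> p \<in> strip v \<Longrightarrow> chart v p \<in> topspace bush"
  by (auto simp: bush.topspace_glued)

lemma level_chart:
  assumes "(\<alpha>, u) \<in> branches" "(c, \<sigma>) \<in> strip (\<alpha>, u)" "\<beta> < \<alpha>" "in_block u \<beta> c"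
  shows "level (chart (\<alpha>, u) (c, \<sigma>)) = \<beta>" "node (chart (\<alpha>, u) (c, \<sigma>)) = below \<beta> u"
  using decode_chart[OF assms(1,2)] block_chart_eq[OF assms(1,3,4)] by (simp_all add: level_def node_def)

lemma bush_pointE:
  assumes "x \<in> topspace bush"
  obtains \<alpha> u \<beta> c \<sigma> where "(\<alpha>, u) \<in> branches" "(c, \<sigma>) \<in> strip (\<alpha>, u)" "x = chart (\<alpha>, u) (c, \<sigma>)"
    "\<beta> < \<alpha>" "in_block u \<beta> c" "level x = \<beta>" "node x = below \<beta> u"
proof -
  obtain v p where v: "v \<in> branches" "p \<in> strip v" "x = chart v p"
    using assms by (auto simp: bush.topspace_glued)
  obtain \<alpha> u c \<sigma> where vp: "v = (\<alpha>, u)" "p = (c, \<sigma>)" by fastforce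
  then obtain \<beta> where \<beta>: "\<beta> < \<alpha>" "in_block u \<beta> c" using v in_block_exists[of \<alpha> u c] by auto
  show thesis
    using that[OF _ _ _ \<beta>] v vp level_chart[OF _ _ \<beta>] by blast
qed

definition initial_part :: "w1 \<Rightarrow> real set" where
  "initial_part \<alpha> = {x \<in> topspace bush. level x < \<alpha>}"

lemma initial_part_mono: "\<alpha> \<le> \<beta> \<Longrightarrow> initial_part \<alpha> \<subseteq> initial_part \<beta>"
  by (auto simp: initial_part_def)

lemma chart_below:
  assumes "(\<alpha>, u) \<in> branches" "p \<in> strip (\<alpha>, u)"
  shows "(\<alpha>, below \<alpha> u) \<in> branches" "strip (\<alpha>, below \<alpha> u) = strip (\<alpha>, u)"
    "chart (\<alpha>, below \<alpha> u) p = chart (\<alpha>, u) p"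
proof -
  show br: "(\<alpha>, below \<alpha> u) \<in> branches"
    by (rule branch_cong[OF assms(1)]) (simp add: below_def)
  show "strip (\<alpha>, below \<alpha> u) = strip (\<alpha>, u)"
    using height_cong[of \<alpha> "below \<alpha> u" u] by (simp add: strip_def below_def)
  obtain c \<sigma> where p: "p = (c, \<sigma>)" by force
  obtain \<beta> where \<beta>: "\<beta> < \<alpha>" "in_block u \<beta> c" using in_block_exists[OF assms(1), of c] assms(2) p by auto
  have "block_chart (\<alpha>, u) (c, \<sigma>) = block_chart (\<alpha>, below \<alpha> u) (c, \<sigma>)"
    using \<beta> by (intro block_chart_agree[OF assms(1) br, of \<beta>]) (auto simp: below_def in_block_def)
  then show "chart (\<alpha>, below \<alpha> u) p = chart (\<alpha>, u) p" by (simp add: chart_def p)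
qed

text \<open>
  Every branch through a point of lower level extends or restricts to one of length \<open>\<alpha>\<close>, so the charts of
  the countably many branches of length \<open>\<alpha>\<close> suffice.
\<close>

lemma initial_part_eq:
  "initial_part \<alpha> = (\<Union>f\<in>{below \<alpha> u | u. (\<alpha>, u) \<in> branches}. chart (\<alpha>, f) ` strip (\<alpha>, f))"
proof (intro equalityI subsetI)
  fix x assume x: "x \<in> initial_part \<alpha>"
  then obtain \<alpha>' u \<beta> c \<sigma> where v: "(\<alpha>', u) \<in> branches" and p: "(c, \<sigma>) \<in> strip (\<alpha>', u)"
    and xc: "x = chart (\<alpha>', u) (c, \<sigma>)" and \<beta>: "\<beta> < \<alpha>'" "in_block u \<beta> c" "level x = \<beta>"
    by (auto simp: initial_part_def elim: bush_pointE)
  have "\<beta> < \<alpha>" using x \<beta>(3) by (simp add: initial_part_def)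
  obtain u' where u': "(\<alpha>, u') \<in> branches" "\<And>\<xi>. \<xi> \<le> \<beta> \<Longrightarrow> u \<xi> = u' \<xi>"
  proof (cases "\<alpha> \<le> \<alpha>'")
    case True
    moreover have "bottom_level < \<alpha>" using \<open>\<beta> < \<alpha>\<close> le_less_trans[OF bottom_level_le] by blast
    ultimately show ?thesis using that[of u] branch_prefix[OF v] by blast
  next
    case False
    then have "\<alpha>' \<le> \<alpha>" by simp
    with v obtain u' where u': "(\<alpha>, u') \<in> branches" "\<And>\<xi>. \<xi> < \<alpha>' \<Longrightarrow> u' \<xi> = u \<xi>"
      by (rule branch_extend) blast
    show ?thesis
    proof (rule that[OF u'(1)])
      show "u \<xi> = u' \<xi>" if "\<xi> \<le> \<beta>" for \<xi>
        using u'(2)[OF le_less_trans[OF that \<beta>(1)]] by simp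
    qed
  qed
  have c: "c < height u \<beta> + weight \<beta> (u \<beta>)" using \<beta>(2) by (simp add: in_block_def)
  also have "\<dots> = height u' \<beta> + weight \<beta> (u' \<beta>)" using u'(2) height_cong[of \<beta> u u'] by simp
  also have "\<dots> \<le> height u' \<alpha>" using height_step[OF u'(1) \<open>\<beta> < \<alpha>\<close> order_refl] .
  finally have strip': "(c, \<sigma>) \<in> strip (\<alpha>, u')" using p by simp
  have "x = chart (\<alpha>, u') (c, \<sigma>)"
    using block_chart_agree[OF v u'(1) \<beta>(1) \<open>\<beta> < \<alpha>\<close> u'(2) c] by (simp add: xc chart_def)
  also have "\<dots> = chart (\<alpha>, below \<alpha> u') (c, \<sigma>)" using chart_below(3)[OF u'(1) strip'] by simp
  finally show "x \<in> (\<Union>f\<in>{below \<alpha> u | u. (\<alpha>, u) \<in> branches}. chart (\<alpha>, f) ` strip (\<alpha>, f))"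
    using u'(1) strip' chart_below(2)[OF u'(1) strip'] by blast
next
  fix x assume "x \<in> (\<Union>f\<in>{below \<alpha> u | u. (\<alpha>, u) \<in> branches}. chart (\<alpha>, f) ` strip (\<alpha>, f))"
  then obtain f c \<sigma> where f: "(\<alpha>, f) \<in> branches" "(c, \<sigma>) \<in> strip (\<alpha>, f)" "x = chart (\<alpha>, f) (c, \<sigma>)"
    using branch_cong[of \<alpha> _ "below \<alpha> _"] by (fastforce simp: below_def)
  then obtain \<beta> where "\<beta> < \<alpha>" "in_block f \<beta> c" using in_block_exists[OF f(1), of c] by auto
  then show "x \<in> initial_part \<alpha>"
    using f(3) level_chart(1)[OF f(1,2)] chart_in_bush[OF f(1,2)] by (simp add: initial_part_def)
qed

lemma prefix_branch: "f \<in> {below \<alpha> u | u. (\<alpha>, u) \<in> branches} \<Longrightarrow> (\<alpha>, f) \<in> branches"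
  by (auto intro: branch_cong simp: below_def)

lemma openin_initial_part: "openin bush (initial_part \<alpha>)"
  unfolding initial_part_eq
  by (intro openin_Union) (auto intro!: bush.chart_open bush.open_S prefix_branch)

lemma Lindelof_chart:
  assumes v: "v \<in> branches"
  shows "Lindelof_space (subtopology bush (chart v ` strip v))"
proof (rule Lindelof_space_continuous_map_image)
  show "Lindelof_space (top_of_set (strip v))"
    unfolding Lindelof_space_def
  proof (intro allI impI, elim conjE)
    fix \<U> assume "\<forall>U\<in>\<U>. openin (top_of_set (strip v)) U" and cover: "\<Union>\<U> = topspace (top_of_set (strip v))"
    then have "open U" if "U \<in> \<U>" for U
      using that bush.open_S[OF v] by (auto simp: openin_open_eq)
    then obtain \<V> where "\<V> \<subseteq> \<U>" "countable \<V>" "\<Union>\<V> = \<Union>\<U>" by (rule Lindelof)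
    then show "\<exists>\<V>. countable \<V> \<and> \<V> \<subseteq> \<U> \<and> \<Union>\<V> = topspace (top_of_set (strip v))"
      using cover by auto
  qed
  have "chart v ` strip v \<subseteq> topspace bush" using v by (auto simp: bush.topspace_glued)
  then show "chart v ` topspace (top_of_set (strip v)) = topspace (subtopology bush (chart v ` strip v))"
    by auto
  show "continuous_map (top_of_set (strip v)) (subtopology bush (chart v ` strip v)) (chart v)"
    using bush.chart_cover_glued v by (auto simp: chart_cover_def continuous_map_in_subtopology)
qed

lemma Lindelof_initial_part: "Lindelof_space (subtopology bush (initial_part \<alpha>))"
  unfolding initial_part_eq
proof (rule Lindelof_space_Union)
  have "{below \<alpha> u | u. (\<alpha>, u) \<in> branches} \<subseteq> {below \<alpha> u | u. eq_mod_finite \<alpha> (coherent_family \<alpha>) u}"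
    by (auto simp: branches_def)
  then have "countable {below \<alpha> u | u. (\<alpha>, u) \<in> branches}"
    using countable_prefixes countable_subset by blast
  then show "countable ((\<lambda>f. chart (\<alpha>, f) ` strip (\<alpha>, f)) ` {below \<alpha> u | u. (\<alpha>, u) \<in> branches})"
    by (rule countable_image)
qed (auto intro!: Lindelof_chart prefix_branch)

text \<open>
  Points of a strip that are higher than the node of level \<open>\<alpha>\<close> have a neighbourhood in this strip that
  avoids all levels below \<open>\<alpha>\<close>.
\<close>

lemma closure_initial_part:
  assumes x: "x \<in> bush closure_of initial_part \<alpha>"
    and v: "(\<alpha>', u) \<in> branches" "(c, \<sigma>) \<in> strip (\<alpha>', u)" "x = chart (\<alpha>', u) (c, \<sigma>)"
    and \<beta>: "\<beta> < \<alpha>'" "in_block u \<beta> c"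
  shows "\<beta> < \<alpha> \<or> \<beta> = \<alpha> \<and> c = height u \<alpha>"
proof (rule ccontr)
  assume contr: "\<not> (\<beta> < \<alpha> \<or> \<beta> = \<alpha> \<and> c = height u \<alpha>)"
  have "\<alpha> \<noteq> bottom_level"
  proof
    assume "\<alpha> = bottom_level"
    then have "initial_part \<alpha> = {}" by (simp add: initial_part_def)
    then show False using x by simp
  qed
  then have "\<beta> \<noteq> bottom_level" using contr by (auto simp flip: bottom_level_less_iff)
  then have "height u \<beta> \<le> c" using \<beta> by (simp add: in_block_def)
  have "height u \<alpha> < c"
  proof (cases "\<beta> = \<alpha>")
    case False
    then have "\<alpha> < \<beta>" using contr by (metis linorder_neqE)
    then show ?thesis
      using height_step[OF v(1) \<open>\<alpha> < \<beta>\<close> less_imp_le[OF \<beta>(1)]] weight_pos[of \<alpha> "u \<alpha>"] \<open>height u \<beta> \<le> c\<close>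
      by linarith
  qed (use contr \<open>height u \<beta> \<le> c\<close> in auto)
  have "\<alpha> \<le> \<beta>" using contr by (simp add: not_less)
  then have "\<alpha> < \<alpha>'" using \<beta>(1) by (rule le_less_trans)
  let ?O = "strip (\<alpha>', u) \<inter> {height u \<alpha><..} \<times> UNIV"
  have O: "openin bush (chart (\<alpha>', u) ` ?O)"
    using bush.open_S[OF v(1)]
    by (intro bush.chart_open[OF v(1)] open_Int open_Times Int_lower1) simp_all
  have "x \<in> chart (\<alpha>', u) ` ?O"
    unfolding v(3) using v(2) \<open>height u \<alpha> < c\<close> by (intro imageI) simp
  then have "\<exists>y. y \<in> initial_part \<alpha> \<and> y \<in> chart (\<alpha>', u) ` ?O"
    using x O by (simp only: in_closure_of)
  then obtain y where y: "y \<in> initial_part \<alpha>" "y \<in> chart (\<alpha>', u) ` ?O" by blast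
  then obtain c' \<sigma>' where c': "(c', \<sigma>') \<in> strip (\<alpha>', u)" "height u \<alpha> < c'" "y = chart (\<alpha>', u) (c', \<sigma>')" by auto
  obtain \<gamma> where \<gamma>: "\<gamma> < \<alpha>'" "in_block u \<gamma> c'" using in_block_exists[OF v(1), of c'] c'(1) by auto
  have "\<gamma> < \<alpha>" using level_chart(1)[OF v(1) c'(1) \<gamma>] y(1) c'(3) by (simp add: initial_part_def)
  then show False
    using height_step[OF v(1) \<open>\<gamma> < \<alpha>\<close> less_imp_le[OF \<open>\<alpha> < \<alpha>'\<close>]] \<gamma>(2) c'(2) by (simp add: in_block_def)
qed

lemma closure_initial_part_subset:
  assumes "\<alpha> < \<beta>"
  shows "bush closure_of initial_part \<alpha> \<subseteq> initial_part \<beta>"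
proof
  fix x assume x: "x \<in> bush closure_of initial_part \<alpha>"
  then have top: "x \<in> topspace bush" by (simp add: in_closure_of)
  then obtain \<alpha>' u \<gamma> c \<sigma> where "(\<alpha>', u) \<in> branches" "(c, \<sigma>) \<in> strip (\<alpha>', u)" "x = chart (\<alpha>', u) (c, \<sigma>)"
    "\<gamma> < \<alpha>'" "in_block u \<gamma> c" "level x = \<gamma>"
    by (rule bush_pointE) blast
  then have "level x \<le> \<alpha>"
    using closure_initial_part[OF x] by force
  then show "x \<in> initial_part \<beta>"
    using top le_less_trans[OF _ assms] by (simp add: initial_part_def)
qed

lemma Lindelof_closure_initial_part: "Lindelof_space (subtopology bush (bush closure_of initial_part \<alpha>))"
proof -
  obtain \<beta> where \<beta>: "\<alpha> < \<beta>" using greater_w1 by blast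
  let ?C = "bush closure_of initial_part \<alpha>" and ?B = "subtopology bush (initial_part \<beta>)"
  have sub: "?C \<subseteq> initial_part \<beta>" using closure_initial_part_subset[OF \<beta>] .
  then have "closedin ?B ?C"
    using closedin_subtopology_Int_closed[of bush ?C "initial_part \<beta>"] by (simp add: Int_absorb1 Int_commute)
  then have "Lindelof_space (subtopology ?B ?C)"
    by (rule Lindelof_space_closedin_subtopology[OF Lindelof_initial_part])
  then show ?thesis using sub by (simp add: subtopology_subtopology Int_absorb1)
qed

text \<open>
  The initial parts form an increasing open cover indexed by \<open>\<omega>\<^sub>1\<close>, and countably many indices are
  bounded.
\<close>

lemma Lindelof_imp_bounded:
  assumes C: "C \<subseteq> topspace bush" and L: "Lindelof_space (subtopology bush C)"
  shows "\<exists>\<alpha>. C \<subseteq> initial_part \<alpha>"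
proof -
  let ?\<U> = "range (\<lambda>\<alpha>. C \<inter> initial_part \<alpha>)"
  have "\<exists>\<V>. countable \<V> \<and> \<V> \<subseteq> ?\<U> \<and> \<Union>\<V> = topspace (subtopology bush C)"
  proof (rule Lindelof_spaceD[OF L])
    show "openin (subtopology bush C) U" if "U \<in> ?\<U>" for U
      using that openin_initial_part by (auto intro: openin_subtopology_Int2)
    have "x \<in> \<Union>?\<U>" if "x \<in> C" for x
      using that C greater_w1[of "level x"] by (auto simp: initial_part_def)
    then show "\<Union>?\<U> = topspace (subtopology bush C)" using C by auto
  qed
  then obtain \<V> where \<V>: "countable \<V>" "\<V> \<subseteq> ?\<U>" "\<Union>\<V> = C" using C by (auto simp: Int_absorb1)
  then have "\<forall>V\<in>\<V>. \<exists>\<alpha>. V = C \<inter> initial_part \<alpha>" by blast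
  then obtain f where f: "\<And>V. V \<in> \<V> \<Longrightarrow> V = C \<inter> initial_part (f V)" by metis
  obtain \<alpha> where \<alpha>: "\<forall>a\<in>f ` \<V>. a < \<alpha>"
    using countable_imp_bounded_w1[of "f ` \<V>"] \<V>(1) by blast
  have "V \<subseteq> initial_part \<alpha>" if "V \<in> \<V>" for V
  proof -
    have "f V \<le> \<alpha>" using \<alpha> that by (simp add: less_imp_le)
    then show ?thesis using f[OF that] initial_part_mono by blast
  qed
  then show ?thesis using \<V>(3) by blast
qed

text \<open>
  The centre of the bottom edge of the block at the node of level \<open>\<alpha>\<close> serves as a sample point on
  this level.
\<close>

lemma edge_point:
  assumes v: "(\<alpha>', u) \<in> branches" and \<alpha>: "\<alpha> < \<alpha>'"
  shows "(height u \<alpha>, 0) \<in> strip (\<alpha>', u)" "in_block u \<alpha> (height u \<alpha>)"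
    "level (chart (\<alpha>', u) (height u \<alpha>, 0)) = \<alpha>" "node (chart (\<alpha>', u) (height u \<alpha>, 0)) = below \<alpha> u"
    "chart (\<alpha>', u) (height u \<alpha>, 0) \<in> topspace bush"
proof -
  show s: "(height u \<alpha>, 0) \<in> strip (\<alpha>', u)"
    using height_step[OF v \<alpha> order_refl] weight_pos[of \<alpha> "u \<alpha>"] by (simp del: weight_pos)
  show b: "in_block u \<alpha> (height u \<alpha>)" by (simp add: in_block_def)
  show "level (chart (\<alpha>', u) (height u \<alpha>, 0)) = \<alpha>" "node (chart (\<alpha>', u) (height u \<alpha>, 0)) = below \<alpha> u"
    using level_chart[OF v s \<alpha> b] by auto
  show "chart (\<alpha>', u) (height u \<alpha>, 0) \<in> topspace bush"
    using chart_in_bush[OF v s] .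
qed

theorem type_I_bush: "type_I bush"
  unfolding type_I_def
proof
  show "\<not> Lindelof_space bush"
  proof
    assume "Lindelof_space bush"
    then obtain \<alpha> where \<alpha>: "topspace bush \<subseteq> initial_part \<alpha>"
      using Lindelof_imp_bounded[of "topspace bush"] by auto
    obtain \<beta> where "\<alpha> < \<beta>" using greater_w1 by blast
    then have br: "(\<beta>, coherent_family \<beta>) \<in> branches"
      using le_less_trans[OF bottom_level_le] by (simp add: branches_def eq_mod_finite_refl)
    show False
      using edge_point(3,5)[OF br \<open>\<alpha> < \<beta>\<close>] \<alpha> by (auto simp: initial_part_def)
  qed
  let ?W = "\<lambda>a. initial_part (Abs_w1 a)"
  have "topspace bush = (\<Union>a\<in>Field omega1. ?W a)"
  proof
    show "topspace bush \<subseteq> (\<Union>a\<in>Field omega1. ?W a)"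
    proof
      fix x assume "x \<in> topspace bush"
      obtain \<beta> where "level x < \<beta>" using greater_w1 by blast
      then have "x \<in> ?W (Rep_w1 \<beta>)"
        using \<open>x \<in> topspace bush\<close> by (simp add: initial_part_def Rep_w1_inverse)
      then show "x \<in> (\<Union>a\<in>Field omega1. ?W a)" using Rep_w1 by blast
    qed
  qed (auto simp: initial_part_def)
  moreover have "bush closure_of ?W a \<subseteq> ?W b" if "(a, b) \<in> omega1" "a \<noteq> b" for a b
  proof (rule closure_initial_part_subset)
    have "a \<in> Field omega1" "b \<in> Field omega1" using that(1) by (auto simp: Field_def)
    then show "Abs_w1 a < Abs_w1 b"
      using that by (simp add: less_w1_def Abs_w1_inverse Abs_w1_inject)
  qed
  ultimately show "\<exists>W. topspace bush = (\<Union>\<alpha>\<in>Field omega1. W \<alpha>) \<and>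
      (\<forall>\<alpha>\<in>Field omega1. openin bush (W \<alpha>) \<and> Lindelof_space (subtopology bush (bush closure_of W \<alpha>))) \<and>
      (\<forall>\<alpha> \<beta>. (\<alpha>, \<beta>) \<in> omega1 \<and> \<alpha> \<noteq> \<beta> \<longrightarrow> bush closure_of W \<alpha> \<subseteq> W \<beta>)"
    using openin_initial_part Lindelof_closure_initial_part by (intro exI[of _ ?W]) simp
qed

section \<open>Shears\<close>

text \<open>
  The label of the second level is shifted by an amount that depends on the label below it. A shift by a
  constant amount would give only countably many maps.
\<close>

definition shear :: "(int \<Rightarrow> int) \<Rightarrow> (w1 \<Rightarrow> int) \<Rightarrow> w1 \<Rightarrow> int" where
  "shear f u = u(second_level := u second_level + f (u bottom_level))"

lemma shear_other [simp]: "\<xi> \<noteq> second_level \<Longrightarrow> shear f u \<xi> = u \<xi>"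
  by (simp add: shear_def)

lemma shear_second_level: "shear f u second_level = u second_level + f (u bottom_level)"
  by (simp add: shear_def)

lemma bottom_level_neq_second_level [simp]: "bottom_level \<noteq> second_level" "second_level \<noteq> bottom_level"
  using bottom_level_less_second_level by auto

lemma shear_inverse: "shear (\<lambda>k. - f k) (shear f u) = u"
  by (simp add: shear_def fun_eq_iff)

lemma shear_branch: "(\<alpha>, u) \<in> branches \<Longrightarrow> (\<alpha>, shear f u) \<in> branches"
  by (simp add: shear_def branch_update)

lemma weight_shear: "weight \<xi> (shear f u \<xi>) = weight \<xi> (u \<xi>)"
  by (cases "\<xi> = second_level") (simp_all add: weight_def)

lemma height_shear [simp]: "height (shear f u) \<beta> = height u \<beta>"
  by (simp add: height_def weight_shear)

lemma in_block_shear [simp]: "in_block (shear f u) \<beta> c \<longleftrightarrow> in_block u \<beta> c"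
  by (simp add: in_block_def weight_shear)

lemma strip_shear [simp]: "strip (\<alpha>, shear f u) = strip (\<alpha>, u)"
  by (simp add: strip_def)

lemma shear_agree:
  assumes "\<And>\<xi>. \<xi> < \<beta> \<Longrightarrow> u \<xi> = u' \<xi>"
  shows "\<And>\<xi>. \<xi> < \<beta> \<Longrightarrow> shear f u \<xi> = shear f u' \<xi>"
    and "shear f u \<beta> - shear f u' \<beta> = u \<beta> - u' \<beta>"
proof -
  show "shear f u \<xi> = shear f u' \<xi>" if "\<xi> < \<beta>" for \<xi>
    using assms[OF that] assms[of bottom_level] bottom_level_less_second_level that
    by (cases "\<xi> = second_level") (auto simp: shear_second_level dest: less_trans)
  show "shear f u \<beta> - shear f u' \<beta> = u \<beta> - u' \<beta>"
    using assms[of bottom_level] bottom_level_less_second_level by (cases "\<beta> = second_level") (auto simp: shear_second_level)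
qed

text \<open>
  At a fork, both labels change by the same amount, since the labels before the fork agree; so the
  relative slope of the two strips stays the same.
\<close>

lemma shear_compatible:
  assumes v: "(\<alpha>, u) \<in> branches" and w: "(\<alpha>', u') \<in> branches"
    and p: "(c, \<sigma>) \<in> strip (\<alpha>, u)" and q: "(c', \<sigma>') \<in> strip (\<alpha>', u')"
    and eq: "chart (\<alpha>, u) (c, \<sigma>) = chart (\<alpha>', u') (c', \<sigma>')"
  shows "chart (\<alpha>, shear f u) (c, \<sigma>) = chart (\<alpha>', shear f u') (c', \<sigma>')"
proof -
  have eq': "block_chart (\<alpha>, u) (c, \<sigma>) = block_chart (\<alpha>', u') (c', \<sigma>')"
    using eq chart_eq_iff[OF v w p q] by simp
  note v' = shear_branch[OF v, of f] and w' = shear_branch[OF w, of f]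
  from v w p q eq' show ?thesis
  proof (cases rule: block_chart_overlapE)
    case (same \<beta>)
    have "shear f u \<xi> = shear f u' \<xi>" if "\<xi> \<le> \<beta>" for \<xi>
    proof (cases "\<xi> = second_level")
      case True
      then have "bottom_level \<le> \<beta>" "second_level \<le> \<beta>" using that by auto
      then show ?thesis using same(3) by (simp add: shear_second_level True)
    qed (use that same(3) in simp)
    then show ?thesis
      using block_chart_agree[OF v' w' same(1,2)] same(4) in_block_shear[of f u \<beta> c]
      unfolding chart_def same(5,6) in_block_def by simp
  next
    case (fork \<beta> z)
    have below: "below \<beta> (shear f u) = below \<beta> (shear f u')"
      using shear_agree(1)[of \<beta> u u' _ f] fork(3) by (simp add: below_eq_iff)
    have k: "shear f u \<beta> - shear f u' \<beta> = u \<beta> - u' \<beta>"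
      using shear_agree(2)[of \<beta> u u' f] fork(3) by simp
    have z: "(c - height u \<beta>) / weight \<beta> (u \<beta>) = z" "(c' - height u \<beta>) / weight \<beta> (u' \<beta>) = z"
      using less_imp_neq[OF weight_pos[of \<beta> "u \<beta>"]] less_imp_neq[OF weight_pos[of \<beta> "u' \<beta>"]]
      unfolding fork(9,10) by auto
    have "4 * of_int (shear f u \<beta>) * max 0 z + \<sigma> = 4 * of_int (shear f u' \<beta>) * max 0 z + \<sigma>'"
      unfolding fork(11) k[symmetric] by (simp add: algebra_simps)
    moreover have "in_block (shear f u) \<beta> c" "in_block (shear f u') \<beta> c'" using fork(5,6) by simp_all
    ultimately show ?thesis
      unfolding chart_def
      by (simp only: block_chart_eq[OF v' fork(1)] block_chart_eq[OF w' fork(2)]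
          weight_shear height_shear fork(7) z below)
  qed
qed

definition bush_shear :: "(int \<Rightarrow> int) \<Rightarrow> real \<Rightarrow> real" where
  "bush_shear f x = (let (v, p) = (SOME (v, p). v \<in> branches \<and> p \<in> strip v \<and> x = chart v p)
     in chart (fst v, shear f (snd v)) p)"

lemma bush_shear_chart:
  assumes "(\<alpha>, u) \<in> branches" "p \<in> strip (\<alpha>, u)"
  shows "bush_shear f (chart (\<alpha>, u) p) = chart (\<alpha>, shear f u) p"
proof -
  let ?P = "\<lambda>(v, q). v \<in> branches \<and> q \<in> strip v \<and> chart (\<alpha>, u) p = chart v q"
  define y where "y = (SOME y. ?P y)"
  obtain \<alpha>' u' c' \<sigma>' where y: "y = ((\<alpha>', u'), (c', \<sigma>'))" by (metis surj_pair)
  obtain c \<sigma> where p: "p = (c, \<sigma>)" by force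
  have "?P ((\<alpha>, u), p)" using assms by blast
  then have P: "?P y" unfolding y_def by (rule someI)
  have "bush_shear f (chart (\<alpha>, u) p) = chart (\<alpha>', shear f u') (c', \<sigma>')"
    unfolding bush_shear_def y_def[symmetric] by (simp add: y)
  also have "\<dots> = chart (\<alpha>, shear f u) p"
    using shear_compatible[of \<alpha> u \<alpha>' u' c \<sigma> c' \<sigma>' f] P assms unfolding y p by simp
  finally show ?thesis .
qed

lemma homeomorphic_map_bush_shear: "homeomorphic_map bush bush (bush_shear f)"
proof -
  have cont: "continuous_map bush bush (bush_shear g)" for g
  proof (rule continuous_map_from_charts[OF bush.chart_cover_glued])
    fix v assume v: "v \<in> branches"
    obtain \<alpha> u where au: "v = (\<alpha>, u)" by force
    have "continuous_map (top_of_set (strip v)) bush (chart (\<alpha>, shear g u))"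
      using bush.chart_cover_glued shear_branch[of \<alpha> u g] v strip_shear[of \<alpha> g u]
      unfolding chart_cover_def au by metis
    then show "continuous_map (top_of_set (strip v)) bush (\<lambda>a. bush_shear g (chart v a))"
      by (rule continuous_map_eq) (use v bush_shear_chart au in auto)
  qed
  have inv: "bush_shear (\<lambda>k. - g k) (bush_shear g x) = x" if "x \<in> topspace bush" for g x
    using that
  proof (rule bush_pointE)
    fix \<alpha> u \<beta> c \<sigma>
    assume v: "(\<alpha>, u) \<in> branches" "(c, \<sigma>) \<in> strip (\<alpha>, u)" "x = chart (\<alpha>, u) (c, \<sigma>)"
    then show ?thesis
      using bush_shear_chart[OF v(1,2), of g] bush_shear_chart[OF shear_branch[OF v(1), of g], of "(c, \<sigma>)" "\<lambda>k. - g k"]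
      by (simp add: shear_inverse)
  qed
  have "homeomorphic_maps bush bush (bush_shear f) (bush_shear (\<lambda>k. - f k))"
    unfolding homeomorphic_maps_def using cont inv[of _ f] inv[of _ "\<lambda>k. - f k"] by simp
  then show ?thesis by (rule homeomorphic_maps_map[THEN iffD1, THEN conjunct1])
qed

section \<open>Isotopies preserve a boundary\<close>

definition frontier_part :: "w1 \<Rightarrow> real set" where
  "frontier_part \<alpha> = bush closure_of initial_part \<alpha> - initial_part \<alpha>"

text \<open>
  Images of Lindelof sets are Lindelof, hence bounded; the inverse map gives the second inclusion.
\<close>

lemma homeomorphic_image_bounded:
  assumes f: "homeomorphic_map bush bush f"
  shows "\<exists>\<gamma>. f ` initial_part \<beta> \<subseteq> initial_part \<gamma> \<and> initial_part \<beta> \<subseteq> f ` initial_part \<gamma>"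
proof -
  have bounded: "\<exists>\<gamma>. g ` initial_part \<beta> \<subseteq> initial_part \<gamma>" if g: "continuous_map bush bush g" for g
  proof (rule Lindelof_imp_bounded)
    show sub: "g ` initial_part \<beta> \<subseteq> topspace bush"
      using continuous_map_image_subset_topspace[OF g] by (auto simp: initial_part_def)
    show "Lindelof_space (subtopology bush (g ` initial_part \<beta>))"
    proof (rule Lindelof_space_continuous_map_image[OF Lindelof_initial_part[of \<beta>]])
      show "continuous_map (subtopology bush (initial_part \<beta>)) (subtopology bush (g ` initial_part \<beta>)) g"
        using continuous_map_from_subtopology[OF g] by (auto simp: continuous_map_in_subtopology)
      show "g ` topspace (subtopology bush (initial_part \<beta>)) = topspace (subtopology bush (g ` initial_part \<beta>))"
        using sub openin_subset[OF openin_initial_part[of \<beta>]]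
        by (simp add: Int_absorb1)
    qed
  qed
  obtain g where g: "homeomorphic_maps bush bush f g" using f by (auto simp: homeomorphic_map_maps)
  then have cont: "continuous_map bush bush f" "continuous_map bush bush g"
    and fg: "\<And>x. x \<in> topspace bush \<Longrightarrow> f (g x) = x"
    by (auto simp: homeomorphic_maps_def)
  obtain \<gamma> where \<gamma>: "f ` initial_part \<beta> \<subseteq> initial_part \<gamma>" using bounded[OF cont(1)] by blast
  obtain \<delta> where \<delta>: "g ` initial_part \<beta> \<subseteq> initial_part \<delta>" using bounded[OF cont(2)] by blast
  let ?m = "max \<gamma> \<delta>"
  have "initial_part \<gamma> \<subseteq> initial_part ?m" "initial_part \<delta> \<subseteq> initial_part ?m"
    by (simp_all add: initial_part_mono)
  moreover have "initial_part \<beta> \<subseteq> f ` initial_part \<delta>"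
  proof
    fix x assume x: "x \<in> initial_part \<beta>"
    then have "x = f (g x)" using fg by (simp add: initial_part_def)
    then show "x \<in> f ` initial_part \<delta>" using \<delta> x by blast
  qed
  ultimately show ?thesis using \<gamma> by (meson image_mono subset_trans)
qed

text \<open>
  A closing-off argument: each initial part is mapped into a larger one and covered by the image of a
  larger one; for countably many homeomorphisms one larger part serves them all, and the union of an
  increasing sequence obtained in this way is invariant.
\<close>

lemma countable_family_invariant_part:
  assumes D: "countable D" and homeo: "\<And>t. t \<in> D \<Longrightarrow> homeomorphic_map bush bush (H t)"
  shows "\<exists>\<alpha>>second_level. \<forall>t\<in>D. H t ` initial_part \<alpha> = initial_part \<alpha>"
proof -
  have "\<exists>\<gamma>>\<beta>. \<forall>t\<in>D. H t ` initial_part \<beta> \<subseteq> initial_part \<gamma> \<and> initial_part \<beta> \<subseteq> H t ` initial_part \<gamma>" for \<beta>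
  proof -
    have "\<forall>t\<in>D. \<exists>\<gamma>. H t ` initial_part \<beta> \<subseteq> initial_part \<gamma> \<and> initial_part \<beta> \<subseteq> H t ` initial_part \<gamma>"
      by (intro ballI homeomorphic_image_bounded homeo)
    then obtain g where g: "\<forall>t\<in>D. H t ` initial_part \<beta> \<subseteq> initial_part (g t) \<and> initial_part \<beta> \<subseteq> H t ` initial_part (g t)"
      by (rule bchoice[THEN exE])
    obtain \<gamma> where \<gamma>: "\<forall>a\<in>insert \<beta> (g ` D). a < \<gamma>"
      using countable_imp_bounded_w1[of "insert \<beta> (g ` D)"] D by auto
    have "initial_part (g t) \<subseteq> initial_part \<gamma>" if "t \<in> D" for t
      using \<gamma> that by (intro initial_part_mono) (auto intro: less_imp_le)
    then show ?thesis using g \<gamma> by (intro exI[of _ \<gamma>]) (meson image_mono insertI1 subset_trans)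
  qed
  then have "\<forall>\<beta>. \<exists>\<gamma>. \<beta> < \<gamma> \<and> (\<forall>t\<in>D. H t ` initial_part \<beta> \<subseteq> initial_part \<gamma> \<and> initial_part \<beta> \<subseteq> H t ` initial_part \<gamma>)"
    by blast
  then obtain s where "\<forall>\<beta>. \<beta> < s \<beta> \<and> (\<forall>t\<in>D. H t ` initial_part \<beta> \<subseteq> initial_part (s \<beta>) \<and> initial_part \<beta> \<subseteq> H t ` initial_part (s \<beta>))"
    by (rule choice[THEN exE])
  then have s: "\<And>\<beta>. \<beta> < s \<beta>"
    "\<And>\<beta> t. t \<in> D \<Longrightarrow> H t ` initial_part \<beta> \<subseteq> initial_part (s \<beta>)"
    "\<And>\<beta> t. t \<in> D \<Longrightarrow> initial_part \<beta> \<subseteq> H t ` initial_part (s \<beta>)"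
    by blast+
  define b where "b = (\<lambda>n. (s ^^ n) second_level)"
  have b_Suc: "b (Suc n) = s (b n)" for n by (simp add: b_def)
  define \<alpha> where "\<alpha> = (LEAST a. \<forall>n. b n < a)"
  have "\<exists>a. \<forall>n. b n < a" using countable_imp_bounded_w1[of "range b"] by auto
  then have upper: "b n < \<alpha>" for n unfolding \<alpha>_def by (rule LeastI2_ex) blast
  have cofinal: "\<exists>n. \<beta> < b n" if less: "\<beta> < \<alpha>" for \<beta>
  proof -
    obtain n where "\<not> b n < \<beta>" using not_less_Least[OF less[unfolded \<alpha>_def]] by blast
    then have "\<beta> < b (Suc n)" using s(1)[of "b n"] by (simp add: b_Suc)
    then show ?thesis by blast
  qed
  have \<alpha>: "initial_part \<alpha> = (\<Union>n. initial_part (b n))"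
  proof
    show "initial_part \<alpha> \<subseteq> (\<Union>n. initial_part (b n))"
      using cofinal by (auto simp: initial_part_def)
    show "(\<Union>n. initial_part (b n)) \<subseteq> initial_part \<alpha>"
      using upper initial_part_mono[OF less_imp_le] by blast
  qed
  have "H t ` initial_part \<alpha> = initial_part \<alpha>" if t: "t \<in> D" for t
  proof
    have "H t ` initial_part (b n) \<subseteq> initial_part (b (Suc n))" for n
      using s(2)[OF t] by (simp add: b_Suc)
    then show "H t ` initial_part \<alpha> \<subseteq> initial_part \<alpha>" unfolding \<alpha> by blast
    have "initial_part (b n) \<subseteq> H t ` initial_part (b (Suc n))" for n
      using s(3)[OF t] by (simp add: b_Suc)
    then show "initial_part \<alpha> \<subseteq> H t ` initial_part \<alpha>" unfolding \<alpha> by blast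
  qed
  moreover have "second_level < \<alpha>" using upper[of 0] by (simp add: b_def)
  ultimately show ?thesis by blast
qed

text \<open>
  The preceding lemma applies to the stages with parameter in a countable dense set of times. A
  homeomorphism that preserves an initial part preserves its frontier, and the frontier is closed, so
  the remaining stages map it into itself by continuity in \<open>t\<close>.
\<close>

lemma isotopy_invariant_frontier:
  assumes h: "continuous_map (prod_topology (top_of_set {0..1::real}) bush) bush h"
    and homeo: "\<And>t. t \<in> {0..1} \<Longrightarrow> homeomorphic_map bush bush (\<lambda>x. h (t, x))"
  shows "\<exists>\<alpha>>second_level. \<forall>t\<in>{0..1}. \<forall>p\<in>frontier_part \<alpha>. h (t, p) \<in> frontier_part \<alpha>"
proof -
  obtain D :: "real set" where D: "countable D" "D \<subseteq> {0..1}" "{0..1} \<subseteq> closure D"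
    using separable[of "{0..1::real}"] by blast
  have "\<exists>\<alpha>>second_level. \<forall>t\<in>D. (\<lambda>x. h (t, x)) ` initial_part \<alpha> = initial_part \<alpha>"
    using D(2) homeo by (intro countable_family_invariant_part[OF D(1)]) blast
  then obtain \<alpha> where \<alpha>: "second_level < \<alpha>" "\<And>t. t \<in> D \<Longrightarrow> (\<lambda>x. h (t, x)) ` initial_part \<alpha> = initial_part \<alpha>"
    by blast
  have sub: "initial_part \<alpha> \<subseteq> topspace bush" by (auto simp: initial_part_def)
  have clo: "closedin bush (frontier_part \<alpha>)"
    unfolding frontier_part_def by (intro closedin_diff openin_initial_part closedin_closure_of)
  then have sub': "frontier_part \<alpha> \<subseteq> topspace bush" by (rule closedin_subset)
  have dense: "h (t, p) \<in> frontier_part \<alpha>" if t: "t \<in> D" and p: "p \<in> frontier_part \<alpha>" for t p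
  proof -
    let ?f = "\<lambda>x. h (t, x)"
    have f: "homeomorphic_map bush bush ?f" using homeo t D(2) by blast
    have "?f ` (bush closure_of initial_part \<alpha>) = bush closure_of initial_part \<alpha>"
      using homeomorphic_map_closure_of[OF f sub] \<alpha>(2)[OF t] by simp
    then have "?f p \<in> bush closure_of initial_part \<alpha>" using p unfolding frontier_part_def by blast
    moreover have "?f p \<notin> initial_part \<alpha>"
    proof
      assume "?f p \<in> initial_part \<alpha>"
      then obtain y where y: "y \<in> initial_part \<alpha>" "?f p = ?f y" using \<alpha>(2)[OF t] by (metis (mono_tags, lifting) imageE)
      then have "p = y"
        using homeomorphic_imp_injective_map[OF f] p sub sub' by (auto dest: inj_onD)
      then show False using p y(1) by (simp add: frontier_part_def)
    qed
    ultimately show ?thesis by (simp add: frontier_part_def)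
  qed
  have "h (t, p) \<in> frontier_part \<alpha>" if t: "t \<in> {0..1}" and p: "p \<in> frontier_part \<alpha>" for t p
  proof -
    have "continuous_map (top_of_set {0..1}) (prod_topology (top_of_set {0..1}) bush) (\<lambda>r. (r, p))"
      using p sub' by (intro continuous_map_pairedI) auto
    then have path: "continuous_map (top_of_set {0..1}) bush (\<lambda>r. h (r, p))"
      using continuous_map_compose[OF _ h] by (simp add: o_def)
    let ?K = "{r \<in> {0..1}. h (r, p) \<in> frontier_part \<alpha>}"
    have "closedin (top_of_set {0..1}) ?K"
      using closedin_continuous_map_preimage[OF path clo] by simp
    then have "closed ?K" using closedin_closed_trans by blast
    moreover have "D \<subseteq> ?K" using D(2) dense p by blast
    ultimately have "closure D \<subseteq> ?K" by (rule closure_minimal[rotated])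
    then show ?thesis using t D(3) by blast
  qed
  then show ?thesis using \<alpha>(1) by blast
qed

lemma edge_point_frontier:
  assumes v: "(\<alpha>', u) \<in> branches" and \<alpha>: "\<alpha> < \<alpha>'" "bottom_level < \<alpha>"
  shows "chart (\<alpha>', u) (height u \<alpha>, 0) \<in> frontier_part \<alpha>"
proof -
  let ?x = "chart (\<alpha>', u) (height u \<alpha>, 0)"
  have "\<exists>y. y \<in> initial_part \<alpha> \<and> y \<in> T" if T: "?x \<in> T" "openin bush T" for T
  proof -
    have "open {p \<in> strip (\<alpha>', u). chart (\<alpha>', u) p \<in> T}"
      using T(2) v by (simp add: bush.openin_glued)
    moreover have "(height u \<alpha>, 0) \<in> {p \<in> strip (\<alpha>', u). chart (\<alpha>', u) p \<in> T}"
      using T(1) edge_point(1)[OF v \<alpha>(1)] by simp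
    ultimately obtain r where r: "0 < r" "ball (height u \<alpha>, 0) r \<subseteq> {p \<in> strip (\<alpha>', u). chart (\<alpha>', u) p \<in> T}"
      by (meson openE)
    let ?c = "height u \<alpha> - r / 2"
    have "(?c, 0) \<in> ball (height u \<alpha>, 0) r"
      using r(1) by (simp add: dist_Pair_Pair dist_real_def)
    then have c: "(?c, 0) \<in> strip (\<alpha>', u)" "chart (\<alpha>', u) (?c, 0) \<in> T" using r(2) by auto
    obtain \<beta> where \<beta>: "\<beta> < \<alpha>" "in_block u \<beta> ?c"
      using in_block_exists[OF branch_prefix[OF v \<alpha>(2) less_imp_le[OF \<alpha>(1)]], of ?c] r(1) by auto
    have "level (chart (\<alpha>', u) (?c, 0)) = \<beta>"
      using level_chart(1)[OF v c(1) less_trans[OF \<beta>(1) \<alpha>(1)] \<beta>(2)] .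
    then show ?thesis
      using c \<beta>(1) chart_in_bush[OF v c(1)] by (auto simp: initial_part_def)
  qed
  then have "?x \<in> bush closure_of initial_part \<alpha>"
    using edge_point(5)[OF v \<alpha>(1)] by (simp add: in_closure_of)
  then show ?thesis
    using edge_point(3)[OF v \<alpha>(1)] by (simp add: frontier_part_def initial_part_def)
qed

text \<open>
  The strip of a branch meets the frontier only in the interval at the node of level \<open>\<alpha>\<close> of this branch.
\<close>

lemma frontier_part_pieces:
  assumes b: "b \<in> frontier_part \<alpha>"
  shows "\<exists>U. openin bush U \<and> b \<in> U \<and> (\<forall>b'\<in>U \<inter> frontier_part \<alpha>. node b' = node b)"
proof -
  have level: "\<beta> = \<alpha> \<and> node x = below \<alpha> u"
    if x: "x \<in> frontier_part \<alpha>" and v: "(\<alpha>', u) \<in> branches" "(c, \<sigma>) \<in> strip (\<alpha>', u)" "x = chart (\<alpha>', u) (c, \<sigma>)"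
      and \<beta>: "\<beta> < \<alpha>'" "in_block u \<beta> c" for x \<alpha>' u c \<sigma> \<beta>
  proof -
    have "level x = \<beta>" "node x = below \<beta> u" using level_chart[OF v(1,2) \<beta>] v(3) by auto
    moreover have "x \<in> bush closure_of initial_part \<alpha>" "\<not> level x < \<alpha>"
      using x chart_in_bush[OF v(1,2)] v(3) by (auto simp: frontier_part_def initial_part_def)
    ultimately show ?thesis using closure_initial_part[OF _ v \<beta>] by blast
  qed
  have "b \<in> topspace bush" using b by (simp add: frontier_part_def in_closure_of)
  then obtain \<alpha>' u \<beta> c \<sigma> where v: "(\<alpha>', u) \<in> branches" "(c, \<sigma>) \<in> strip (\<alpha>', u)" "b = chart (\<alpha>', u) (c, \<sigma>)"
    and \<beta>: "\<beta> < \<alpha>'" "in_block u \<beta> c"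
    by (rule bush_pointE) blast
  let ?U = "chart (\<alpha>', u) ` strip (\<alpha>', u)"
  have "openin bush ?U" using bush.chart_open[OF v(1) bush.open_S[OF v(1)] order_refl] .
  moreover have "b \<in> ?U" unfolding v(3) using v(2) by (rule imageI)
  moreover have "node b' = node b" if b': "b' \<in> ?U \<inter> frontier_part \<alpha>" for b'
  proof -
    obtain c' \<sigma>' where c': "(c', \<sigma>') \<in> strip (\<alpha>', u)" "b' = chart (\<alpha>', u) (c', \<sigma>')" using b' by auto
    obtain \<gamma> where "\<gamma> < \<alpha>'" "in_block u \<gamma> c'" using in_block_exists[OF v(1), of c'] c'(1) by auto
    then have "node b' = below \<alpha> u" using level[OF _ v(1) c'] b' by blast
    then show ?thesis using level[OF b v \<beta>] by simp
  qed
  ultimately show ?thesis by blast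
qed

text \<open>
  The value \<open>f j\<close> is read off from a branch with lowest label \<open>j\<close>: the shear moves the label of the next
  level by \<open>f j\<close>, and an isotopy cannot change the node of a frontier point.
\<close>

theorem lepoll_mapping_class_group_bush:
  "(UNIV :: (int \<Rightarrow> int) set) \<lesssim> carrier (mapping_class_group bush)"
proof (rule lepoll_mapping_class_group)
  show "homeomorphic_map bush bush (bush_shear f)" for f
    by (rule homeomorphic_map_bush_shear)
  fix f g :: "int \<Rightarrow> int" assume "isotopic bush (bush_shear f) (bush_shear g)"
  then obtain h where h: "continuous_map (prod_topology (top_of_set {0..1::real}) bush) bush h"
    "\<And>x. h (0, x) = bush_shear f x" "\<And>x. h (1, x) = bush_shear g x"
    "\<And>t. t \<in> {0..1} \<Longrightarrow> homeomorphic_map bush bush (\<lambda>x. h (t, x))"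
    by (rule isotopicE) blast
  obtain \<alpha> where \<alpha>: "second_level < \<alpha>" "\<And>t p. t \<in> {0..1} \<Longrightarrow> p \<in> frontier_part \<alpha> \<Longrightarrow> h (t, p) \<in> frontier_part \<alpha>"
    using isotopy_invariant_frontier[OF h(1,4)] by blast
  obtain \<alpha>' where \<alpha>': "\<alpha> < \<alpha>'" using greater_w1 by blast
  have bottom_level\<alpha>: "bottom_level < \<alpha>" using bottom_level_less_second_level \<alpha>(1) by (rule less_trans)
  have "f j = g j" for j
  proof -
    let ?u = "(coherent_family \<alpha>')(bottom_level := j)"
    have u: "(\<alpha>', ?u) \<in> branches"
      using less_trans[OF bottom_level\<alpha> \<alpha>'] by (intro branch_update) (simp add: branches_def eq_mod_finite_refl)
    let ?p = "chart (\<alpha>', ?u) (height ?u \<alpha>, 0)"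
    have p: "?p \<in> frontier_part \<alpha>" using edge_point_frontier[OF u \<alpha>' bottom_level\<alpha>] .
    have node: "node (bush_shear k ?p) = below \<alpha> (shear k ?u)" for k
      using bush_shear_chart[OF u edge_point(1)[OF u \<alpha>'], of k]
        edge_point(4)[OF shear_branch[OF u, of k] \<alpha>'] by simp
    have "node (h (0, ?p)) = node (h (1, ?p))"
    proof (rule isotopy_track_index[OF h(1)])
      show "?p \<in> topspace bush" using edge_point(5)[OF u \<alpha>'] .
      show "h (t, ?p) \<in> frontier_part \<alpha>" if "t \<in> {0..1}" for t using \<alpha>(2)[OF that p] .
    qed (rule frontier_part_pieces)
    then have "below \<alpha> (shear f ?u) second_level = below \<alpha> (shear g ?u) second_level" by (simp add: h node)
    then show ?thesis using \<alpha>(1) by (simp add: below_def shear_second_level)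
  qed
  then show "f = g" by blast
qed

lemma reals_lepoll_int_functions: "(UNIV :: real set) \<lesssim> (UNIV :: (int \<Rightarrow> int) set)"
proof -
  have "inj (\<lambda>(A :: nat set) k :: int. if k \<in> int ` A then 1 else 0 :: int)"
  proof (rule injI)
    fix A B :: "nat set"
    assume eq: "(\<lambda>k. if k \<in> int ` A then 1 else 0 :: int) = (\<lambda>k. if k \<in> int ` B then 1 else 0)"
    have "n \<in> A \<longleftrightarrow> n \<in> B" for n
      using fun_cong[OF eq, of "int n"] by (auto split: if_splits)
    then show "A = B" by blast
  qed
  then have "(UNIV :: nat set set) \<lesssim> (UNIV :: (int \<Rightarrow> int) set)" unfolding lepoll_def by blast
  then show ?thesis
    using nat_sets_eqpoll_reals eqpoll_sym eqpoll_imp_lepoll lepoll_trans by blast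
qed

section \<open>Both surfaces\<close>

theorem theorem7p4:
  shows "(contractible_space pruefer \<and>
          (UNIV :: real set) \<lesssim> carrier (mapping_class_group pruefer)) \<and>
         (\<exists>X :: real topology. surface X \<and> type_I X \<and> contractible_space X \<and>
            (UNIV :: real set) \<lesssim> carrier (mapping_class_group X))"
proof -
  have "(UNIV :: real set) \<lesssim> carrier (mapping_class_group bush)"
    using reals_lepoll_int_functions lepoll_mapping_class_group_bush by (rule lepoll_trans)
  then show ?thesis
    using contractible_pruefer lepoll_mapping_class_group_pruefer
      surface_bush type_I_bush contractible_bush by blast
qed

end
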